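(* Let $f\in\mathcal C^2(\mathbb R^d)$ with $m I_d\preceq D^2f\preceq M I_d$ for some $0<m\le M<\infty$, let $\kappa:=M/m$ and $\pi(dx)\propto e^{-f(x)}dx$. Let $\gamma_n:=h\in(0,\frac2{m+M})$ be the constant step-size in the RLMC algorithm and let $\pi_h$ be the stationary distribution of the resulting Markov chain. Then $$W_2(\pi,\pi_h)\le 3\sqrt{dh}\;\frac{(1+2Mh)^2}{\kappa^{-1}-Mh/\sqrt3}.$$
   Context: RLMC algorithm (randomized midpoint discretization of $dx(t)=-\nabla f(x(t))dt+\sqrt2\,dW(t)$) with step-sizes $(\gamma_n)$: from an initial point $x_0$, $$x_{n+\frac12}=x_n-\alpha_{n+1}\gamma_{n+1}\nabla f(x_n)+\sqrt{2\alpha_{n+1}\gamma_{n+1}}\,U'_{n+1},\qquad x_{n+1}=x_n-\gamma_{n+1}\nabla f(x_{n+\frac12})+\sqrt{2\gamma_{n+1}}\,U_{n+1},$$ where $(\alpha_n)$ are i.i.d. uniform on $[0,1]$, and $(U_n)$, $(U'_n)$ are i.i.d. sequences of $d$-dimensional standard Gaussian vectors such that, given $\alpha_n$, the cross-covariance matrix of $U_n$ and $U'_n$ is $\sqrt{\alpha_n}I_d$; the triples $(\alpha_n,U_n,U_n')$ are independent over $n$ and of $x_0$. $W_2$ is the Wasserstein-2 distance with respect to the Euclidean norm.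
   Formalization: The formal statement additionally assumes κ^{-1} − Mh/√3 > 0; for some h in (0, 2/(m+M)) this denominator is zero or negative, and the bound is then undefined or negative and so fails. *)

theory Defs
  imports "HOL-Probability.Probability"
begin

subsection \<open>Twice continuously differentiable functions and the Loewner order\<close>

definition gradient :: "(real^'n \<Rightarrow> real) \<Rightarrow> real^'n \<Rightarrow> real^'n" where
  "gradient f x = (THE D. GDERIV f x :> D)"

definition hessian :: "(real^'n \<Rightarrow> real) \<Rightarrow> real^'n \<Rightarrow> real^'n^'n" where
  "hessian f x = matrix (frechet_derivative (gradient f) (at x))"

definition C2 :: "(real^'n \<Rightarrow> real) \<Rightarrow> bool" where
  "C2 f \<longleftrightarrow> (\<forall>x. f differentiable (at x)) \<and> (\<forall>x. gradient f differentiable (at x)) \<and>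
     continuous_on UNIV (hessian f)"

text \<open>Loewner order. It is only applied to symmetric matrices here (multiples of the identity and
  Hessians of C2 functions), so symmetry of the difference is not part of the definition.\<close>

definition loewner_le :: "real^'n^'n \<Rightarrow> real^'n^'n \<Rightarrow> bool" where
  "loewner_le A B \<longleftrightarrow> (\<forall>v. 0 \<le> v \<bullet> ((B - A) *v v))"

subsection \<open>The target distribution\<close>

definition gibbs :: "(real^'n \<Rightarrow> real) \<Rightarrow> (real^'n) measure" where
  "gibbs f = density lborel (\<lambda>x. ennreal (exp (- f x) / (LINT y|lborel. exp (- f y))))"

subsection \<open>The Wasserstein-2 distance\<close>

definition couplings :: "'a measure \<Rightarrow> 'b measure \<Rightarrow> ('a \<times> 'b) measure set" where
  "couplings \<mu> \<nu> = {\<rho>. sets \<rho> = sets (\<mu> \<Otimes>\<^sub>M \<nu>) \<and> distr \<rho> \<mu> fst = \<mu> \<and> distr \<rho> \<nu> snd = \<nu>}"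

definition esqrt :: "ennreal \<Rightarrow> ennreal" where
  "esqrt t = (if t = \<infinity> then \<infinity> else ennreal (sqrt (enn2real t)))"

definition W2 :: "'a::euclidean_space measure \<Rightarrow> 'a measure \<Rightarrow> ennreal" where
  "W2 \<mu> \<nu> = esqrt (INF \<rho> \<in> couplings \<mu> \<nu>. \<integral>\<^sup>+ z. ennreal ((dist (fst z) (snd z))\<^sup>2) \<partial>\<rho>)"

subsection \<open>The randomized midpoint (RLMC) chain\<close>

definition std_gaussian :: "'a::euclidean_space measure" where
  "std_gaussian = density lborel (\<lambda>x. ennreal (\<Prod>b\<in>Basis. std_normal_density (x \<bullet> b)))"

text \<open>Joint law of the triple consisting of \<open>\<alpha>\<close>, \<open>U\<close> and \<open>U'\<close>, in this order: \<open>\<alpha>\<close> is uniform on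
  the unit interval and, given \<open>\<alpha> = a\<close>, the pair of \<open>U\<close> and \<open>U'\<close> is centred jointly Gaussian with
  identity covariances and cross-covariance \<open>sqrt a\<close> times the identity. This conditional law is
  realised from independent standard Gaussians \<open>Z\<close> and \<open>V\<close> as \<open>U = sqrt a Z + sqrt (1 - a) V\<close>,
  \<open>U' = Z\<close>.\<close>

definition rlmc_noise :: "(real \<times> (real^'n) \<times> (real^'n)) measure" where
  "rlmc_noise =
     distr (uniform_measure lborel {0..1} \<Otimes>\<^sub>M std_gaussian \<Otimes>\<^sub>M std_gaussian) borel
       (\<lambda>(a, z, v). (a, sqrt a *\<^sub>R z + sqrt (1 - a) *\<^sub>R v, z))"

definition rlmc_midpoint ::
    "(real^'n \<Rightarrow> real) \<Rightarrow> real \<Rightarrow> real^'n \<Rightarrow> real \<Rightarrow> real^'n \<Rightarrow> real^'n" where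
  "rlmc_midpoint f \<gamma> x a u' =
     x - (a * \<gamma>) *\<^sub>R gradient f x + sqrt (2 * a * \<gamma>) *\<^sub>R u'"

definition rlmc_step ::
    "(real^'n \<Rightarrow> real) \<Rightarrow> real \<Rightarrow> real^'n \<Rightarrow> real \<times> (real^'n) \<times> (real^'n) \<Rightarrow> real^'n" where
  "rlmc_step f \<gamma> x = (\<lambda>(a, u, u').
     x - \<gamma> *\<^sub>R gradient f (rlmc_midpoint f \<gamma> x a u') + sqrt (2 * \<gamma>) *\<^sub>R u)"

text \<open>Since the noise triples are independent over the iterations and of the initial point, the
  iterates form a Markov chain whose transition from time \<open>n\<close> to \<open>n + 1\<close> is
  \<open>rlmc_kernel f (\<gamma> (n + 1))\<close>; it is time-homogeneous for a constant step-size.\<close>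

definition rlmc_kernel :: "(real^'n \<Rightarrow> real) \<Rightarrow> real \<Rightarrow> real^'n \<Rightarrow> (real^'n) measure" where
  "rlmc_kernel f \<gamma> x = distr rlmc_noise borel (rlmc_step f \<gamma> x)"

definition stationary_distribution ::
    "('a::topological_space \<Rightarrow> 'a measure) \<Rightarrow> 'a measure \<Rightarrow> bool" where
  "stationary_distribution K \<mu> \<longleftrightarrow>
     prob_space \<mu> \<and> sets \<mu> = sets borel \<and> \<mu> \<bind> K = \<mu>"

end

theory Submission
  imports Defs
begin

text \<open>The randomized midpoint kernel contracts \<open>W\<^sub>2\<close> by the factor \<open>1 - m h + M\<^sup>2 h\<^sup>2 / sqrt 3\<close> when
  two copies are driven by the same noise, so it suffices to couple \<open>\<pi>\<close> with its own image under one
  step up to an error of order \<open>M h sqrt (d h)\<close>. Usually this is done with the stationary Langevin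
  diffusion. Here the diffusion on \<open>[0, h]\<close> is replaced by \<open>k\<close> steps, of size \<open>h / k\<close>, of the
  Metropolis-adjusted Langevin chain: it leaves \<open>\<pi>\<close> exactly invariant, its Gaussian increments add
  up to the increment of the midpoint step, and the contribution of the rejected moves vanishes as
  \<open>k\<close> tends to infinity.\<close>

section \<open>Square-integrable bounds and measure-preserving maps\<close>

text \<open>Working with the diffusion itself would call for existence and stationarity of solutions
  of a stochastic differential equation; the Metropolis chain needs finitely many Gaussians and
  detailed balance. A plain Euler chain would not do, since its invariant law is biased. The defects
  of the rejected moves add up in L2 over \<open>k\<close> steps, so each has to be o(1/k): the
  squared displacement being O(1/k), the rejection probability must be o(1/k), which is what the
  cancellation in \<open>trapezoid_error\<close> supplies. The local error is counted twice because
  the chain and the midpoint step are both compared with the Euler step that freezes the gradient at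
  the starting point; in both cases the gradient is wanted at a point whose L2 distance from the
  start is, up to rejections, at most \<open>sqrt (2 h d) + h sqrt (M d)\<close>. The chain fixes
  the Gaussian increment, that is \<open>U\<close>, so \<open>U'\<close> has to be sampled given
  \<open>U\<close> and \<alpha>, against the order of \<open>rlmc_noise\<close>. The contraction
  yields \<open>D <= c D + 2 E\<close> for the distance \<open>D\<close>, rate \<open>c\<close> and
  local error \<open>E\<close>; this can be solved for \<open>D\<close> only once \<open>D\<close>
  is known to be finite, hence the second-moment bounds on both laws.\<close>

definition L2_le :: "'a measure \<Rightarrow> ('a \<Rightarrow> 'b::real_normed_vector) \<Rightarrow> real \<Rightarrow> bool" where
  "L2_le M X c \<longleftrightarrow> X \<in> borel_measurable M \<and> 0 \<le> c \<and>
     (\<integral>\<^sup>+x. ennreal ((norm (X x))\<^sup>2) \<partial>M) \<le> ennreal (c\<^sup>2)"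

lemma L2_leD:
  assumes "L2_le M X c"
  shows "X \<in> borel_measurable M" "0 \<le> c" "(\<integral>\<^sup>+x. ennreal ((norm (X x))\<^sup>2) \<partial>M) \<le> ennreal (c\<^sup>2)"
  using assms by (auto simp: L2_le_def)

lemma L2_le_mono:
  assumes "L2_le M Y c" "X \<in> borel_measurable M" "AE x in M. norm (X x) \<le> norm (Y x)" "c \<le> c'"
  shows "L2_le M X c'"
proof -
  have "(\<integral>\<^sup>+x. ennreal ((norm (X x))\<^sup>2) \<partial>M) \<le> (\<integral>\<^sup>+x. ennreal ((norm (Y x))\<^sup>2) \<partial>M)"
    using assms(3) by (intro nn_integral_mono_AE) (auto elim!: eventually_mono intro!: ennreal_leI power_mono)
  also have "\<dots> \<le> ennreal (c\<^sup>2)" using assms(1) by (simp add: L2_le_def)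
  also have "\<dots> \<le> ennreal (c'\<^sup>2)"
    using assms(1,4) by (intro ennreal_leI power_mono) (auto simp: L2_le_def)
  finally show ?thesis using assms by (auto simp: L2_le_def)
qed

lemma L2_le_scaleR:
  fixes X :: "'a \<Rightarrow> 'b::{second_countable_topology,real_normed_vector}"
  assumes "L2_le M X c"
  shows "L2_le M (\<lambda>x. r *\<^sub>R X x) (\<bar>r\<bar> * c)"
proof -
  note [measurable] = L2_leD(1)[OF assms]
  have "(\<integral>\<^sup>+x. ennreal ((norm (r *\<^sub>R X x))\<^sup>2) \<partial>M) = (\<integral>\<^sup>+x. ennreal (r\<^sup>2) * ennreal ((norm (X x))\<^sup>2) \<partial>M)"
    by (intro nn_integral_cong) (simp add: power_mult_distrib ennreal_mult)
  also have "\<dots> = ennreal (r\<^sup>2) * (\<integral>\<^sup>+x. ennreal ((norm (X x))\<^sup>2) \<partial>M)"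
    by (rule nn_integral_cmult) simp
  also have "\<dots> \<le> ennreal (r\<^sup>2) * ennreal (c\<^sup>2)"
    using L2_leD(3)[OF assms] by (rule mult_left_mono) simp
  also have "\<dots> = ennreal ((\<bar>r\<bar> * c)\<^sup>2)" by (simp add: power_mult_distrib ennreal_mult)
  finally show ?thesis using L2_leD(2)[OF assms] by (simp add: L2_le_def)
qed

text \<open>Covers the degenerate case of the triangle inequality, where the optimal weight
  \<open>b / a\<close> is zero or undefined.\<close>

lemma L2_le_zero_AE:
  fixes X :: "'a \<Rightarrow> 'b::{second_countable_topology,real_normed_vector}"
  assumes "L2_le M X 0"
  shows "AE x in M. X x = 0"
proof -
  note [measurable] = L2_leD(1)[OF assms]
  have "(\<integral>\<^sup>+x. ennreal ((norm (X x))\<^sup>2) \<partial>M) = 0"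
    using L2_leD(3)[OF assms] by simp
  then show ?thesis by (subst (asm) nn_integral_0_iff_AE) (auto simp: ennreal_eq_0_iff)
qed

lemma square_add_le_weighted:
  fixes a b t :: real
  assumes "0 < t"
  shows "(a + b)\<^sup>2 \<le> (1 + t) * a\<^sup>2 + (1 + 1 / t) * b\<^sup>2"
proof -
  have "(1 + t) * a\<^sup>2 + (1 + 1 / t) * b\<^sup>2 - (a + b)\<^sup>2 = (t * a - b)\<^sup>2 / t"
    using assms by (simp add: field_simps power2_eq_square)
  moreover have "\<dots> \<ge> 0" using assms by simp
  ultimately show ?thesis by linarith
qed

text \<open>Minkowski's inequality for bounds instead of norms, which spares integrability
  conditions. The weighted inequality for squares is integrated and the weight then
  optimised.\<close>

lemma L2_le_add:
  fixes X Y :: "'a \<Rightarrow> 'b::{second_countable_topology,real_normed_vector}"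
  assumes X: "L2_le M X a" and Y: "L2_le M Y b"
  shows "L2_le M (\<lambda>x. X x + Y x) (a + b)"
proof -
  note [measurable] = L2_leD(1)[OF X] L2_leD(1)[OF Y]
  have nn: "0 \<le> a" "0 \<le> b" using X Y by (auto simp: L2_le_def)
  consider "a = 0" | "b = 0" | "0 < a" "0 < b" using nn by force
  then show ?thesis
  proof cases
    case 1
    then have "AE x in M. X x = 0" using X L2_le_zero_AE by blast
    then show ?thesis using 1
      by (intro L2_le_mono[OF Y]) (auto elim!: eventually_mono)
  next
    case 2
    then have "AE x in M. Y x = 0" using Y L2_le_zero_AE by blast
    then show ?thesis using 2
      by (intro L2_le_mono[OF X]) (auto elim!: eventually_mono)
  next
    case 3
    \<comment> \<open>The weight minimising \<open>(1 + t) * a^2 + (1 + 1 / t) * b^2\<close>; the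
      minimum is exactly \<open>(a + b)^2\<close>.\<close>
    define t where "t = b / a"
    have t: "0 < t" using 3 by (simp add: t_def)
    have "(\<integral>\<^sup>+x. ennreal ((norm (X x + Y x))\<^sup>2) \<partial>M)
        \<le> (\<integral>\<^sup>+x. ennreal (1 + t) * ennreal ((norm (X x))\<^sup>2) + ennreal (1 + 1 / t) * ennreal ((norm (Y x))\<^sup>2) \<partial>M)"
    proof (intro nn_integral_mono)
      fix x
      have "(norm (X x + Y x))\<^sup>2 \<le> (norm (X x) + norm (Y x))\<^sup>2"
        by (intro power_mono norm_triangle_ineq) simp
      also have "\<dots> \<le> (1 + t) * (norm (X x))\<^sup>2 + (1 + 1 / t) * (norm (Y x))\<^sup>2"
        by (rule square_add_le_weighted[OF t])
      finally show "ennreal ((norm (X x + Y x))\<^sup>2)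
        \<le> ennreal (1 + t) * ennreal ((norm (X x))\<^sup>2) + ennreal (1 + 1 / t) * ennreal ((norm (Y x))\<^sup>2)"
        using t by (simp add: ennreal_mult[symmetric] ennreal_plus[symmetric] ennreal_leI del: ennreal_plus)
    qed
    also have "\<dots> = ennreal (1 + t) * (\<integral>\<^sup>+x. ennreal ((norm (X x))\<^sup>2) \<partial>M)
        + ennreal (1 + 1 / t) * (\<integral>\<^sup>+x. ennreal ((norm (Y x))\<^sup>2) \<partial>M)"
      by (simp add: nn_integral_add nn_integral_cmult)
    also have "\<dots> \<le> ennreal (1 + t) * ennreal (a\<^sup>2) + ennreal (1 + 1 / t) * ennreal (b\<^sup>2)"
      by (intro add_mono mult_left_mono L2_leD(3)[OF X] L2_leD(3)[OF Y]) auto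
    also have "\<dots> = ennreal ((1 + t) * a\<^sup>2 + (1 + 1 / t) * b\<^sup>2)"
      using t by (simp add: ennreal_mult[symmetric] ennreal_plus[symmetric] del: ennreal_plus)
    also have "(1 + t) * a\<^sup>2 + (1 + 1 / t) * b\<^sup>2 = (a + b)\<^sup>2"
      using 3 by (simp add: t_def field_simps power2_eq_square)
    finally show ?thesis using nn by (simp add: L2_le_def)
  qed
qed

text \<open>Read probabilistically: the random variable \<open>T\<close> on \<open>M\<close> has law
  \<open>N\<close>, and independence is expressed by a product \<open>N\<close>. A coupling is then
  a pair of such maps on a common space.\<close>

definition preserves :: "'a measure \<Rightarrow> 'b measure \<Rightarrow> ('a \<Rightarrow> 'b) \<Rightarrow> bool" where
  "preserves M N T \<longleftrightarrow> T \<in> M \<rightarrow>\<^sub>M N \<and> distr M N T = N"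

lemma preservesD: "preserves M N T \<Longrightarrow> T \<in> M \<rightarrow>\<^sub>M N"
  by (simp add: preserves_def)

lemma preserves_nn_integral:
  assumes "preserves M N T" "g \<in> borel_measurable N"
  shows "(\<integral>\<^sup>+x. g (T x) \<partial>M) = (\<integral>\<^sup>+y. g y \<partial>N)"
proof -
  have "(\<integral>\<^sup>+y. g y \<partial>N) = (\<integral>\<^sup>+y. g y \<partial>distr M N T)" using assms by (simp add: preserves_def)
  also have "\<dots> = (\<integral>\<^sup>+x. g (T x) \<partial>M)"
    using assms by (intro nn_integral_distr) (auto simp: preserves_def)
  finally show ?thesis by simp
qed

lemma preservesI:
  assumes T[measurable]: "T \<in> M \<rightarrow>\<^sub>M N"
    and eq: "\<And>g. g \<in> borel_measurable N \<Longrightarrow> (\<integral>\<^sup>+x. g (T x) \<partial>M) = (\<integral>\<^sup>+y. g y \<partial>N)"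
  shows "preserves M N T"
  unfolding preserves_def
proof (intro conjI T measure_eqI)
  fix A assume "A \<in> sets (distr M N T)"
  then have [measurable]: "A \<in> sets N" by simp
  have "emeasure (distr M N T) A = (\<integral>\<^sup>+y. indicator A y \<partial>distr M N T)"
    by (subst nn_integral_indicator) auto
  also have "\<dots> = (\<integral>\<^sup>+x. indicator A (T x) \<partial>M)"
    by (rule nn_integral_distr) auto
  also have "\<dots> = (\<integral>\<^sup>+y. indicator A y \<partial>N)" by (rule eq) simp
  also have "\<dots> = emeasure N A" by simp
  finally show "emeasure (distr M N T) A = emeasure N A" .
qed simp

lemma preserves_comp:
  assumes "preserves M N T" "preserves N K S"
  shows "preserves M K (\<lambda>x. S (T x))"
  using assms by (auto simp: preserves_def distr_distr[symmetric, unfolded comp_def] intro: measurable_compose)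

lemma preserves_prob_space:
  assumes "preserves M N T" "prob_space M"
  shows "prob_space N"
  using assms prob_space.prob_space_distr unfolding preserves_def by metis

lemma preserves_id: "preserves M M (\<lambda>x. x)"
  by (simp add: preserves_def distr_id2)

lemma preserves_prod:
  assumes f: "preserves M N f" and g: "preserves M' N' g" and "prob_space M" "prob_space M'"
  shows "preserves (M \<Otimes>\<^sub>M M') (N \<Otimes>\<^sub>M N') (\<lambda>(x, y). (f x, g y))"
proof -
  note [measurable] = preservesD[OF f] preservesD[OF g]
  have N': "prob_space N'" using preserves_prob_space[OF g assms(4)] .
  have "distr M N f \<Otimes>\<^sub>M distr M' N' g = distr (M \<Otimes>\<^sub>M M') (N \<Otimes>\<^sub>M N') (\<lambda>(x, y). (f x, g y))"
    using N' g by (intro pair_measure_distr) (auto simp: preserves_def prob_space_imp_sigma_finite)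
  then show ?thesis using f g by (simp add: preserves_def)
qed

lemma preserves_fst:
  assumes "prob_space N" shows "preserves (M \<Otimes>\<^sub>M N) M fst"
  using assms by (simp add: preserves_def prob_space.distr_pair_fst)

lemma preserves_snd:
  assumes "prob_space M" "prob_space N" shows "preserves (M \<Otimes>\<^sub>M N) N snd"
proof (rule preservesI)
  interpret M: prob_space M by fact
  interpret N: prob_space N by fact
  fix g :: "'b \<Rightarrow> ennreal" assume [measurable]: "g \<in> borel_measurable N"
  show "(\<integral>\<^sup>+x. g (snd x) \<partial>(M \<Otimes>\<^sub>M N)) = (\<integral>\<^sup>+y. g y \<partial>N)"
    by (subst N.nn_integral_fst[symmetric]) (auto simp: M.emeasure_space_1)
qed simp

text \<open>Lets the head of a noise stream be set apart from the initial point and the rest of the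
  stream.\<close>

lemma preserves_swap_assoc:
  assumes "prob_space A" "prob_space B" "prob_space C"
  shows "preserves (A \<Otimes>\<^sub>M (B \<Otimes>\<^sub>M C)) ((A \<Otimes>\<^sub>M C) \<Otimes>\<^sub>M B) (\<lambda>(x, s, w). ((x, w), s))"
proof (rule preservesI)
  interpret A: prob_space A by fact
  interpret B: prob_space B by fact
  interpret C: prob_space C by fact
  interpret BC': prob_space "B \<Otimes>\<^sub>M C" by (rule prob_space_pair) fact+
  interpret BC: pair_sigma_finite B C ..
  fix g :: "('a \<times> 'c) \<times> 'b \<Rightarrow> ennreal" assume [measurable]: "g \<in> borel_measurable ((A \<Otimes>\<^sub>M C) \<Otimes>\<^sub>M B)"
  have "(\<integral>\<^sup>+x. g (case x of (x, s, w) \<Rightarrow> ((x, w), s)) \<partial>(A \<Otimes>\<^sub>M (B \<Otimes>\<^sub>M C)))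
      = (\<integral>\<^sup>+x. \<integral>\<^sup>+s. \<integral>\<^sup>+w. g ((x, w), s) \<partial>C \<partial>B \<partial>A)"
    apply (subst BC'.nn_integral_fst[symmetric])
     apply simp
    apply (intro nn_integral_cong)
    apply (subst C.nn_integral_fst[symmetric])
     apply auto
    done
  also have "\<dots> = (\<integral>\<^sup>+x. \<integral>\<^sup>+w. \<integral>\<^sup>+s. g ((x, w), s) \<partial>B \<partial>C \<partial>A)"
    by (intro nn_integral_cong BC.Fubini'[symmetric]) simp
  also have "\<dots> = (\<integral>\<^sup>+y. g y \<partial>((A \<Otimes>\<^sub>M C) \<Otimes>\<^sub>M B))"
    by (subst B.nn_integral_fst[symmetric], simp, subst C.nn_integral_fst[symmetric]) auto
  finally show "(\<integral>\<^sup>+x. g (case x of (x, s, w) \<Rightarrow> ((x, w), s)) \<partial>(A \<Otimes>\<^sub>M (B \<Otimes>\<^sub>M C))) = (\<integral>\<^sup>+y. g y \<partial>((A \<Otimes>\<^sub>M C) \<Otimes>\<^sub>M B))" .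
qed simp

lemma L2_le_preserves:
  assumes X: "L2_le N X c" and T: "preserves M N T"
  shows "L2_le M (\<lambda>x. X (T x)) c"
proof -
  note [measurable] = L2_leD(1)[OF X] preservesD[OF T]
  have "(\<integral>\<^sup>+x. ennreal ((norm (X (T x)))\<^sup>2) \<partial>M) = (\<integral>\<^sup>+y. ennreal ((norm (X y))\<^sup>2) \<partial>N)"
    by (rule preserves_nn_integral[OF T]) simp
  then show ?thesis using X by (simp add: L2_le_def)
qed

section \<open>Smooth strongly convex functions\<close>

text \<open>Gradient and Hessian enter as plain functions tied to \<open>f\<close> by derivatives,
  which keeps description operators out of the calculus. Symmetry of \<open>H x\<close> is not part
  of the interface but derived in \<open>H_symmetric\<close>.\<close>

locale smooth_convex =
  fixes f :: "'a::euclidean_space \<Rightarrow> real" and g :: "'a \<Rightarrow> 'a" and H :: "'a \<Rightarrow> 'a \<Rightarrow> 'a"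
    and m M :: real
  assumes f_deriv: "\<And>x. (f has_derivative (\<lambda>v. g x \<bullet> v)) (at x)"
    and g_deriv: "\<And>x. (g has_derivative H x) (at x)"
    and H_lower: "\<And>x v. m * (v \<bullet> v) \<le> v \<bullet> H x v"
    and H_upper: "\<And>x v. v \<bullet> H x v \<le> M * (v \<bullet> v)"
    and m_pos: "0 < m" and m_le_M: "m \<le> M"
begin

lemma M_pos: "0 < M"
  using m_pos m_le_M by linarith

lemma H_linear: "linear (H x)"
  using g_deriv has_derivative_linear by blast

lemma continuous_f: "continuous_on UNIV f" and continuous_g: "continuous_on UNIV g"
  by (auto intro!: continuous_at_imp_continuous_on has_derivative_continuous[OF f_deriv]
      has_derivative_continuous[OF g_deriv])

lemma measurable_f [measurable]: "f \<in> borel_measurable borel"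
  and measurable_g [measurable]: "g \<in> borel_measurable borel"
  by (rule borel_measurable_continuous_onI[OF continuous_f]) (rule borel_measurable_continuous_onI[OF continuous_g])

lemma f_line_deriv:
  "((\<lambda>t. f (x + t *\<^sub>R v)) has_real_derivative g (x + t *\<^sub>R v) \<bullet> v) (at t)"
proof -
  have "((\<lambda>t. x + t *\<^sub>R v) has_derivative (\<lambda>s. s *\<^sub>R v)) (at t)"
    by (auto intro!: derivative_eq_intros)
  from has_derivative_compose[OF this f_deriv] show ?thesis
    by (simp add: has_field_derivative_def inner_commute mult.commute[of "v \<bullet> _"] mult_commute_abs)
qed

lemma g_line_deriv:
  "((\<lambda>t. w \<bullet> g (x + t *\<^sub>R v)) has_real_derivative w \<bullet> H (x + t *\<^sub>R v) v) (at t)"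
proof -
  have "((\<lambda>t. x + t *\<^sub>R v) has_derivative (\<lambda>s. s *\<^sub>R v)) (at t)"
    by (auto intro!: derivative_eq_intros)
  from has_derivative_inner_right[OF has_derivative_compose[OF this g_deriv], of w] show ?thesis
    by (simp add: has_field_derivative_def linear_scale[OF H_linear] mult_commute_abs)
qed

text \<open>The mean value theorem has no equality form for the vector-valued \<open>g\<close>;
  tested against a fixed \<open>w\<close> the scalar version applies, at a point that depends on
  \<open>w\<close>.\<close>

lemma g_mean_value:
  obtains t where "0 < t" "t < 1" "w \<bullet> (g (x + v) - g x) = w \<bullet> H (x + t *\<^sub>R v) v"
proof -
  have "\<exists>t>0. t < 1 \<and> w \<bullet> g (x + 1 *\<^sub>R v) - w \<bullet> g (x + 0 *\<^sub>R v) = (1 - 0) * (w \<bullet> H (x + t *\<^sub>R v) v)"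
    by (rule MVT2) (auto intro: g_line_deriv)
  then show ?thesis using that by (auto simp: inner_diff_right)
qed

lemma g_monotone: "m * (v \<bullet> v) \<le> v \<bullet> (g (x + v) - g x)"
  and g_monotone_upper: "v \<bullet> (g (x + v) - g x) \<le> M * (v \<bullet> v)"
proof -
  obtain t where "v \<bullet> (g (x + v) - g x) = v \<bullet> H (x + t *\<^sub>R v) v" using g_mean_value[of v x v] by blast
  then show "m * (v \<bullet> v) \<le> v \<bullet> (g (x + v) - g x)" "v \<bullet> (g (x + v) - g x) \<le> M * (v \<bullet> v)"
    using H_lower H_upper by simp_all
qed

text \<open>The derivative of the auxiliary function at \<open>t\<close> is nonpositive by
  \<open>g_monotone_upper\<close> for the increment \<open>t\<close> times \<open>v\<close>, divided
  by \<open>t\<close>; hence the separate case \<open>t = 0\<close>.\<close>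

lemma f_upper: "f (x + v) \<le> f x + g x \<bullet> v + M / 2 * (v \<bullet> v)"
proof -
  let ?\<psi> = "\<lambda>t. f (x + t *\<^sub>R v) - t * (g x \<bullet> v) - M / 2 * t\<^sup>2 * (v \<bullet> v)"
  have "?\<psi> 1 \<le> ?\<psi> 0"
  proof (rule DERIV_nonpos_imp_nonincreasing[of 0 1 ?\<psi>])
    fix t :: real assume t: "0 \<le> t" "t \<le> 1"
    have "(?\<psi> has_real_derivative g (x + t *\<^sub>R v) \<bullet> v - g x \<bullet> v - M * t * (v \<bullet> v)) (at t)"
      by (auto intro!: derivative_eq_intros f_line_deriv)
    moreover have "g (x + t *\<^sub>R v) \<bullet> v - g x \<bullet> v \<le> M * t * (v \<bullet> v)"
    proof (cases "t = 0")
      case False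
      have "t * (v \<bullet> (g (x + t *\<^sub>R v) - g x)) \<le> t * (M * t * (v \<bullet> v))"
        using g_monotone_upper[of "t *\<^sub>R v" x] by (simp add: mult.assoc mult.left_commute)
      then have "v \<bullet> (g (x + t *\<^sub>R v) - g x) \<le> M * t * (v \<bullet> v)"
        using False t by (simp only: mult_le_cancel_left_pos)
      then show ?thesis by (simp add: inner_diff_right inner_commute)
    qed simp
    ultimately show "\<exists>y. (?\<psi> has_real_derivative y) (at t) \<and> y \<le> 0" by (meson diff_le_0_iff_le)
  qed simp
  then show ?thesis by simp
qed

lemma f_lower: "f x + g x \<bullet> v + m / 2 * (v \<bullet> v) \<le> f (x + v)"
proof -
  let ?\<psi> = "\<lambda>t. f (x + t *\<^sub>R v) - t * (g x \<bullet> v) - m / 2 * t\<^sup>2 * (v \<bullet> v)"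
  have "?\<psi> 0 \<le> ?\<psi> 1"
  proof (rule DERIV_nonneg_imp_nondecreasing[of 0 1 ?\<psi>])
    fix t :: real assume t: "0 \<le> t" "t \<le> 1"
    have "(?\<psi> has_real_derivative g (x + t *\<^sub>R v) \<bullet> v - g x \<bullet> v - m * t * (v \<bullet> v)) (at t)"
      by (auto intro!: derivative_eq_intros f_line_deriv)
    moreover have "m * t * (v \<bullet> v) \<le> g (x + t *\<^sub>R v) \<bullet> v - g x \<bullet> v"
    proof (cases "t = 0")
      case False
      have "t * (m * t * (v \<bullet> v)) \<le> t * (v \<bullet> (g (x + t *\<^sub>R v) - g x))"
        using g_monotone[of "t *\<^sub>R v" x] by (simp add: mult.assoc mult.left_commute)
      then have "m * t * (v \<bullet> v) \<le> v \<bullet> (g (x + t *\<^sub>R v) - g x)"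
        using False t by (simp only: mult_le_cancel_left_pos)
      then show ?thesis by (simp add: inner_diff_right inner_commute)
    qed simp
    ultimately show "\<exists>y. (?\<psi> has_real_derivative y) (at t) \<and> 0 \<le> y" by (meson diff_ge_0_iff_ge)
  qed simp
  then show ?thesis by simp
qed

section \<open>Second-order expansion and symmetry of the Hessian\<close>

lemma g_expansion:
  assumes "0 < e"
  obtains d where "0 < d" "\<And>v. norm v < d \<Longrightarrow> norm (g (x + v) - g x - H x v) \<le> e * norm v"
proof -
  have "\<forall>e>0. \<exists>d>0. \<forall>y. norm (y - x) < d \<longrightarrow> norm (g y - g x - H x (y - x)) \<le> e * norm (y - x)"
    using g_deriv[of x] by (simp add: has_derivative_at_alt)
  then obtain d where d: "0 < d"
    and "\<forall>y. norm (y - x) < d \<longrightarrow> norm (g y - g x - H x (y - x)) \<le> e * norm (y - x)"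
    using assms by blast
  then have "norm (g (x + v) - g x - H x v) \<le> e * norm v" if "norm v < d" for v
    using that by (auto dest: spec[of _ "x + v"])
  with d show ?thesis by (rule that)
qed

text \<open>The mixed second difference is symmetric in \<open>a\<close> and \<open>b\<close>, its
  approximation is not visibly so. The mean value theorem is used in direction \<open>b\<close>
  only; the two gradients it produces are then expanded around \<open>x\<close>, so that
  \<open>H\<close> enters at the single point \<open>x\<close>.\<close>

lemma second_difference:
  assumes e: "0 < e"
    and d: "\<And>v. norm v < d \<Longrightarrow> norm (g (x + v) - g x - H x v) \<le> e * norm v"
    and ab: "norm a + norm b < d"
  shows "\<bar>f (x + a + b) - f (x + a) - f (x + b) + f x - b \<bullet> H x a\<bar> \<le> 2 * e * (norm a + norm b)\<^sup>2"
proof -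
  let ?\<phi> = "\<lambda>t. f (x + a + t *\<^sub>R b) - f (x + t *\<^sub>R b)"
  have "\<exists>t>0. t < 1 \<and> ?\<phi> 1 - ?\<phi> 0 = (1 - 0) * (g (x + a + t *\<^sub>R b) \<bullet> b - g (x + t *\<^sub>R b) \<bullet> b)"
    by (rule MVT2) (auto intro!: derivative_eq_intros f_line_deriv)
  then obtain t where t: "0 < t" "t < 1"
    and eq: "?\<phi> 1 - ?\<phi> 0 = g (x + a + t *\<^sub>R b) \<bullet> b - g (x + t *\<^sub>R b) \<bullet> b" by auto
  define e1 where "e1 = g (x + (a + t *\<^sub>R b)) - g x - H x (a + t *\<^sub>R b)"
  define e2 where "e2 = g (x + t *\<^sub>R b) - g x - H x (t *\<^sub>R b)"
  have tb: "norm (t *\<^sub>R b) \<le> norm b" using t by (simp add: mult_left_le_one_le)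
  have atb: "norm (a + t *\<^sub>R b) \<le> norm a + norm b" using norm_triangle_ineq[of a "t *\<^sub>R b"] tb by linarith
  have "norm e1 \<le> e * norm (a + t *\<^sub>R b)" unfolding e1_def using atb ab by (intro d) linarith
  also have "\<dots> \<le> e * (norm a + norm b)" using atb e by simp
  finally have 1: "norm e1 \<le> e * (norm a + norm b)" .
  have "norm e2 \<le> e * norm (t *\<^sub>R b)" unfolding e2_def using tb ab norm_ge_zero[of a] by (intro d) linarith
  also have "\<dots> \<le> e * (norm a + norm b)" using tb e norm_ge_zero[of a] by (intro mult_left_mono) linarith+
  finally have 2: "norm e2 \<le> e * (norm a + norm b)" .
  have "f (x + a + b) - f (x + a) - f (x + b) + f x - b \<bullet> H x a = b \<bullet> (e1 - e2)"
    using eq by (simp add: e1_def e2_def linear_add[OF H_linear] inner_diff_right inner_add_right inner_commute add.assoc)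
  then have "\<bar>f (x + a + b) - f (x + a) - f (x + b) + f x - b \<bullet> H x a\<bar> \<le> norm b * norm (e1 - e2)"
    using Cauchy_Schwarz_ineq2 by metis
  also have "\<dots> \<le> (norm a + norm b) * (2 * (e * (norm a + norm b)))"
    using norm_triangle_ineq4[of e1 e2] 1 2 by (intro mult_mono) auto
  finally show ?thesis by (simp add: power2_eq_square algebra_simps)
qed

text \<open>Schwarz's theorem: both sides, multiplied by \<open>s^2\<close>, approximate one and the
  same second difference, with an error that is an arbitrarily small multiple of
  \<open>s^2\<close>.\<close>

lemma H_symmetric: "v \<bullet> H x w = w \<bullet> H x v"
proof -
  define K where "K = (norm v + norm w)\<^sup>2"
  have "\<bar>v \<bullet> H x w - w \<bullet> H x v\<bar> \<le> 0 + e'" if e': "0 < e'" for e'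
  proof -
    \<comment> \<open>Two approximations cost \<open>2 * e * K\<close> each after division by
      \<open>s^2\<close>; the added 1 covers \<open>K = 0\<close>.\<close>
    define e where "e = e' / (4 * (K + 1))"
    have K: "0 \<le> K" by (simp add: K_def)
    have e: "0 < e" using K e' by (simp add: e_def)
    obtain d where d: "0 < d" "\<And>v. norm v < d \<Longrightarrow> norm (g (x + v) - g x - H x v) \<le> e * norm v"
      using g_expansion[OF e, of x] by blast
    \<comment> \<open>Scales both vectors into the ball of radius \<open>d\<close> in which the
      expansion of \<open>g\<close> is valid.\<close>
    define s where "s = d / (2 * (norm v + norm w + 1))"
    have pos: "0 < norm v + norm w + 1" by (simp add: add_nonneg_pos)
    have s: "0 < s" using d pos by (simp add: s_def)
    have "s * (norm v + norm w) < s * (2 * (norm v + norm w + 1))"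
      using s by (intro mult_strict_left_mono) (smt (verit) norm_ge_zero)+
    also have "\<dots> = d" using pos by (simp add: s_def)
    finally have sd: "norm (s *\<^sub>R v) + norm (s *\<^sub>R w) < d" using s by (simp add: algebra_simps)
    have sd': "norm (s *\<^sub>R w) + norm (s *\<^sub>R v) < d" using sd by simp
    let ?S = "f (x + s *\<^sub>R v + s *\<^sub>R w) - f (x + s *\<^sub>R v) - f (x + s *\<^sub>R w) + f x"
    have sq: "(norm (s *\<^sub>R v) + norm (s *\<^sub>R w))\<^sup>2 = s\<^sup>2 * K"
      using s by (simp add: K_def power2_eq_square algebra_simps)
    have 1: "\<bar>?S - s\<^sup>2 * (w \<bullet> H x v)\<bar> \<le> 2 * e * (s\<^sup>2 * K)"
      using second_difference[OF e d(2) sd] sq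
      by (simp add: linear_scale[OF H_linear] power2_eq_square mult.assoc)
    have S: "?S = f (x + s *\<^sub>R w + s *\<^sub>R v) - f (x + s *\<^sub>R w) - f (x + s *\<^sub>R v) + f x"
      by (simp add: add.assoc add.commute[of "s *\<^sub>R w"])
    have 2: "\<bar>?S - s\<^sup>2 * (v \<bullet> H x w)\<bar> \<le> 2 * e * (s\<^sup>2 * K)"
      using second_difference[OF e d(2) sd'] sq unfolding S
      by (simp add: linear_scale[OF H_linear] power2_eq_square mult.assoc add.commute[of "\<bar>s\<bar> * norm w"])
    have "s\<^sup>2 * \<bar>v \<bullet> H x w - w \<bullet> H x v\<bar> = \<bar>s\<^sup>2 * (v \<bullet> H x w) - s\<^sup>2 * (w \<bullet> H x v)\<bar>"
      by (simp add: right_diff_distrib[symmetric] abs_mult)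
    also have "\<dots> \<le> s\<^sup>2 * (4 * e * K)" using 1 2 by (simp add: algebra_simps)
    finally have "\<bar>v \<bullet> H x w - w \<bullet> H x v\<bar> \<le> 4 * e * K" using s by simp
    also have "\<dots> = e' * (K / (K + 1))" using K by (simp add: e_def divide_simps)
    also have "\<dots> \<le> e' * 1" using K e' by (intro mult_left_mono) auto
    finally show ?thesis by simp
  qed
  then have "\<bar>v \<bullet> H x w - w \<bullet> H x v\<bar> \<le> 0" by (rule field_le_epsilon)
  then show ?thesis by simp
qed

text \<open>For symmetric \<open>H\<close> this is the scalar inequality \<open>(\<lambda> - m) * (M - \<lambda>) \<ge> 0\<close> on the spectrum,
  obtained without diagonalising by testing \<open>H - m\<close> at \<open>v - s (H v - m v)\<close>.\<close>

lemma norm_H_square: "(norm (H x v))\<^sup>2 \<le> (m + M) * (v \<bullet> H x v) - m * M * (v \<bullet> v)"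
proof -
  define A where "A = (\<lambda>v. H x v - m *\<^sub>R v)"
  define L where "L = M - m"
  have L: "0 \<le> L" using m_le_M by (simp add: L_def)
  have A_lower: "0 \<le> u \<bullet> A u" and A_upper: "u \<bullet> A u \<le> L * (u \<bullet> u)" for u
    using H_lower[of u x] H_upper[of u x] by (auto simp: A_def L_def inner_diff_right algebra_simps)
  have A_sym: "u \<bullet> A w = w \<bullet> A u" for u w
    using H_symmetric[of u x w] by (simp add: A_def inner_diff_right inner_commute)
  have A_lin: "A (u - s *\<^sub>R w) = A u - s *\<^sub>R A w" for u w s
    by (simp add: A_def linear_diff[OF H_linear] linear_scale[OF H_linear] algebra_simps)
  have quad: "0 \<le> v \<bullet> A v - 2 * s * (A v \<bullet> A v) + s\<^sup>2 * (L * (A v \<bullet> A v))" for s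
  proof -
    have "0 \<le> (v - s *\<^sub>R A v) \<bullet> A (v - s *\<^sub>R A v)" by (rule A_lower)
    also have "\<dots> = v \<bullet> A v - 2 * s * (A v \<bullet> A v) + s\<^sup>2 * (A v \<bullet> A (A v))"
      using A_sym[of v "A v"] unfolding A_lin
      by (simp add: inner_diff_left inner_diff_right power2_eq_square algebra_simps)
    also have "\<dots> \<le> v \<bullet> A v - 2 * s * (A v \<bullet> A v) + s\<^sup>2 * (L * (A v \<bullet> A v))"
      using A_upper[of "A v"] by (intro add_left_mono mult_left_mono) auto
    finally show ?thesis .
  qed
  have "A v \<bullet> A v \<le> L * (v \<bullet> A v)"
  proof (cases "L = 0")
    case True
    then have "v \<bullet> A v = 0" using A_lower[of v] A_upper[of v] by simp
    then show ?thesis using quad[of 1] True by simp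
  next
    case False
    \<comment> \<open>The quadratic in \<open>s\<close> is smallest at \<open>1 / L\<close>; in the
      case \<open>L = 0\<close> above, \<open>s = 1\<close> already forces \<open>A v\<close> to
      vanish.\<close>
    then show ?thesis using quad[of "1 / L"] L by (simp add: field_simps power2_eq_square)
  qed
  moreover have "A v \<bullet> A v = (norm (H x v))\<^sup>2 - 2 * m * (v \<bullet> H x v) + m\<^sup>2 * (v \<bullet> v)"
    unfolding A_def inner_diff_left inner_diff_right power2_norm_eq_inner
    by (simp add: inner_commute[of "H x v" v] power2_eq_square algebra_simps)
  moreover have "L * (v \<bullet> A v) = (M - m) * (v \<bullet> H x v) - (M - m) * m * (v \<bullet> v)"
    by (simp add: A_def L_def inner_diff_right algebra_simps)
  ultimately show ?thesis by (simp add: algebra_simps power2_eq_square)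
qed

section \<open>Operator bounds and contraction of gradient steps\<close>

lemma norm_H_le: "norm (H x v) \<le> M * norm v"
proof (rule power2_le_imp_le)
  have "(m + M) * (v \<bullet> H x v) \<le> (m + M) * (M * (v \<bullet> v))"
    using H_upper m_pos M_pos by (intro mult_left_mono) auto
  then show "(norm (H x v))\<^sup>2 \<le> (M * norm v)\<^sup>2"
    using norm_H_square[of x v] by (simp add: power_mult_distrib dot_square_norm power2_eq_square algebra_simps)
qed (use M_pos in simp)

text \<open>On a spectrum in \<open>[m, M]\<close> this reads
  \<open>|1 - h \<lambda>| <= 1 - m h\<close>, true because \<open>h * (m + M) <= 2\<close>. After
  \<open>norm_H_square\<close> the coefficient of \<open>v \<bullet> H x v\<close> is
  \<open>- h * (2 - h * (m + M))\<close>, hence nonpositive; inserting the lower bound on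
  \<open>H\<close> leaves a perfect square.\<close>

lemma gradient_step_contraction:
  assumes h: "0 \<le> h" "h * (m + M) \<le> 2"
  shows "norm (v - h *\<^sub>R H x v) \<le> (1 - m * h) * norm v"
proof (rule power2_le_imp_le)
  have "m * h + m * h \<le> h * (m + M)" using mult_right_mono[OF m_le_M h(1)] by (simp add: algebra_simps)
  then have "0 \<le> 1 - m * h" using h by (simp add: mult.commute)
  then show "0 \<le> (1 - m * h) * norm v" by simp
  have "(norm (v - h *\<^sub>R H x v))\<^sup>2 = v \<bullet> v - 2 * h * (v \<bullet> H x v) + h\<^sup>2 * (norm (H x v))\<^sup>2"
    unfolding power2_norm_eq_inner inner_diff_left inner_diff_right
    by (simp add: inner_commute[of "H x v" v] power2_eq_square algebra_simps)
  also have "\<dots> \<le> v \<bullet> v - 2 * h * (v \<bullet> H x v) + h\<^sup>2 * ((m + M) * (v \<bullet> H x v) - m * M * (v \<bullet> v))"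
    by (intro add_left_mono mult_left_mono norm_H_square) simp
  also have "\<dots> = (1 - h\<^sup>2 * m * M) * (v \<bullet> v) - (h * (2 - h * (m + M))) * (v \<bullet> H x v)"
    by (simp add: power2_eq_square algebra_simps)
  also have "\<dots> \<le> (1 - h\<^sup>2 * m * M) * (v \<bullet> v) - (h * (2 - h * (m + M))) * (m * (v \<bullet> v))"
    using h by (intro diff_left_mono mult_left_mono H_lower mult_nonneg_nonneg) auto
  also have "\<dots> = ((1 - m * h) * norm v)\<^sup>2"
    by (simp add: power_mult_distrib dot_square_norm power2_eq_square algebra_simps)
  finally show "(norm (v - h *\<^sub>R H x v))\<^sup>2 \<le> ((1 - m * h) * norm v)\<^sup>2" .
qed

text \<open>Testing the mean value theorem against the increment itself produces its squared norm,
  and one factor cancels.\<close>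

lemma g_lipschitz_add: "norm (g (x + v) - g x) \<le> M * norm v"
proof -
  let ?w = "g (x + v) - g x"
  obtain t where "?w \<bullet> ?w = ?w \<bullet> H (x + t *\<^sub>R v) v" using g_mean_value[of ?w x v] by blast
  also have "\<dots> \<le> norm ?w * norm (H (x + t *\<^sub>R v) v)" by (rule norm_cauchy_schwarz)
  also have "\<dots> \<le> norm ?w * (M * norm v)" by (intro mult_left_mono norm_H_le) simp
  finally have "norm ?w * norm ?w \<le> norm ?w * (M * norm v)" by (simp add: dot_square_norm power2_eq_square)
  then show ?thesis
    using M_pos by (cases "norm ?w = 0") (auto simp: mult_le_cancel_left_pos)
qed

lemma g_lipschitz: "norm (g y - g x) \<le> M * norm (y - x)"
  using g_lipschitz_add[of x "y - x"] by simp

lemma g_expanding: "m * norm (y - x) \<le> norm (g y - g x)"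
proof -
  have "m * (norm (y - x) * norm (y - x)) \<le> norm (y - x) * norm (g y - g x)"
    using g_monotone[of "y - x" x] norm_cauchy_schwarz[of "y - x" "g y - g x"]
    by (simp add: dot_square_norm power2_eq_square)
  then show ?thesis
    by (cases "norm (y - x) = 0") (auto simp: mult_le_cancel_left_pos mult.left_commute)
qed

text \<open>Error of the trapezoidal rule along the segment from \<open>x\<close> to
  \<open>x + v\<close>. Up to sign it is the part of the log acceptance ratio of the Metropolis
  chain that carries no factor of the step size.\<close>

definition trapezoid_error :: "'a \<Rightarrow> 'a \<Rightarrow> real" where
  "trapezoid_error x v = f (x + v) - f x - (g x + g (x + v)) \<bullet> v / 2"

text \<open>Crude bound, meant for domination. The Taylor remainder of \<open>f\<close> and half of
  the increment of \<open>g\<close> along \<open>v\<close> both lie between 0 and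
  \<open>M / 2 * (v \<bullet> v)\<close>.\<close>

lemma trapezoid_error_le: "\<bar>trapezoid_error x v\<bar> \<le> M * (norm v)\<^sup>2"
proof -
  define p q where "p = g x \<bullet> v" and "q = g (x + v) \<bullet> v"
  have "0 \<le> m * (v \<bullet> v)" using m_pos by simp
  moreover have "m * (v \<bullet> v) \<le> q - p" "q - p \<le> M * (v \<bullet> v)"
    using g_monotone[of v x] g_monotone_upper[of v x]
    by (simp_all add: p_def q_def inner_diff_right inner_commute)
  moreover have "f (x + v) \<le> f x + p + M * (v \<bullet> v) / 2" "f x + p + m * (v \<bullet> v) / 2 \<le> f (x + v)"
    using f_upper[of x v] f_lower[of x v] by (simp_all add: p_def)
  moreover have "trapezoid_error x v = f (x + v) - f x - (p + q) / 2"
    by (simp add: trapezoid_error_def p_def q_def inner_add_left)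
  ultimately show ?thesis by (simp add: power2_norm_eq_inner abs_le_iff field_simps)
qed

text \<open>The second-order terms cancel: the expansion of \<open>f\<close> and the average of the
  two gradients both contribute half of \<open>v \<bullet> H x v\<close>. This is the source of the
  vanishing rejection rate.\<close>

lemma trapezoid_error_small:
  assumes e: "0 < e"
  obtains d where "0 < d" "\<And>v. norm v < d \<Longrightarrow> \<bar>trapezoid_error x v\<bar> \<le> e * (norm v)\<^sup>2"
proof -
  have e2: "0 < e / 2" using e by simp
  obtain d where d: "0 < d" "\<And>v. norm v < d \<Longrightarrow> norm (g (x + v) - g x - H x v) \<le> e / 2 * norm v"
    using g_expansion[OF e2, of x] by blast
  have "\<bar>trapezoid_error x v\<bar> \<le> e * (norm v)\<^sup>2" if v: "norm v < d" for v
  proof -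
    \<comment> \<open>Subtracting the quadratic Taylor term beforehand makes the derivative at
      \<open>t\<close> equal to \<open>v\<close> paired with the expansion remainder of
      \<open>g\<close> at \<open>t\<close> times \<open>v\<close>.\<close>
    let ?\<psi> = "\<lambda>t. f (x + t *\<^sub>R v) - t * (g x \<bullet> v) - t\<^sup>2 / 2 * (v \<bullet> H x v)"
    have "\<exists>t>0. t < 1 \<and> ?\<psi> 1 - ?\<psi> 0 = (1 - 0) * (g (x + t *\<^sub>R v) \<bullet> v - g x \<bullet> v - t * (v \<bullet> H x v))"
      by (rule MVT2) (auto intro!: derivative_eq_intros f_line_deriv)
    then obtain t where t: "0 < t" "t < 1"
      and eq: "?\<psi> 1 - ?\<psi> 0 = g (x + t *\<^sub>R v) \<bullet> v - g x \<bullet> v - t * (v \<bullet> H x v)" by auto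
    define r where "r = (\<lambda>v. g (x + v) - g x - H x v)"
    have tv: "norm (t *\<^sub>R v) \<le> norm v" using t by (simp add: mult_left_le_one_le)
    have "norm (r (t *\<^sub>R v)) \<le> e / 2 * norm (t *\<^sub>R v)" unfolding r_def using tv v by (intro d) linarith
    also have "\<dots> \<le> e / 2 * norm v" using tv e by simp
    finally have r1: "norm (r (t *\<^sub>R v)) \<le> e / 2 * norm v" .
    have r2: "norm (r v) \<le> e / 2 * norm v" unfolding r_def by (rule d) (rule v)
    have "trapezoid_error x v = v \<bullet> r (t *\<^sub>R v) - v \<bullet> r v / 2"
      using eq unfolding trapezoid_error_def r_def
      by (simp add: inner_diff_right inner_add_right inner_add_left inner_commute linear_scale[OF H_linear] field_simps)
    then have "\<bar>trapezoid_error x v\<bar> \<le> \<bar>v \<bullet> r (t *\<^sub>R v)\<bar> + \<bar>v \<bullet> r v\<bar> / 2" by linarith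
    also have "\<dots> \<le> norm v * (e / 2 * norm v) + norm v * (e / 2 * norm v) / 2"
      by (intro add_mono divide_right_mono order_trans[OF Cauchy_Schwarz_ineq2] mult_left_mono r1 r2) auto
    also have "\<dots> \<le> e * (norm v)\<^sup>2" using e by (simp add: power2_eq_square)
    finally show ?thesis .
  qed
  with d(1) show ?thesis using that by blast
qed

end

section \<open>Gaussian measures and moments of the score\<close>

lemma nn_integral_lborel_affine:
  fixes F :: "'a::euclidean_space \<Rightarrow> ennreal"
  assumes [measurable]: "F \<in> borel_measurable borel" and c: "c \<noteq> 0"
  shows "(\<integral>\<^sup>+x. F x \<partial>lborel) = ennreal (\<bar>c\<bar> ^ DIM('a)) * (\<integral>\<^sup>+x. F (t + c *\<^sub>R x) \<partial>lborel)"
  by (subst lborel_affine[OF c, of t]) (simp add: nn_integral_density nn_integral_distr nn_integral_cmult)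

text \<open>Brings the Gaussian into the form constant times \<open>exp (- F)\<close>, on which the
  score estimates act and in which rotation invariance is visible.\<close>

lemma std_gaussian_density:
  "(std_gaussian :: 'a::euclidean_space measure) =
     density lborel (\<lambda>x. ennreal ((1 / sqrt (2 * pi)) ^ DIM('a) * exp (- (x \<bullet> x / 2))))"
proof -
  have "(\<Prod>b\<in>Basis. std_normal_density (x \<bullet> b)) = (1 / sqrt (2 * pi)) ^ DIM('a) * exp (- (x \<bullet> x / 2))"
    for x :: 'a
    by (simp only: std_normal_density_def prod.distrib prod_constant exp_sum[OF finite_Basis, symmetric])
       (simp add: euclidean_inner[of x x] power2_eq_square sum_negf sum_divide_distrib)
  then show ?thesis by (simp add: std_gaussian_def)
qed

lemma sets_std_gaussian [simp, measurable_cong]: "sets std_gaussian = sets borel"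
  and space_std_gaussian [simp]: "space std_gaussian = UNIV"
  by (simp_all add: std_gaussian_def)

lemma prob_space_std_gaussian: "prob_space (std_gaussian :: 'a::euclidean_space measure)"
proof
  have "(\<integral>\<^sup>+x. ennreal (std_normal_density x) \<partial>lborel) = 1"
    by (subst nn_integral_eq_integral) auto
  then have "(\<integral>\<^sup>+x. (\<Prod>b\<in>Basis. ennreal (std_normal_density ((x::'a) \<bullet> b))) \<partial>lborel) = 1"
    by (subst nn_integral_lborel_prod) auto
  then show "emeasure (std_gaussian :: 'a measure) (space std_gaussian) = 1"
    by (simp add: std_gaussian_def emeasure_density prod_ennreal)
qed

text \<open>The map is factored into two affine substitutions in one block each: at fixed
  \<open>v\<close>, \<open>z\<close> is replaced by \<open>p = c z + s v\<close>; at fixed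
  \<open>p\<close>, \<open>v\<close> is replaced by \<open>q = (s / c) p - (1 / c) v\<close>. Their
  Jacobian factors, powers of \<open>|c|\<close> and \<open>|1 / c|\<close>, cancel.\<close>

lemma lborel_rotation:
  fixes F :: "'a::euclidean_space \<times> 'a \<Rightarrow> ennreal"
  assumes [measurable]: "F \<in> borel_measurable borel" and c: "c \<noteq> 0" and cs: "c\<^sup>2 + s\<^sup>2 = 1"
  shows "(\<integral>\<^sup>+v. \<integral>\<^sup>+z. F (c *\<^sub>R z + s *\<^sub>R v, s *\<^sub>R z - c *\<^sub>R v) \<partial>lborel \<partial>lborel)
    = (\<integral>\<^sup>+p. \<integral>\<^sup>+q. F (p, q) \<partial>lborel \<partial>lborel)"
proof -
  have [measurable]: "F \<in> borel_measurable (borel \<Otimes>\<^sub>M borel)" by (simp add: borel_prod)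
  let ?k = "ennreal (\<bar>c\<bar> ^ DIM('a))"
  have z: "(\<integral>\<^sup>+p. F (p, (s / c) *\<^sub>R p - (1 / c) *\<^sub>R v) \<partial>lborel)
      = ?k * (\<integral>\<^sup>+z. F (c *\<^sub>R z + s *\<^sub>R v, s *\<^sub>R z - c *\<^sub>R v) \<partial>lborel)" for v
  proof -
    have "(s / c) *\<^sub>R (s *\<^sub>R v + c *\<^sub>R z) - (1 / c) *\<^sub>R v = s *\<^sub>R z - c *\<^sub>R v" for z
    proof -
      have "s * s / c - 1 / c = - c" using cs c by (simp add: field_simps power2_eq_square)
      then have "(s * s / c) *\<^sub>R v - (1 / c) *\<^sub>R v = - c *\<^sub>R v" by (simp only: scaleR_left_diff_distrib[symmetric])
      then show ?thesis using c by (simp add: scaleR_add_right algebra_simps)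
    qed
    then show ?thesis
      by (subst nn_integral_lborel_affine[OF _ c, of _ "s *\<^sub>R v"]) (simp_all add: add.commute)
  qed
  have v: "(\<integral>\<^sup>+q. F (p, q) \<partial>lborel)
      = ennreal (\<bar>1 / c\<bar> ^ DIM('a)) * (\<integral>\<^sup>+v. F (p, (s / c) *\<^sub>R p - (1 / c) *\<^sub>R v) \<partial>lborel)" for p
    using c by (subst nn_integral_lborel_affine[of _ "- 1 / c" "(s / c) *\<^sub>R p"]) simp_all
  have kk: "ennreal (\<bar>1 / c\<bar> ^ DIM('a)) * ?k = 1"
    using c by (simp add: ennreal_mult[symmetric] power_mult_distrib[symmetric] abs_mult[symmetric])
  have "(\<integral>\<^sup>+p. \<integral>\<^sup>+q. F (p, q) \<partial>lborel \<partial>lborel)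
     = (\<integral>\<^sup>+p. ennreal (\<bar>1 / c\<bar> ^ DIM('a)) * (\<integral>\<^sup>+v. F (p, (s / c) *\<^sub>R p - (1 / c) *\<^sub>R v) \<partial>lborel) \<partial>lborel)"
    by (simp only: v)
  also have "\<dots> = ennreal (\<bar>1 / c\<bar> ^ DIM('a)) * (\<integral>\<^sup>+p. \<integral>\<^sup>+v. F (p, (s / c) *\<^sub>R p - (1 / c) *\<^sub>R v) \<partial>lborel \<partial>lborel)"
    by (rule nn_integral_cmult) measurable
  also have "(\<integral>\<^sup>+p. \<integral>\<^sup>+v. F (p, (s / c) *\<^sub>R p - (1 / c) *\<^sub>R v) \<partial>lborel \<partial>lborel)
      = (\<integral>\<^sup>+v. \<integral>\<^sup>+p. F (p, (s / c) *\<^sub>R p - (1 / c) *\<^sub>R v) \<partial>lborel \<partial>lborel)"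
    by (rule lborel_pair.Fubini'[symmetric]) measurable
  also have "\<dots> = (\<integral>\<^sup>+v. ?k * (\<integral>\<^sup>+z. F (c *\<^sub>R z + s *\<^sub>R v, s *\<^sub>R z - c *\<^sub>R v) \<partial>lborel) \<partial>lborel)"
    by (simp only: z)
  also have "\<dots> = ?k * (\<integral>\<^sup>+v. \<integral>\<^sup>+z. F (c *\<^sub>R z + s *\<^sub>R v, s *\<^sub>R z - c *\<^sub>R v) \<partial>lborel \<partial>lborel)"
    by (rule nn_integral_cmult) measurable
  finally show ?thesis by (simp only: mult.assoc[symmetric] kk mult_1_left)
qed

text \<open>The map is a reflection and thus its own inverse, which later lets the two noises of a
  step trade places.\<close>

lemma std_gaussian_rotation:
  assumes s: "0 \<le> s" and cs: "c\<^sup>2 + s\<^sup>2 = 1"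
  shows "preserves (std_gaussian \<Otimes>\<^sub>M std_gaussian) (std_gaussian \<Otimes>\<^sub>M std_gaussian)
    (\<lambda>(z :: 'a::euclidean_space, v). (c *\<^sub>R z + s *\<^sub>R v, s *\<^sub>R z - c *\<^sub>R v))"
proof -
  let ?G = "std_gaussian :: 'a measure"
  interpret G: prob_space ?G by (rule prob_space_std_gaussian)
  interpret GG: pair_sigma_finite ?G ?G ..
  show ?thesis
  proof (cases "c = 0")
    case True
    \<comment> \<open>\<open>lborel_rotation\<close> divides by \<open>c\<close>. For
      \<open>c = 0\<close> the nonnegative \<open>s\<close> equals 1 and the map is the swap of the
      two factors.\<close>
    then have s1: "s = 1" using s cs by (simp add: power2_eq_1_iff)
    have "(\<lambda>(x, y). (y, x)) \<in> ?G \<Otimes>\<^sub>M ?G \<rightarrow>\<^sub>M ?G \<Otimes>\<^sub>M ?G" by measurable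
    with GG.distr_pair_swap show ?thesis by (simp add: True s1 preserves_def)
  next
    case False
    define \<phi> where "\<phi> = (\<lambda>x::'a. ennreal ((1 / sqrt (2 * pi)) ^ DIM('a) * exp (- (x \<bullet> x / 2))))"
    have \<phi>[measurable]: "\<phi> \<in> borel_measurable borel" by (simp add: \<phi>_def)
    have G: "?G = density lborel \<phi>" by (simp add: std_gaussian_density \<phi>_def)
    \<comment> \<open>The joint density depends on the pair only through the sum of squared norms,
      which the reflection keeps.\<close>
    have \<phi>\<phi>: "\<phi> (c *\<^sub>R z + s *\<^sub>R v) * \<phi> (s *\<^sub>R z - c *\<^sub>R v) = \<phi> z * \<phi> v" for z v
    proof -
      have "(c *\<^sub>R z + s *\<^sub>R v) \<bullet> (c *\<^sub>R z + s *\<^sub>R v) + (s *\<^sub>R z - c *\<^sub>R v) \<bullet> (s *\<^sub>R z - c *\<^sub>R v)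
          = (c\<^sup>2 + s\<^sup>2) * (z \<bullet> z) + (c\<^sup>2 + s\<^sup>2) * (v \<bullet> v)"
        by (simp add: inner_add_left inner_add_right inner_diff_left inner_diff_right inner_commute
            power2_eq_square algebra_simps)
      then have *: "(c *\<^sub>R z + s *\<^sub>R v) \<bullet> (c *\<^sub>R z + s *\<^sub>R v) / 2 + (s *\<^sub>R z - c *\<^sub>R v) \<bullet> (s *\<^sub>R z - c *\<^sub>R v) / 2
          = z \<bullet> z / 2 + v \<bullet> v / 2"
        by (simp only: cs)
      have P: "\<phi> x * \<phi> y = ennreal (((1 / sqrt (2 * pi)) ^ DIM('a))\<^sup>2 * exp (- (x \<bullet> x / 2 + y \<bullet> y / 2)))" for x y
        by (simp add: \<phi>_def ennreal_mult[symmetric] exp_add[symmetric] power2_eq_square mult_ac)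
      show ?thesis unfolding P * ..
    qed
    show ?thesis
    proof (rule preservesI)
      fix F :: "'a \<times> 'a \<Rightarrow> ennreal" assume F: "F \<in> borel_measurable (?G \<Otimes>\<^sub>M ?G)"
      then have [measurable]: "F \<in> borel_measurable (borel \<Otimes>\<^sub>M borel)"
        using measurable_cong_sets[OF sets_pair_measure_cong[OF sets_std_gaussian sets_std_gaussian] refl] by blast
      define E where "E = (\<lambda>x. \<phi> (fst x) * (\<phi> (snd x) * F x))"
      have E: "E \<in> borel_measurable borel" unfolding E_def borel_prod[symmetric] by measurable
      have GG: "(\<integral>\<^sup>+y. \<integral>\<^sup>+x. J (x, y) \<partial>?G \<partial>?G) = (\<integral>\<^sup>+y. \<integral>\<^sup>+x. \<phi> y * (\<phi> x * J (x, y)) \<partial>lborel \<partial>lborel)"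
        if [measurable]: "J \<in> borel_measurable (borel \<Otimes>\<^sub>M borel)" for J
      proof -
        have "(\<integral>\<^sup>+y. \<integral>\<^sup>+x. J (x, y) \<partial>?G \<partial>?G) = (\<integral>\<^sup>+y. \<phi> y * (\<integral>\<^sup>+x. \<phi> x * J (x, y) \<partial>lborel) \<partial>lborel)"
          unfolding G by (subst nn_integral_density, measurable, subst nn_integral_density, measurable)
        also have "\<dots> = (\<integral>\<^sup>+y. \<integral>\<^sup>+x. \<phi> y * (\<phi> x * J (x, y)) \<partial>lborel \<partial>lborel)"
          by (intro nn_integral_cong nn_integral_cmult[symmetric]) measurable
        finally show ?thesis .
      qed
      have "(\<integral>\<^sup>+x. F (case x of (z, v) \<Rightarrow> (c *\<^sub>R z + s *\<^sub>R v, s *\<^sub>R z - c *\<^sub>R v)) \<partial>(?G \<Otimes>\<^sub>M ?G))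
          = (\<integral>\<^sup>+v. \<integral>\<^sup>+z. F (c *\<^sub>R z + s *\<^sub>R v, s *\<^sub>R z - c *\<^sub>R v) \<partial>?G \<partial>?G)"
        by (subst GG.nn_integral_snd[symmetric]) auto
      also have "\<dots> = (\<integral>\<^sup>+v. \<integral>\<^sup>+z. \<phi> v * (\<phi> z * F (c *\<^sub>R z + s *\<^sub>R v, s *\<^sub>R z - c *\<^sub>R v)) \<partial>lborel \<partial>lborel)"
        using GG[of "\<lambda>x. F (c *\<^sub>R fst x + s *\<^sub>R snd x, s *\<^sub>R fst x - c *\<^sub>R snd x)"] by simp
      also have "\<dots> = (\<integral>\<^sup>+v. \<integral>\<^sup>+z. E (c *\<^sub>R z + s *\<^sub>R v, s *\<^sub>R z - c *\<^sub>R v) \<partial>lborel \<partial>lborel)"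
        unfolding E_def fst_conv snd_conv mult.assoc[symmetric] \<phi>\<phi>
        by (intro nn_integral_cong arg_cong2[where f="(*)"] mult.commute refl)
      also have "\<dots> = (\<integral>\<^sup>+p. \<integral>\<^sup>+q. E (p, q) \<partial>lborel \<partial>lborel)"
        by (rule lborel_rotation[OF E False cs])
      also have "\<dots> = (\<integral>\<^sup>+p. \<integral>\<^sup>+q. F (p, q) \<partial>?G \<partial>?G)"
        using GG[of "\<lambda>x. F (snd x, fst x)"] by (simp add: E_def)
      also have "\<dots> = (\<integral>\<^sup>+y. F y \<partial>(?G \<Otimes>\<^sub>M ?G))"
        by (rule G.nn_integral_fst) (rule F)
      finally show "(\<integral>\<^sup>+x. F (case x of (z, v) \<Rightarrow> (c *\<^sub>R z + s *\<^sub>R v, s *\<^sub>R z - c *\<^sub>R v)) \<partial>(?G \<Otimes>\<^sub>M ?G))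
          = (\<integral>\<^sup>+y. F y \<partial>(?G \<Otimes>\<^sub>M ?G))" .
    qed measurable
  qed
qed

lemma std_gaussian_combination:
  assumes "0 \<le> s" and "c\<^sup>2 + s\<^sup>2 = 1"
  shows "preserves (std_gaussian \<Otimes>\<^sub>M std_gaussian) std_gaussian
    (\<lambda>(z :: 'a::euclidean_space, v). c *\<^sub>R z + s *\<^sub>R v)"
  using preserves_comp[OF std_gaussian_rotation[OF assms] preserves_fst[OF prob_space_std_gaussian]]
  by (simp add: case_prod_beta')

section \<open>Moments of the score\<close>

lemma borel_measurable_cosh [measurable]: "(cosh :: real \<Rightarrow> real) \<in> borel_measurable borel"
  by (intro borel_measurable_continuous_onI continuous_intros)

text \<open>The even powers in the series of \<open>cosh\<close> are nonnegative, so every finite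
  selection of them is a lower bound.\<close>

lemma cosh_ge_partial_sum:
  fixes y :: real
  assumes "finite I"
  shows "(\<Sum>n\<in>I. if even n then y ^ n / fact n else 0) \<le> cosh y"
proof -
  have "(\<lambda>n. if even n then y ^ n /\<^sub>R fact n else 0) sums cosh y" by (rule cosh_converges)
  moreover have "(\<lambda>n. if even n then y ^ n /\<^sub>R fact n else 0) = (\<lambda>n. if even n then y ^ n / fact n else 0)"
    by (auto simp: divide_inverse mult.commute)
  ultimately have s: "(\<lambda>n. if even n then y ^ n / fact n else 0) sums cosh y" by simp
  show ?thesis
    unfolding sums_unique[OF s]
    by (rule sum_le_suminf[OF sums_summable[OF s] assms]) (auto simp: zero_le_even_power)
qed

lemma cosh_ge_square: "1 + y\<^sup>2 / 2 \<le> cosh (y::real)"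
  and cosh_ge_fourth_power: "y ^ 4 / 24 \<le> cosh (y::real)"
  using cosh_ge_partial_sum[of "{0, 2}" y] cosh_ge_partial_sum[of "{4}" y] by (simp_all add: fact_numeral)

text \<open>Translation invariance of Lebesgue measure, applied to \<open>x + t e\<close> and \<open>x - t e\<close>, replaces
  the integration by parts that is usually used to bound moments of the score.\<close>

lemma score_exponential_moment:
  fixes F :: "'a::euclidean_space \<Rightarrow> real" and G :: "'a \<Rightarrow> 'a"
  assumes [measurable]: "F \<in> borel_measurable borel" "G \<in> borel_measurable borel"
    and smooth: "\<And>x v. F (x + v) \<le> F x + G x \<bullet> v + L / 2 * (v \<bullet> v)"
    and \<mu>: "\<mu> = density lborel (\<lambda>x. ennreal (K * exp (- F x)))" and K: "0 \<le> K"
    and prob: "prob_space \<mu>"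
    and e: "norm e = 1"
  shows "(\<integral>\<^sup>+x. ennreal (cosh (t * (G x \<bullet> e))) \<partial>\<mu>) \<le> ennreal (exp (L * t\<^sup>2 / 2))"
proof -
  have total: "(\<integral>\<^sup>+x. ennreal (K * exp (- F x)) \<partial>lborel) = 1"
    using prob_space.emeasure_space_1[OF prob] by (simp add: \<mu> emeasure_density)
  have shift: "(\<integral>\<^sup>+x. ennreal (K * exp (- F (x + v))) \<partial>lborel) = 1" for v
    using nn_integral_lborel_affine[of "\<lambda>x. ennreal (K * exp (- F x))" 1 v] total by (simp add: add.commute)
  \<comment> \<open>By smoothness each of the two shifted densities keeps at least the factor
    \<open>exp (- (L * t^2 / 2))\<close>; the linear terms enter with opposite signs and add up to
    \<open>2 * cosh\<close>.\<close>
  define r where "r = 2 * exp (- (L * t\<^sup>2 / 2))"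
  have r: "0 < r" by (simp add: r_def)
  have "ennreal r * (\<integral>\<^sup>+x. ennreal (cosh (t * (G x \<bullet> e))) \<partial>\<mu>)
      = ennreal r * (\<integral>\<^sup>+x. ennreal (K * exp (- F x)) * ennreal (cosh (t * (G x \<bullet> e))) \<partial>lborel)"
    unfolding \<mu> by (subst nn_integral_density) auto
  also have "\<dots> = (\<integral>\<^sup>+x. ennreal (r * (K * exp (- F x)) * cosh (t * (G x \<bullet> e))) \<partial>lborel)"
    using K r by (subst nn_integral_cmult[symmetric]) (auto simp: ennreal_mult mult.assoc)
  also have "\<dots> \<le> (\<integral>\<^sup>+x. ennreal (K * exp (- F (x + t *\<^sub>R e))) + ennreal (K * exp (- F (x + (- t) *\<^sub>R e))) \<partial>lborel)"
  proof (rule nn_integral_mono)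
    fix x
    have ee: "e \<bullet> e = 1" using e by (simp add: dot_square_norm)
    have b: "exp (- F x) * exp (- (L * u\<^sup>2 / 2)) * exp (- (u * (G x \<bullet> e))) \<le> exp (- F (x + u *\<^sub>R e))" for u
      using smooth[of x "u *\<^sub>R e"] by (simp add: exp_add[symmetric] ee power2_eq_square algebra_simps)
    have "r * exp (- F x) * cosh (t * (G x \<bullet> e)) =
        exp (- F x) * exp (- (L * t\<^sup>2 / 2)) * exp (- (t * (G x \<bullet> e)))
        + exp (- F x) * exp (- (L * (- t)\<^sup>2 / 2)) * exp (- (- t * (G x \<bullet> e)))"
      by (simp add: r_def cosh_def algebra_simps)
    also have "\<dots> \<le> exp (- F (x + t *\<^sub>R e)) + exp (- F (x + (- t) *\<^sub>R e))"
      by (intro add_mono b)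
    finally have "K * (r * exp (- F x) * cosh (t * (G x \<bullet> e)))
        \<le> K * (exp (- F (x + t *\<^sub>R e)) + exp (- F (x + (- t) *\<^sub>R e)))"
      using K by (rule mult_left_mono)
    then show "ennreal (r * (K * exp (- F x)) * cosh (t * (G x \<bullet> e)))
        \<le> ennreal (K * exp (- F (x + t *\<^sub>R e))) + ennreal (K * exp (- F (x + (- t) *\<^sub>R e)))"
      using K by (simp add: ennreal_plus[symmetric] ennreal_leI distrib_left mult_ac del: ennreal_plus)
  qed
  also have "\<dots> = 2" by (subst nn_integral_add) (simp_all only: shift, auto)
  also have "2 = ennreal r * ennreal (exp (L * t\<^sup>2 / 2))"
  proof -
    have "r * exp (L * t\<^sup>2 / 2) = 2" by (simp add: r_def exp_minus)
    then show ?thesis using r by (simp add: ennreal_mult[symmetric])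
  qed
  finally have "ennreal r * (\<integral>\<^sup>+x. ennreal (cosh (t * (G x \<bullet> e))) \<partial>\<mu>) \<le> ennreal r * ennreal (exp (L * t\<^sup>2 / 2))" .
  then show ?thesis using r by (simp add: ennreal_mult_le_mult_iff)
qed

text \<open>Comparison of first-order terms as \<open>s\<close> tends to 0.\<close>

lemma le_of_exp_bound:
  fixes a L :: real
  assumes "\<And>s. 0 < s \<Longrightarrow> 1 + s * a \<le> exp (L * s)" and L: "0 \<le> L"
  shows "a \<le> L"
proof (rule field_le_epsilon)
  fix e :: real assume e: "0 < e"
  \<comment> \<open>The first entry gives \<open>L * s <= 1\<close>, hence
    \<open>exp (L * s) <= 1 + L * s + (L * s)^2\<close>; the second gives
    \<open>L^2 * s <= e\<close>.\<close>
  define s where "s = min (1 / (L + 1)) (e / (L\<^sup>2 + 1))"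
  have s: "0 < s" using e L by (auto simp: s_def add_nonneg_pos)
  have "L * s \<le> L * (1 / (L + 1))" using L by (intro mult_left_mono) (auto simp: s_def)
  also have "\<dots> \<le> 1" using L by simp
  finally have Ls: "L * s \<le> 1" .
  have "1 + s * a \<le> 1 + L * s + (L * s)\<^sup>2"
    using assms(1)[OF s] exp_bound[of "L * s"] Ls L s by simp
  then have "s * a \<le> s * (L + L\<^sup>2 * s)" by (simp add: power2_eq_square algebra_simps)
  then have "a \<le> L + L\<^sup>2 * s" using s by (simp only: mult_le_cancel_left_pos)
  also have "L\<^sup>2 * s \<le> (L\<^sup>2 + 1) * (e / (L\<^sup>2 + 1))"
    using s by (intro mult_mono) (auto simp: s_def)
  also have "\<dots> = e" by (simp add: add_nonneg_eq_0_iff)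
  finally show "a \<le> L + e" by simp
qed

text \<open>The second moment along a basis vector follows from \<open>cosh y >= 1 + y^2 / 2\<close>
  at \<open>t = sqrt (2 * s)\<close> for small \<open>s\<close>, which yields the constant
  \<open>L\<close> of integration by parts. The fourth moment only has to be finite, so
  \<open>t = 1\<close> is enough.\<close>

lemma
  fixes F :: "'a::euclidean_space \<Rightarrow> real" and G :: "'a \<Rightarrow> 'a"
  assumes [measurable]: "F \<in> borel_measurable borel" "G \<in> borel_measurable borel"
    and smooth: "\<And>x v. F (x + v) \<le> F x + G x \<bullet> v + L / 2 * (v \<bullet> v)" and L: "0 \<le> L"
    and \<mu>: "\<mu> = density lborel (\<lambda>x. ennreal (K * exp (- F x)))" and K: "0 \<le> K"
    and prob: "prob_space \<mu>"
  shows score_L2: "L2_le \<mu> G (sqrt (L * DIM('a)))"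
    and score_fourth_moment: "(\<integral>\<^sup>+x. ennreal (norm (G x) ^ 4) \<partial>\<mu>) < \<infinity>"
proof -
  interpret prob_space \<mu> by fact
  have [measurable_cong]: "sets \<mu> = sets borel" by (simp add: \<mu>)
  note moment = score_exponential_moment[OF assms(1,2) smooth \<mu> K prob norm_Basis]
  have second: "(\<integral>\<^sup>+x. ennreal ((G x \<bullet> b)\<^sup>2) \<partial>\<mu>) \<le> ennreal L" if b: "b \<in> Basis" for b
  proof -
    let ?A = "\<integral>\<^sup>+x. ennreal ((G x \<bullet> b)\<^sup>2) \<partial>\<mu>"
    have bound: "1 + ennreal s * ?A \<le> ennreal (exp (L * s))" if s: "0 < s" for s
    proof -
      have "1 + ennreal s * ?A = (\<integral>\<^sup>+x. 1 + ennreal s * ennreal ((G x \<bullet> b)\<^sup>2) \<partial>\<mu>)"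
        by (simp add: nn_integral_add nn_integral_cmult emeasure_space_1)
      also have "\<dots> \<le> (\<integral>\<^sup>+x. ennreal (cosh (sqrt (2 * s) * (G x \<bullet> b))) \<partial>\<mu>)"
      proof (rule nn_integral_mono)
        fix x
        have "1 + s * (G x \<bullet> b)\<^sup>2 \<le> cosh (sqrt (2 * s) * (G x \<bullet> b))"
          using cosh_ge_square[of "sqrt (2 * s) * (G x \<bullet> b)"] s by (simp add: power_mult_distrib)
        then show "1 + ennreal s * ennreal ((G x \<bullet> b)\<^sup>2) \<le> ennreal (cosh (sqrt (2 * s) * (G x \<bullet> b)))"
          using s by (simp add: ennreal_mult[symmetric] ennreal_1[symmetric] ennreal_plus[symmetric] ennreal_leI
              del: ennreal_plus ennreal_1)
      qed
      also have "\<dots> \<le> ennreal (exp (L * (sqrt (2 * s))\<^sup>2 / 2))" by (rule moment) (rule b)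
      finally show ?thesis using s by simp
    qed
    \<comment> \<open>The single value \<open>s = 1\<close> shows finiteness; only then is there a
      real number to which \<open>le_of_exp_bound\<close> applies.\<close>
    have fin: "?A < \<infinity>"
      using bound[of 1] by (cases ?A) (auto simp: top_unique)
    then obtain a where a: "0 \<le> a" "?A = ennreal a" by (cases ?A) auto
    have "1 + s * a \<le> exp (L * s)" if "0 < s" for s
      using bound[OF that] a that
      by (simp add: ennreal_mult[symmetric] ennreal_1[symmetric] ennreal_plus[symmetric] ennreal_le_iff
          del: ennreal_plus ennreal_1)
    then have "a \<le> L" using L by (rule le_of_exp_bound)
    then show ?thesis by (simp add: a ennreal_leI)
  qed
  have norm2: "(norm v)\<^sup>2 = (\<Sum>b\<in>Basis. (v \<bullet> b)\<^sup>2)" for v :: 'a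
    unfolding power2_norm_eq_inner by (subst euclidean_inner) (simp add: power2_eq_square)
  have "(\<integral>\<^sup>+x. ennreal ((norm (G x))\<^sup>2) \<partial>\<mu>) = (\<Sum>b\<in>Basis. \<integral>\<^sup>+x. ennreal ((G x \<bullet> b)\<^sup>2) \<partial>\<mu>)"
  proof -
    have p: "ennreal ((norm (G x))\<^sup>2) = (\<Sum>b\<in>Basis. ennreal ((G x \<bullet> b)\<^sup>2))" for x
      by (simp add: norm2 sum_ennreal)
    show ?thesis unfolding p by (rule nn_integral_sum) measurable
  qed
  also have "\<dots> \<le> (\<Sum>b\<in>(Basis::'a set). ennreal L)" by (intro sum_mono second)
  also have "\<dots> = ennreal ((sqrt (L * DIM('a)))\<^sup>2)"
    using L by (simp add: ennreal_mult ennreal_of_nat_eq_real_of_nat mult.commute)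
  finally show "L2_le \<mu> G (sqrt (L * DIM('a)))" using L by (simp add: L2_le_def)
  have fourth: "(\<integral>\<^sup>+x. ennreal ((G x \<bullet> b) ^ 4) \<partial>\<mu>) < \<infinity>" if b: "b \<in> Basis" for b
  proof -
    have "(\<integral>\<^sup>+x. ennreal ((G x \<bullet> b) ^ 4) \<partial>\<mu>) \<le> (\<integral>\<^sup>+x. 24 * ennreal (cosh (1 * (G x \<bullet> b))) \<partial>\<mu>)"
    proof (rule nn_integral_mono)
      fix x
      have "ennreal ((G x \<bullet> b) ^ 4) \<le> ennreal (24 * cosh (G x \<bullet> b))"
        using cosh_ge_fourth_power[of "G x \<bullet> b"] by (intro ennreal_leI) simp
      then show "ennreal ((G x \<bullet> b) ^ 4) \<le> 24 * ennreal (cosh (1 * (G x \<bullet> b)))"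
        by (simp add: ennreal_mult)
    qed
    also have "\<dots> = 24 * (\<integral>\<^sup>+x. ennreal (cosh (1 * (G x \<bullet> b))) \<partial>\<mu>)"
      by (rule nn_integral_cmult) measurable
    also have "\<dots> \<le> 24 * ennreal (exp (L * 1\<^sup>2 / 2))"
      by (intro mult_left_mono moment b) simp
    also have "\<dots> < \<infinity>" by (simp add: ennreal_mult_less_top)
    finally show ?thesis .
  qed
  have "(\<integral>\<^sup>+x. ennreal (norm (G x) ^ 4) \<partial>\<mu>)
      \<le> (\<integral>\<^sup>+x. ennreal DIM('a) * (\<Sum>b\<in>Basis. ennreal ((G x \<bullet> b) ^ 4)) \<partial>\<mu>)"
  proof (rule nn_integral_mono)
    fix x
    have "norm (G x) ^ 4 = ((norm (G x))\<^sup>2)\<^sup>2" by simp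
    also have "\<dots> \<le> DIM('a) * (\<Sum>b\<in>Basis. ((G x \<bullet> b)\<^sup>2)\<^sup>2)"
      unfolding norm2 using sum_squared_le_sum_of_squares[of "\<lambda>b. (G x \<bullet> b)\<^sup>2" "Basis :: 'a set"] by (simp add: mult.commute)
    finally have "ennreal (norm (G x) ^ 4) \<le> ennreal (DIM('a) * (\<Sum>b\<in>Basis. (G x \<bullet> b) ^ 4))"
      by (intro ennreal_leI) simp
    then show "ennreal (norm (G x) ^ 4) \<le> ennreal DIM('a) * (\<Sum>b\<in>Basis. ennreal ((G x \<bullet> b) ^ 4))"
      by (simp add: ennreal_mult sum_ennreal sum_nonneg)
  qed
  also have "\<dots> = ennreal DIM('a) * (\<Sum>b\<in>Basis. \<integral>\<^sup>+x. ennreal ((G x \<bullet> b) ^ 4) \<partial>\<mu>)"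
    by (subst nn_integral_cmult, measurable, subst nn_integral_sum, measurable)
  also have "\<dots> < \<infinity>" using fourth by (simp add: ennreal_mult_less_top)
  finally show "(\<integral>\<^sup>+x. ennreal (norm (G x) ^ 4) \<partial>\<mu>) < \<infinity>" .
qed

text \<open>The Gaussian is the case \<open>F x = x \<bullet> x / 2\<close>, whose score is
  \<open>x\<close> itself, with \<open>L = 1\<close>.\<close>

lemma
  shows std_gaussian_L2: "L2_le (std_gaussian :: 'a::euclidean_space measure) (\<lambda>x. x) (sqrt DIM('a))"
    and std_gaussian_fourth_moment:
      "(\<integral>\<^sup>+x. ennreal (norm x ^ 4) \<partial>(std_gaussian :: 'a::euclidean_space measure)) < \<infinity>"
proof -
  have smooth: "(x + v) \<bullet> (x + v) / 2 \<le> x \<bullet> x / 2 + x \<bullet> v + 1 / 2 * (v \<bullet> v)" for x v :: 'a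
    by (simp add: inner_add_left inner_add_right inner_commute)
  note * = smooth _ std_gaussian_density _ prob_space_std_gaussian
  show "L2_le (std_gaussian :: 'a measure) (\<lambda>x. x) (sqrt DIM('a))"
    using score_L2[OF _ _ *] by simp
  show "(\<integral>\<^sup>+x. ennreal (norm x ^ 4) \<partial>(std_gaussian :: 'a measure)) < \<infinity>"
    using score_fourth_moment[OF _ _ *] by simp
qed

section \<open>The Metropolis-adjusted Langevin chain\<close>

abbreviation unit_uniform :: "real measure" where
  "unit_uniform \<equiv> uniform_measure lborel {0..1}"

lemma prob_space_unit_uniform: "prob_space unit_uniform"
  by (rule prob_space_uniform_measure) auto

text \<open>Integrates out the acceptance variable of a Metropolis step.\<close>

lemma nn_integral_unit_uniform_threshold:
  assumes "0 \<le> a" "a \<le> 1"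
  shows "(\<integral>\<^sup>+u. (if u \<le> a then A else B) \<partial>unit_uniform) = ennreal a * A + ennreal (1 - a) * B"
proof -
  have "(\<integral>\<^sup>+u. (if u \<le> a then A else B) \<partial>unit_uniform)
      = (\<integral>\<^sup>+u. (if u \<le> a then A else B) * indicator {0..1} u \<partial>lborel)"
    by (subst nn_integral_uniform_measure) (auto simp: divide_ennreal_def)
  also have "\<dots> = (\<integral>\<^sup>+u. A * indicator {0..a} u + B * indicator {a<..1} u \<partial>lborel)"
    using assms by (intro nn_integral_cong) (auto split: split_indicator)
  also have "\<dots> = ennreal a * A + ennreal (1 - a) * B"
    using assms by (subst nn_integral_add) (auto simp: nn_integral_cmult_indicator mult.commute)
  finally show ?thesis .
qed

locale vec_smooth_convex = smooth_convex f g H m M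
  for f :: "real^'n \<Rightarrow> real" and g :: "real^'n \<Rightarrow> real^'n" and H :: "real^'n \<Rightarrow> real^'n \<Rightarrow> real^'n"
    and m M :: real
begin

section \<open>Normalisation of the target density\<close>

lemma f_quadratic_lower: "f 0 - (norm (g 0))\<^sup>2 / m + m / 4 * (x \<bullet> x) \<le> f x"
proof -
  \<comment> \<open>Half of the quadratic term \<open>m / 2 * (x \<bullet> x)\<close> is spent on
    absorbing the linear term.\<close>
  have "0 \<le> (m * norm x / 2 - norm (g 0))\<^sup>2 / m" using m_pos by simp
  also have "\<dots> = m / 4 * (x \<bullet> x) - norm x * norm (g 0) + (norm (g 0))\<^sup>2 / m"
    using m_pos by (simp add: dot_square_norm power2_eq_square field_simps)
  finally have "- (g 0 \<bullet> x) \<le> m / 4 * (x \<bullet> x) + (norm (g 0))\<^sup>2 / m"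
    using Cauchy_Schwarz_ineq2[of "g 0" x] by (simp add: mult.commute)
  then show ?thesis using f_lower[of 0 x] by simp
qed

text \<open>The density lies below a multiple of a Gaussian, and finiteness of the Gaussian integral
  is read off from \<open>std_gaussian\<close> being a probability measure.\<close>

lemma integrable_exp_neg_f: "integrable lborel (\<lambda>x. exp (- f x))"
proof (rule integrableI_nonneg)
  let ?k = "(1 / sqrt (2 * pi)) ^ DIM(real^'n)"
  have k: "0 < ?k" by simp
  have "(\<integral>\<^sup>+x. ennreal (?k * exp (- ((x::real^'n) \<bullet> x / 2))) \<partial>lborel) = 1"
    using prob_space.emeasure_space_1[OF prob_space_std_gaussian[where 'a="real^'n"]]
    by (simp only: std_gaussian_density) (simp add: emeasure_density)
  then have "ennreal ?k * (\<integral>\<^sup>+x. ennreal (exp (- ((x::real^'n) \<bullet> x / 2))) \<partial>lborel) = 1"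
    by (simp add: ennreal_mult nn_integral_cmult)
  then have fin: "(\<integral>\<^sup>+x. ennreal (exp (- ((x::real^'n) \<bullet> x / 2))) \<partial>lborel) < \<infinity>"
    using k by (cases "(\<integral>\<^sup>+x. ennreal (exp (- ((x::real^'n) \<bullet> x / 2))) \<partial>lborel) = \<top>")
      (auto simp: ennreal_mult_top less_top)
  define c where "c = f 0 - (norm (g 0))\<^sup>2 / m"
  \<comment> \<open>Rescaling by \<open>sqrt (2 / m)\<close> turns the exponent \<open>m / 4\<close>
    into the standard \<open>1 / 2\<close>.\<close>
  define s where "s = sqrt (2 / m)"
  have s: "s \<noteq> 0" "s\<^sup>2 = 2 / m" using m_pos by (auto simp: s_def)
  have sq: "m / 4 * ((0 + s *\<^sub>R x) \<bullet> (0 + s *\<^sub>R x)) = x \<bullet> x / 2" for x :: "real^'n"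
  proof -
    have "m / 4 * ((0 + s *\<^sub>R x) \<bullet> (0 + s *\<^sub>R x)) = m / 4 * s\<^sup>2 * (x \<bullet> x)" by (simp add: power2_eq_square)
    then show ?thesis using m_pos by (simp add: s(2))
  qed
  have "(\<integral>\<^sup>+x. ennreal (exp (- f x)) \<partial>lborel)
      \<le> (\<integral>\<^sup>+x. ennreal (exp (- c)) * ennreal (exp (- (m / 4 * ((x::real^'n) \<bullet> x)))) \<partial>lborel)"
  proof (rule nn_integral_mono)
    fix x
    have "exp (- f x) \<le> exp (- c + - (m / 4 * (x \<bullet> x)))" using f_quadratic_lower[of x] by (simp add: c_def)
    then show "ennreal (exp (- f x)) \<le> ennreal (exp (- c)) * ennreal (exp (- (m / 4 * (x \<bullet> x))))"
      by (simp add: ennreal_mult[symmetric] exp_add[symmetric])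
  qed
  also have "\<dots> = ennreal (exp (- c)) * (\<integral>\<^sup>+x. ennreal (exp (- (m / 4 * ((x::real^'n) \<bullet> x)))) \<partial>lborel)"
    by (rule nn_integral_cmult) measurable
  also have "(\<integral>\<^sup>+x. ennreal (exp (- (m / 4 * ((x::real^'n) \<bullet> x)))) \<partial>lborel)
      = ennreal (\<bar>s\<bar> ^ DIM(real^'n)) * (\<integral>\<^sup>+x. ennreal (exp (- ((x::real^'n) \<bullet> x / 2))) \<partial>lborel)"
    unfolding sq[symmetric] by (rule nn_integral_lborel_affine) (measurable, rule s)
  also have "ennreal (exp (- c)) * \<dots> < \<infinity>" using fin by (simp add: ennreal_mult_less_top)
  finally show "(\<integral>\<^sup>+x. ennreal (exp (- f x)) \<partial>lborel) < \<infinity>" .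
qed auto

definition K where "K = 1 / (LINT y|lborel. exp (- f y))"

lemma partition_function_pos: "0 < (LINT y|lborel. exp (- f y))"
proof -
  have "(LINT y|lborel. exp (- f y)) \<noteq> 0"
  proof
    assume "(LINT y|lborel. exp (- f y)) = 0"
    then have "AE y in lborel. exp (- f y) = 0"
      by (subst (asm) integral_nonneg_eq_0_iff_AE[OF integrable_exp_neg_f]) auto
    then have "AE y in (lborel :: (real^'n) measure). False" by simp
    then show False by (simp add: AE_iff_measurable[of UNIV])
  qed
  moreover have "0 \<le> (LINT y|lborel. exp (- f y))" by simp
  ultimately show ?thesis by (simp add: less_le)
qed

lemma K_pos: "0 < K"
  using partition_function_pos by (simp add: K_def)

lemma gibbs_density: "gibbs f = density lborel (\<lambda>x. ennreal (K * exp (- f x)))"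
  by (simp add: gibbs_def K_def)

lemma sets_gibbs [simp, measurable_cong]: "sets (gibbs f) = sets borel"
  and space_gibbs [simp]: "space (gibbs f) = UNIV"
  by (simp_all add: gibbs_def)

lemma prob_space_gibbs: "prob_space (gibbs f)"
proof
  have "(\<integral>\<^sup>+x. ennreal (K * exp (- f x)) \<partial>lborel) = ennreal (LINT x|lborel. K * exp (- f x))"
    using K_pos integrable_exp_neg_f by (intro nn_integral_eq_integral) auto
  also have "\<dots> = 1" using partition_function_pos by (simp add: K_def)
  finally show "emeasure (gibbs f) (space (gibbs f)) = 1"
    by (simp add: gibbs_density emeasure_density)
qed

lemma gradient_L2: "L2_le (gibbs f) g (sqrt (M * CARD('n)))"
  and gradient_fourth_moment: "(\<integral>\<^sup>+x. ennreal (norm (g x) ^ 4) \<partial>gibbs f) < \<infinity>"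
  using score_L2[OF measurable_f measurable_g f_upper _ gibbs_density _ prob_space_gibbs]
    score_fourth_moment[OF measurable_f measurable_g f_upper _ gibbs_density _ prob_space_gibbs]
    M_pos K_pos by simp_all

section \<open>The Metropolis step and its invariance\<close>

definition mala_proposal :: "real \<Rightarrow> real^'n \<Rightarrow> real^'n \<Rightarrow> real^'n" where
  "mala_proposal d x z = x - d *\<^sub>R g x + sqrt (2 * d) *\<^sub>R z"

text \<open>Logarithm of the joint density of the state \<open>x\<close> and the proposal
  \<open>y\<close>, without additive constants, which are the same after exchanging the two. The
  proposal has variance \<open>2 * d\<close> per coordinate, hence \<open>4 * d\<close>.\<close>

definition mala_log_joint :: "real \<Rightarrow> real^'n \<Rightarrow> real^'n \<Rightarrow> real" where
  "mala_log_joint d x y = - f x - (norm (y - x + d *\<^sub>R g x))\<^sup>2 / (4 * d)"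

definition mala_accept :: "real \<Rightarrow> real^'n \<Rightarrow> real^'n \<Rightarrow> real" where
  "mala_accept d x y = min 1 (exp (mala_log_joint d y x - mala_log_joint d x y))"

definition mala_step :: "real \<Rightarrow> real^'n \<Rightarrow> (real^'n) \<times> real \<Rightarrow> real^'n" where
  "mala_step d x n = (if snd n \<le> mala_accept d x (mala_proposal d x (fst n))
     then mala_proposal d x (fst n) else x)"

definition mala_noise :: "((real^'n) \<times> real) measure" where
  "mala_noise = std_gaussian \<Otimes>\<^sub>M unit_uniform"

lemma sets_mala_noise [simp, measurable_cong]: "sets mala_noise = sets (borel \<Otimes>\<^sub>M borel)"
  unfolding mala_noise_def by (intro sets_pair_measure_cong) auto

lemma prob_space_mala_noise: "prob_space mala_noise"
  unfolding mala_noise_def by (intro prob_space_pair prob_space_std_gaussian prob_space_unit_uniform)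

lemma measurable_mala_proposal [measurable]:
  "(\<lambda>(x, z). mala_proposal d x z) \<in> borel \<Otimes>\<^sub>M borel \<rightarrow>\<^sub>M borel"
  unfolding mala_proposal_def by measurable

lemma measurable_mala_accept [measurable]:
  "(\<lambda>(x, y). mala_accept d x y) \<in> borel \<Otimes>\<^sub>M borel \<rightarrow>\<^sub>M borel"
  unfolding mala_accept_def mala_log_joint_def by measurable

lemma measurable_mala_step [measurable]:
  "(\<lambda>(x, n). mala_step d x n) \<in> borel \<Otimes>\<^sub>M (borel \<Otimes>\<^sub>M borel) \<rightarrow>\<^sub>M borel"
  unfolding mala_step_def by measurable

lemma mala_accept_bounds: "0 \<le> mala_accept d x y" "mala_accept d x y \<le> 1"
  by (simp_all add: mala_accept_def)

text \<open>Substituting the proposal for \<open>z\<close> turns the accepted part into an integral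
  against a density symmetric in \<open>x\<close> and \<open>y\<close>, the minimum of the two joint
  densities: this is detailed balance. \<open>J\<close> is general so that functions of the old and
  of the new state can both be inserted.\<close>

lemma nn_integral_mala_proposal:
  assumes d: "0 < d" and [measurable]: "(\<lambda>(x, y). J x y) \<in> borel_measurable (borel \<Otimes>\<^sub>M borel)"
  shows "(\<integral>\<^sup>+x. \<integral>\<^sup>+z. ennreal (mala_accept d x (mala_proposal d x z)) * J x (mala_proposal d x z)
      \<partial>std_gaussian \<partial>gibbs f)
    = (\<integral>\<^sup>+x. \<integral>\<^sup>+y. ennreal (K * (1 / sqrt (2 * pi)) ^ CARD('n) / sqrt (2 * d) ^ CARD('n)
        * min (exp (mala_log_joint d x y)) (exp (mala_log_joint d y x))) * J x y \<partial>lborel \<partial>lborel)"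
proof -
  interpret G: prob_space "std_gaussian :: (real^'n) measure" by (rule prob_space_std_gaussian)
  let ?k = "(1 / sqrt (2 * pi)) ^ CARD('n)"
  let ?s = "sqrt (2 * d)"
  have s: "0 < ?s" using d by simp
  have inner: "ennreal (K * exp (- f x)) * (\<integral>\<^sup>+z. ennreal (mala_accept d x (mala_proposal d x z)) * J x (mala_proposal d x z) \<partial>std_gaussian)
     = (\<integral>\<^sup>+y. ennreal (K * ?k / ?s ^ CARD('n)
        * min (exp (mala_log_joint d x y)) (exp (mala_log_joint d y x))) * J x y \<partial>lborel)" for x
  proof -
    have "(\<integral>\<^sup>+y. ennreal (K * ?k / ?s ^ CARD('n)
        * min (exp (mala_log_joint d x y)) (exp (mala_log_joint d y x))) * J x y \<partial>lborel)
      = ennreal (\<bar>?s\<bar> ^ DIM(real^'n)) * (\<integral>\<^sup>+z. ennreal (K * ?k / ?s ^ CARD('n)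
        * min (exp (mala_log_joint d x (mala_proposal d x z))) (exp (mala_log_joint d (mala_proposal d x z) x)))
          * J x (mala_proposal d x z) \<partial>lborel)"
      unfolding mala_proposal_def
      by (rule nn_integral_lborel_affine) (use s in \<open>auto simp: mala_log_joint_def\<close>)
    also have "\<dots> = (\<integral>\<^sup>+z. ennreal (?s ^ CARD('n)) * (ennreal (K * ?k / ?s ^ CARD('n)
        * min (exp (mala_log_joint d x (mala_proposal d x z))) (exp (mala_log_joint d (mala_proposal d x z) x)))
          * J x (mala_proposal d x z)) \<partial>lborel)"
      using s by (subst nn_integral_cmult) (auto simp: mala_log_joint_def)
    also have "\<dots> = (\<integral>\<^sup>+z. ennreal (K * exp (- f x)) * (ennreal (?k * exp (- (z \<bullet> z / 2)))
        * (ennreal (mala_accept d x (mala_proposal d x z)) * J x (mala_proposal d x z))) \<partial>lborel)"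
    proof (rule nn_integral_cong)
      fix z
      let ?y = "mala_proposal d x z"
      have "(norm (?y - x + d *\<^sub>R g x))\<^sup>2 / (4 * d) = z \<bullet> z / 2"
        using d by (simp add: mala_proposal_def power_mult_distrib dot_square_norm)
      then have A: "exp (mala_log_joint d x ?y) = exp (- f x) * exp (- (z \<bullet> z / 2))"
        by (simp add: mala_log_joint_def exp_add[symmetric])
      have pull: "ennreal p * (ennreal q * r) = ennreal (p * q) * r" if "0 \<le> p" for p q r
        using that by (simp add: ennreal_mult' mult.assoc)
      \<comment> \<open>Multiplying the ratio capped at 1 by its denominator gives the symmetric
        minimum.\<close>
      have "exp (mala_log_joint d x ?y) * mala_accept d x ?y
          = min (exp (mala_log_joint d x ?y)) (exp (mala_log_joint d ?y x))"
        by (simp add: mala_accept_def min_mult_distrib_left exp_diff)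
      then have "?s ^ CARD('n) * (K * ?k / ?s ^ CARD('n) * min (exp (mala_log_joint d x ?y)) (exp (mala_log_joint d ?y x)))
          = K * exp (- f x) * (?k * exp (- (z \<bullet> z / 2))) * mala_accept d x ?y"
        using s by (simp add: A mult_ac)
      moreover have "ennreal (?s ^ CARD('n)) * (ennreal (K * ?k / ?s ^ CARD('n)
          * min (exp (mala_log_joint d x ?y)) (exp (mala_log_joint d ?y x))) * J x ?y)
        = ennreal (?s ^ CARD('n) * (K * ?k / ?s ^ CARD('n) * min (exp (mala_log_joint d x ?y)) (exp (mala_log_joint d ?y x)))) * J x ?y"
        by (rule pull) (use s in simp)
      moreover have "ennreal (K * exp (- f x)) * (ennreal (?k * exp (- (z \<bullet> z / 2)))
          * (ennreal (mala_accept d x ?y) * J x ?y))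
        = ennreal (K * exp (- f x) * (?k * exp (- (z \<bullet> z / 2))) * mala_accept d x ?y) * J x ?y"
        by (subst pull, simp, subst pull) (use K_pos in \<open>auto simp: mult.assoc\<close>)
      ultimately show "ennreal (?s ^ CARD('n)) * (ennreal (K * ?k / ?s ^ CARD('n)
          * min (exp (mala_log_joint d x ?y)) (exp (mala_log_joint d ?y x))) * J x ?y)
        = ennreal (K * exp (- f x)) * (ennreal (?k * exp (- (z \<bullet> z / 2)))
          * (ennreal (mala_accept d x ?y) * J x ?y))" by simp
    qed
    also have "\<dots> = ennreal (K * exp (- f x)) * (\<integral>\<^sup>+z. ennreal (?k * exp (- (z \<bullet> z / 2)))
        * (ennreal (mala_accept d x (mala_proposal d x z)) * J x (mala_proposal d x z)) \<partial>lborel)"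
      by (rule nn_integral_cmult) measurable
    also have "(\<integral>\<^sup>+z. ennreal (?k * exp (- (z \<bullet> z / 2)))
        * (ennreal (mala_accept d x (mala_proposal d x z)) * J x (mala_proposal d x z)) \<partial>lborel)
      = (\<integral>\<^sup>+z. ennreal (mala_accept d x (mala_proposal d x z)) * J x (mala_proposal d x z) \<partial>std_gaussian)"
      by (subst std_gaussian_density, subst nn_integral_density) auto
    finally show ?thesis by simp
  qed
  show ?thesis
    unfolding inner[symmetric] by (subst gibbs_density, rule nn_integral_density) measurable
qed

text \<open>Exact invariance of the target is what lets the Metropolis chain play the role of the
  stationary Langevin diffusion.\<close>

lemma mala_step_preserves_gibbs:
  assumes d: "0 < d"
  shows "preserves (gibbs f \<Otimes>\<^sub>M mala_noise) (gibbs f) (\<lambda>(x, n). mala_step d x n)"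
proof (rule preservesI)
  interpret P: prob_space "gibbs f" by (rule prob_space_gibbs)
  interpret N: prob_space mala_noise by (rule prob_space_mala_noise)
  interpret G: prob_space "std_gaussian :: (real^'n) measure" by (rule prob_space_std_gaussian)
  interpret U: prob_space unit_uniform by (rule prob_space_unit_uniform)
  fix F :: "real^'n \<Rightarrow> ennreal" assume "F \<in> borel_measurable (gibbs f)"
  then have [measurable]: "F \<in> borel_measurable borel" by simp
  let ?a = "\<lambda>x z. mala_accept d x (mala_proposal d x z)"
  let ?c = "K * (1 / sqrt (2 * pi)) ^ CARD('n) / sqrt (2 * d) ^ CARD('n)"
  let ?s = "\<lambda>x y. ennreal (?c * min (exp (mala_log_joint d x y)) (exp (mala_log_joint d y x)))"
  have s_meas [measurable]: "(\<lambda>(x, y). ?s x y) \<in> borel_measurable (borel \<Otimes>\<^sub>M borel)"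
    unfolding mala_log_joint_def by measurable
  \<comment> \<open>Detailed balance in use: exchanging \<open>x\<close> and \<open>y\<close>
    carries the accepted mass back to the starting point, after which the weights of acceptance and
    rejection add up to 1.\<close>
  have swap: "(\<integral>\<^sup>+x. \<integral>\<^sup>+z. ennreal (?a x z) * F (mala_proposal d x z) \<partial>std_gaussian \<partial>gibbs f)
      = (\<integral>\<^sup>+x. \<integral>\<^sup>+z. ennreal (?a x z) * F x \<partial>std_gaussian \<partial>gibbs f)"
  proof -
    have "(\<integral>\<^sup>+x. \<integral>\<^sup>+y. ?s x y * F y \<partial>lborel \<partial>lborel) = (\<integral>\<^sup>+y. \<integral>\<^sup>+x. ?s x y * F y \<partial>lborel \<partial>lborel)"
      by (rule lborel_pair.Fubini'[symmetric]) measurable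
    also have "\<dots> = (\<integral>\<^sup>+x. \<integral>\<^sup>+y. ?s x y * F x \<partial>lborel \<partial>lborel)"
      by (simp only: min.commute)
    finally show ?thesis
      using nn_integral_mala_proposal[OF d, of "\<lambda>x y. F y"] nn_integral_mala_proposal[OF d, of "\<lambda>x y. F x"] by simp
  qed
  have "(\<integral>\<^sup>+x. F (case x of (x, n) \<Rightarrow> mala_step d x n) \<partial>(gibbs f \<Otimes>\<^sub>M mala_noise))
      = (\<integral>\<^sup>+x. \<integral>\<^sup>+z. \<integral>\<^sup>+u. F (mala_step d x (z, u)) \<partial>unit_uniform \<partial>std_gaussian \<partial>gibbs f)"
    by (subst N.nn_integral_fst[symmetric], simp, simp add: mala_noise_def, intro nn_integral_cong,
        subst U.nn_integral_fst[symmetric], auto)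
  also have "\<dots> = (\<integral>\<^sup>+x. \<integral>\<^sup>+z. ennreal (?a x z) * F (mala_proposal d x z) + ennreal (1 - ?a x z) * F x \<partial>std_gaussian \<partial>gibbs f)"
  proof (intro nn_integral_cong)
    fix x z
    have "(\<integral>\<^sup>+u. F (mala_step d x (z, u)) \<partial>unit_uniform)
        = (\<integral>\<^sup>+u. (if u \<le> ?a x z then F (mala_proposal d x z) else F x) \<partial>unit_uniform)"
      by (intro nn_integral_cong) (simp add: mala_step_def)
    then show "(\<integral>\<^sup>+u. F (mala_step d x (z, u)) \<partial>unit_uniform)
        = ennreal (?a x z) * F (mala_proposal d x z) + ennreal (1 - ?a x z) * F x"
      by (simp only: nn_integral_unit_uniform_threshold[OF mala_accept_bounds])
  qed
  also have "\<dots> = (\<integral>\<^sup>+x. \<integral>\<^sup>+z. ennreal (?a x z) * F (mala_proposal d x z) \<partial>std_gaussian \<partial>gibbs f)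
      + (\<integral>\<^sup>+x. \<integral>\<^sup>+z. ennreal (1 - ?a x z) * F x \<partial>std_gaussian \<partial>gibbs f)"
    by (simp add: nn_integral_add)
  also have "\<dots> = (\<integral>\<^sup>+x. \<integral>\<^sup>+z. ennreal (?a x z) * F x \<partial>std_gaussian \<partial>gibbs f)
      + (\<integral>\<^sup>+x. \<integral>\<^sup>+z. ennreal (1 - ?a x z) * F x \<partial>std_gaussian \<partial>gibbs f)"
    by (simp only: swap)
  also have "\<dots> = (\<integral>\<^sup>+x. \<integral>\<^sup>+z. ennreal (?a x z) * F x + ennreal (1 - ?a x z) * F x \<partial>std_gaussian \<partial>gibbs f)"
    by (simp add: nn_integral_add)
  also have "\<dots> = (\<integral>\<^sup>+x. F x \<partial>gibbs f)"
  proof (rule nn_integral_cong)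
    fix x
    have "ennreal (?a x z) * F x + ennreal (1 - ?a x z) * F x = F x" for z
      using mala_accept_bounds[of d x "mala_proposal d x z"]
      by (simp add: distrib_right[symmetric] ennreal_plus[symmetric] del: ennreal_plus)
    then show "(\<integral>\<^sup>+z. ennreal (?a x z) * F x + ennreal (1 - ?a x z) * F x \<partial>std_gaussian) = F x"
      by (simp add: G.emeasure_space_1[simplified])
  qed
  finally show "(\<integral>\<^sup>+x. F (case x of (x, n) \<Rightarrow> mala_step d x n) \<partial>(gibbs f \<Otimes>\<^sub>M mala_noise)) = (\<integral>\<^sup>+x. F x \<partial>gibbs f)" .
qed measurable


text \<open>The log acceptance ratio is minus the trapezoid error plus \<open>d / 4\<close> times
  the difference of the squared gradient norms, and \<open>1 - min 1 (exp l) <= |l|\<close>. The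
  Lipschitz bound on \<open>g\<close> controls the second term.\<close>

lemma mala_rejection_le:
  assumes d: "0 < d"
  shows "1 - mala_accept d x (x + v)
    \<le> \<bar>trapezoid_error x v\<bar> + d / 4 * (M * norm v * (2 * norm (g x) + M * norm v))"
proof -
  define y where "y = x + v"
  define l where "l = mala_log_joint d y x - mala_log_joint d x y"
  have a: "(norm (y - x + d *\<^sub>R g x))\<^sup>2 = (norm v)\<^sup>2 + 2 * d * (g x \<bullet> v) + d\<^sup>2 * (norm (g x))\<^sup>2"
    unfolding power2_norm_eq_inner y_def
    by (simp add: inner_add_left inner_add_right inner_commute[of v "g x"] power2_eq_square algebra_simps)
  have b: "(norm (x - y + d *\<^sub>R g y))\<^sup>2 = (norm v)\<^sup>2 - 2 * d * (g y \<bullet> v) + d\<^sup>2 * (norm (g y))\<^sup>2"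
    unfolding power2_norm_eq_inner y_def
    by (simp add: inner_add_left inner_add_right inner_commute[of v "g (v + x)"] inner_commute[of v "g (x + v)"] power2_eq_square algebra_simps)
  have l: "l = - trapezoid_error x v + d / 4 * ((norm (g x))\<^sup>2 - (norm (g y))\<^sup>2)"
    unfolding l_def mala_log_joint_def a b trapezoid_error_def y_def[symmetric]
    using d by (simp add: field_simps inner_add_left power2_eq_square)
  have gy: "norm (g y - g x) \<le> M * norm v" using g_lipschitz_add[of x v] by (simp add: y_def)
  have "(norm (g x))\<^sup>2 - (norm (g y))\<^sup>2 = (norm (g x) - norm (g y)) * (norm (g y) + norm (g x))"
    by (simp add: power2_eq_square algebra_simps)
  then have "\<bar>(norm (g x))\<^sup>2 - (norm (g y))\<^sup>2\<bar> = \<bar>norm (g y) - norm (g x)\<bar> * (norm (g y) + norm (g x))"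
    by (simp add: abs_mult abs_minus_commute)
  also have "\<dots> \<le> (M * norm v) * (2 * norm (g x) + M * norm v)"
    using gy norm_triangle_ineq3[of "g y" "g x"] norm_triangle_ineq2[of "g y" "g x"] M_pos by (intro mult_mono) auto
  finally have "\<bar>d / 4 * ((norm (g x))\<^sup>2 - (norm (g y))\<^sup>2)\<bar> \<le> d / 4 * (M * norm v * (2 * norm (g x) + M * norm v))"
    using d by (simp add: abs_mult mult_left_mono)
  then have "\<bar>l\<bar> \<le> \<bar>trapezoid_error x v\<bar> + d / 4 * (M * norm v * (2 * norm (g x) + M * norm v))"
    unfolding l by linarith
  moreover have "1 - mala_accept d x y \<le> \<bar>l\<bar>"
  proof -
    have "1 - exp l \<le> \<bar>l\<bar>" using exp_ge_add_one_self[of l] by linarith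
    then show ?thesis unfolding mala_accept_def l_def[symmetric] by linarith
  qed
  ultimately show ?thesis by (simp add: y_def)
qed

text \<open>One factor \<open>d\<close> is split off and the rest is made independent of
  \<open>d\<close>, so that one integrable bound serves all step sizes \<open>h / k\<close>.\<close>

lemma mala_displacement:
  assumes "0 < d" "d \<le> h"
  shows "(norm (mala_proposal d x z - x))\<^sup>2 \<le> d * (2 * h * (norm (g x))\<^sup>2 + 4 * (norm z)\<^sup>2)"
proof -
  have "norm (mala_proposal d x z - x) \<le> d * norm (g x) + sqrt (2 * d) * norm z"
    using norm_triangle_ineq[of "- d *\<^sub>R g x" "sqrt (2 * d) *\<^sub>R z"] assms by (simp add: mala_proposal_def)
  then have "(norm (mala_proposal d x z - x))\<^sup>2 \<le> (d * norm (g x) + sqrt (2 * d) * norm z)\<^sup>2"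
    by (rule power_mono) simp
  also have "\<dots> \<le> 2 * (d * norm (g x))\<^sup>2 + 2 * (sqrt (2 * d) * norm z)\<^sup>2"
    using square_add_le_weighted[of 1 "d * norm (g x)" "sqrt (2 * d) * norm z"] by simp
  also have "\<dots> = d * (2 * d * (norm (g x))\<^sup>2 + 4 * (norm z)\<^sup>2)"
    using assms by (simp add: power_mult_distrib algebra_simps power2_eq_square)
  also have "\<dots> \<le> d * (2 * h * (norm (g x))\<^sup>2 + 4 * (norm z)\<^sup>2)"
    using assms by (intro mult_left_mono add_right_mono mult_right_mono) auto
  finally show ?thesis .
qed

text \<open>As \<open>f\<close> is only twice differentiable, there is no rate for the rejection probability, hence the
  argument by dominated convergence.\<close>

lemma mala_rejection_vanishes:
  assumes h: "0 < h"
  shows "(\<lambda>k. \<integral>\<^sup>+(x, z). ennreal ((real (Suc k))\<^sup>2 * ((norm (mala_proposal (h / Suc k) x z - x))\<^sup>2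
      * (1 - mala_accept (h / Suc k) x (mala_proposal (h / Suc k) x z)))) \<partial>(gibbs f \<Otimes>\<^sub>M std_gaussian)) \<longlonglongrightarrow> 0"
proof -
  interpret P: prob_space "gibbs f" by (rule prob_space_gibbs)
  interpret G: prob_space "std_gaussian :: (real^'n) measure" by (rule prob_space_std_gaussian)
  define d where "d = (\<lambda>k. h / real (Suc k))"
  define V where "V = (\<lambda>k x z. mala_proposal (d k) x z - x)"
  \<comment> \<open>The squared number of steps is the scale at which the L2 defects of all steps
    together still vanish.\<close>
  define T where "T = (\<lambda>k x z. (real (Suc k))\<^sup>2 * ((norm (V k x z))\<^sup>2 * (1 - mala_accept (d k) x (mala_proposal (d k) x z))))"
  define N where "N = (\<lambda>x z. 2 * h * (norm (g x))\<^sup>2 + 4 * (norm (z::real^'n))\<^sup>2)"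
  \<comment> \<open>An upper bound for \<open>T\<close> whose prefactor is \<open>h^2\<close>, the
    square of \<open>Suc k * d k\<close>. It tends to 0 pointwise by
    \<open>trapezoid_error_small\<close> and is dominated by means of
    \<open>trapezoid_error_le\<close>.\<close>
  define S where "S = (\<lambda>k x z. h\<^sup>2 * N x z * (\<bar>trapezoid_error x (V k x z)\<bar> / d k
      + M / 4 * (norm (V k x z) * (2 * norm (g x) + M * norm (V k x z)))))"
  define C where "C = h\<^sup>2 * (M + M / 4 * (h + 1 / (2 * h) + M * h))"
  have dk: "0 < d k" "d k \<le> h" for k using h by (auto simp: d_def field_simps)
  have N0: "0 \<le> N x z" for x z using h by (simp add: N_def)
  have VN: "(norm (V k x z))\<^sup>2 \<le> d k * N x z" for k x z
    unfolding V_def N_def by (rule mala_displacement[OF dk])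
  have VhN: "(norm (V k x z))\<^sup>2 \<le> h * N x z" for k x z
    using VN[of k x z] mult_right_mono[OF dk(2)[of k] N0[of x z]] by linarith
  have T0: "0 \<le> T k x z" for k x z using mala_accept_bounds[of "d k" x] by (simp add: T_def)
  have TS: "T k x z \<le> S k x z" for k x z
  proof -
    have R: "1 - mala_accept (d k) x (mala_proposal (d k) x z)
        \<le> \<bar>trapezoid_error x (V k x z)\<bar> + d k / 4 * (M * norm (V k x z) * (2 * norm (g x) + M * norm (V k x z)))"
      using mala_rejection_le[OF dk(1), of k x "V k x z"] by (simp add: V_def)
    have "T k x z \<le> (real (Suc k))\<^sup>2 * ((d k * N x z) * (\<bar>trapezoid_error x (V k x z)\<bar>
        + d k / 4 * (M * norm (V k x z) * (2 * norm (g x) + M * norm (V k x z)))))"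
      unfolding T_def using mala_accept_bounds[of "d k" x] dk[of k] N0[of x z]
      by (intro mult_left_mono mult_mono VN R) auto
    also have "\<dots> = ((real (Suc k)) * d k)\<^sup>2 * N x z * (\<bar>trapezoid_error x (V k x z)\<bar> / d k
      + M / 4 * (norm (V k x z) * (2 * norm (g x) + M * norm (V k x z))))"
      using dk(1)[of k] by (simp add: field_simps power2_eq_square)
    also have "real (Suc k) * d k = h" by (simp add: d_def)
    finally show ?thesis by (simp add: S_def)
  qed
  have SC: "S k x z \<le> C * (N x z)\<^sup>2" for k x z
  proof -
    have "\<bar>trapezoid_error x (V k x z)\<bar> / d k \<le> M * (d k * N x z) / d k"
      using trapezoid_error_le[of x "V k x z"] VN[of k x z] dk(1)[of k] M_pos
      by (intro divide_right_mono) (auto intro: order_trans mult_left_mono)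
    then have 1: "\<bar>trapezoid_error x (V k x z)\<bar> / d k \<le> M * N x z" using dk(1)[of k] by simp
    have "(norm (g x))\<^sup>2 \<le> N x z / (2 * h)" using h by (simp add: N_def field_simps)
    moreover have "2 * (norm (V k x z) * norm (g x)) \<le> (norm (V k x z))\<^sup>2 + (norm (g x))\<^sup>2"
      using sum_squares_bound[of "norm (V k x z)" "norm (g x)"] by simp
    moreover have "norm (V k x z) * (2 * norm (g x) + M * norm (V k x z))
        = 2 * (norm (V k x z) * norm (g x)) + M * (norm (V k x z))\<^sup>2"
      by (simp add: algebra_simps power2_eq_square)
    moreover have "M * (norm (V k x z))\<^sup>2 \<le> M * (h * N x z)"
      using VhN[of k x z] M_pos by simp
    ultimately have "norm (V k x z) * (2 * norm (g x) + M * norm (V k x z)) \<le> h * N x z + N x z / (2 * h) + M * (h * N x z)"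
      using VhN[of k x z] by linarith
    then have 2: "M / 4 * (norm (V k x z) * (2 * norm (g x) + M * norm (V k x z)))
        \<le> M / 4 * (h * N x z + N x z / (2 * h) + M * (h * N x z))"
      using M_pos by (intro mult_left_mono) auto
    have "S k x z \<le> h\<^sup>2 * N x z * (M * N x z + M / 4 * (h * N x z + N x z / (2 * h) + M * (h * N x z)))"
      unfolding S_def using N0[of x z] by (intro mult_left_mono[OF add_mono[OF 1 2]]) simp
    also have "\<dots> = C * (N x z)\<^sup>2" by (simp add: C_def power2_eq_square algebra_simps)
    finally show ?thesis .
  qed
  have S_lim: "(\<lambda>k. S k x z) \<longlonglongrightarrow> 0" for x z
  proof -
    have d0: "d \<longlonglongrightarrow> 0" unfolding d_def using LIMSEQ_Suc[OF lim_const_over_n[of h]] by simp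
    have "(\<lambda>k. (norm (V k x z))\<^sup>2) \<longlonglongrightarrow> 0"
      by (rule tendsto_sandwich[OF _ _ tendsto_const tendsto_mult_left_zero[OF d0, of "N x z"]]) (auto simp: VN)
    then have V0: "(\<lambda>k. norm (V k x z)) \<longlonglongrightarrow> 0" using tendsto_real_sqrt by fastforce
    have E0: "(\<lambda>k. \<bar>trapezoid_error x (V k x z)\<bar> / d k) \<longlonglongrightarrow> 0"
    proof (rule LIMSEQ_I)
      fix e :: real assume e: "0 < e"
      define e' where "e' = e / (N x z + 1)"
      have e': "0 < e'" using e N0[of x z] by (simp add: e'_def)
      obtain r where r: "0 < r" "\<And>v. norm v < r \<Longrightarrow> \<bar>trapezoid_error x v\<bar> \<le> e' * (norm v)\<^sup>2"
        using trapezoid_error_small[OF e', of x] by blast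
      obtain k0 where k0: "\<And>k. k \<ge> k0 \<Longrightarrow> norm (V k x z) < r"
        using LIMSEQ_D[OF V0 r(1)] by auto
      have "norm (\<bar>trapezoid_error x (V k x z)\<bar> / d k - 0) < e" if "k \<ge> k0" for k
      proof -
        have "\<bar>trapezoid_error x (V k x z)\<bar> \<le> e' * (d k * N x z)"
          using r(2)[OF k0[OF that]] VN[of k x z] e' by (meson less_imp_le mult_left_mono order_trans)
        then have "\<bar>trapezoid_error x (V k x z)\<bar> / d k \<le> e' * N x z"
          using dk(1)[of k] by (simp add: field_simps)
        also have "\<dots> < e' * (N x z + 1)" using e' by simp
        also have "\<dots> = e" using N0[of x z] by (simp add: e'_def)
        finally show ?thesis using dk(1)[of k] by simp
      qed
      then show "\<exists>k0. \<forall>k\<ge>k0. norm (\<bar>trapezoid_error x (V k x z)\<bar> / d k - 0) < e" by blast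
    qed
    have "(\<lambda>k. h\<^sup>2 * N x z * (\<bar>trapezoid_error x (V k x z)\<bar> / d k
      + M / 4 * (norm (V k x z) * (2 * norm (g x) + M * norm (V k x z)))))
      \<longlonglongrightarrow> h\<^sup>2 * N x z * (0 + M / 4 * (0 * (2 * norm (g x) + M * 0)))"
      by (intro tendsto_intros E0 V0)
    then show ?thesis by (simp add: S_def)
  qed
  have T_lim: "(\<lambda>k. T k x z) \<longlonglongrightarrow> 0" for x z
    by (rule tendsto_sandwich[OF _ _ tendsto_const S_lim[of x z]]) (auto simp: T0 TS)
  have C0: "0 \<le> C" using h M_pos by (simp add: C_def)
  \<comment> \<open>Bounds \<open>C\<close> times the square of \<open>N\<close>, split so that only
    fourth moments of the gradient and of the Gaussian occur.\<close>
  define W where "W = (\<lambda>(x, z). ennreal C * (ennreal (8 * h\<^sup>2) * ennreal (norm (g x) ^ 4) + 32 * ennreal (norm (z::real^'n) ^ 4)))"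
  have TW: "ennreal (T k x z) \<le> W (x, z)" for k x z
  proof -
    have "(N x z)\<^sup>2 \<le> 2 * (2 * h * (norm (g x))\<^sup>2)\<^sup>2 + 2 * (4 * (norm z)\<^sup>2)\<^sup>2"
      using square_add_le_weighted[of 1 "2 * h * (norm (g x))\<^sup>2" "4 * (norm z)\<^sup>2"] by (simp add: N_def)
    also have "\<dots> = 8 * h\<^sup>2 * norm (g x) ^ 4 + 32 * norm z ^ 4"
      by (simp add: power_mult_distrib power_mult[symmetric])
    finally have "T k x z \<le> C * (8 * h\<^sup>2 * norm (g x) ^ 4 + 32 * norm z ^ 4)"
      using TS[of k x z] SC[of k x z] C0 by (meson mult_left_mono order_trans)
    then have "ennreal (T k x z) \<le> ennreal (C * (8 * h\<^sup>2 * norm (g x) ^ 4 + 32 * norm z ^ 4))"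
      by (rule ennreal_leI)
    also have "\<dots> = W (x, z)"
      using C0 by (simp add: W_def ennreal_mult)
    finally show ?thesis .
  qed
  have "(\<integral>\<^sup>+y. W y \<partial>(gibbs f \<Otimes>\<^sub>M std_gaussian))
      = (\<integral>\<^sup>+x. \<integral>\<^sup>+z. W (x, z) \<partial>std_gaussian \<partial>gibbs f)"
    by (rule G.nn_integral_fst[symmetric]) (simp add: W_def)
  also have "\<dots> = ennreal C * (ennreal (8 * h\<^sup>2) * (\<integral>\<^sup>+x. ennreal (norm (g x) ^ 4) \<partial>gibbs f)
      + 32 * (\<integral>\<^sup>+z. ennreal (norm z ^ 4) \<partial>(std_gaussian :: (real^'n) measure)))"
    by (simp add: W_def nn_integral_cmult nn_integral_add G.emeasure_space_1[simplified] P.emeasure_space_1[simplified])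
  also have "\<dots> < \<infinity>"
    using gradient_fourth_moment std_gaussian_fourth_moment[where 'a="real^'n"]
    by (simp add: ennreal_mult_less_top)
  finally have W_fin: "(\<integral>\<^sup>+y. W y \<partial>(gibbs f \<Otimes>\<^sub>M std_gaussian)) < \<infinity>" .
  have "(\<lambda>k. \<integral>\<^sup>+y. ennreal (T k (fst y) (snd y)) \<partial>(gibbs f \<Otimes>\<^sub>M std_gaussian))
      \<longlonglongrightarrow> (\<integral>\<^sup>+y. 0 \<partial>(gibbs f \<Otimes>\<^sub>M (std_gaussian :: (real^'n) measure)))"
  proof (rule nn_integral_dominated_convergence[OF _ _ _ _ W_fin])
    show "\<And>k. (\<lambda>y. ennreal (T k (fst y) (snd y))) \<in> borel_measurable (gibbs f \<Otimes>\<^sub>M std_gaussian)"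
      unfolding T_def V_def by measurable
    show "W \<in> borel_measurable (gibbs f \<Otimes>\<^sub>M std_gaussian)" unfolding W_def by measurable
    show "AE y in gibbs f \<Otimes>\<^sub>M std_gaussian. (\<lambda>k. ennreal (T k (fst y) (snd y))) \<longlonglongrightarrow> 0"
      using tendsto_ennrealI[OF T_lim] by simp
  qed (use TW in auto)
  then show ?thesis by (simp add: T_def V_def d_def case_prod_beta')
qed

text \<open>At \<open>e / k\<close> per step the rejections of all \<open>k\<close> steps cost at
  most \<open>e\<close>. A rejected move stays at \<open>x\<close>, so integrating out the uniform
  variable leaves the squared displacement times the rejection probability.\<close>

lemma mala_rejection_small:
  assumes h: "0 < h" and e: "0 < e"
  obtains k :: nat where "0 < k"
    "L2_le (gibbs f \<Otimes>\<^sub>M mala_noise) (\<lambda>(x, n). mala_step (h / k) x n - mala_proposal (h / k) x (fst n)) (e / k)"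
proof -
  interpret P: prob_space "gibbs f" by (rule prob_space_gibbs)
  interpret N: prob_space mala_noise by (rule prob_space_mala_noise)
  interpret G: prob_space "std_gaussian :: (real^'n) measure" by (rule prob_space_std_gaussian)
  interpret U: prob_space unit_uniform by (rule prob_space_unit_uniform)
  let ?I = "\<lambda>k::nat. \<integral>\<^sup>+(x, z). ennreal ((real k)\<^sup>2 * ((norm (mala_proposal (h / k) x z - x))\<^sup>2
      * (1 - mala_accept (h / k) x (mala_proposal (h / k) x z)))) \<partial>(gibbs f \<Otimes>\<^sub>M std_gaussian)"
  have "0 < ennreal (e\<^sup>2)" using e by simp
  with order_tendstoD(2)[OF mala_rejection_vanishes[OF h]] have "\<forall>\<^sub>F k in sequentially. ?I (Suc k) < ennreal (e\<^sup>2)"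
    by simp
  then obtain k' where k': "?I (Suc k') < ennreal (e\<^sup>2)"
    by (auto simp: eventually_sequentially)
  define k where "k = Suc k'"
  define d where "d = h / k"
  have k: "0 < k" by (simp add: k_def)
  let ?a = "\<lambda>x z. mala_accept d x (mala_proposal d x z)"
  have "(\<integral>\<^sup>+y. ennreal ((norm (case y of (x, n) \<Rightarrow> mala_step d x n - mala_proposal d x (fst n)))\<^sup>2) \<partial>(gibbs f \<Otimes>\<^sub>M mala_noise))
      = (\<integral>\<^sup>+x. \<integral>\<^sup>+z. \<integral>\<^sup>+u. ennreal ((norm (mala_step d x (z, u) - mala_proposal d x z))\<^sup>2) \<partial>unit_uniform \<partial>std_gaussian \<partial>gibbs f)"
    by (subst N.nn_integral_fst[symmetric], simp, simp add: mala_noise_def, intro nn_integral_cong,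
        subst U.nn_integral_fst[symmetric], auto)
  also have "\<dots> = (\<integral>\<^sup>+x. \<integral>\<^sup>+z. ennreal ((norm (mala_proposal d x z - x))\<^sup>2 * (1 - ?a x z)) \<partial>std_gaussian \<partial>gibbs f)"
  proof (intro nn_integral_cong)
    fix x z
    have "(\<integral>\<^sup>+u. ennreal ((norm (mala_step d x (z, u) - mala_proposal d x z))\<^sup>2) \<partial>unit_uniform)
        = (\<integral>\<^sup>+u. (if u \<le> ?a x z then 0 else ennreal ((norm (mala_proposal d x z - x))\<^sup>2)) \<partial>unit_uniform)"
      by (intro nn_integral_cong) (simp add: mala_step_def norm_minus_commute)
    also have "\<dots> = ennreal (1 - ?a x z) * ennreal ((norm (mala_proposal d x z - x))\<^sup>2)"
      by (simp only: nn_integral_unit_uniform_threshold[OF mala_accept_bounds]) simp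
    finally show "(\<integral>\<^sup>+u. ennreal ((norm (mala_step d x (z, u) - mala_proposal d x z))\<^sup>2) \<partial>unit_uniform)
        = ennreal ((norm (mala_proposal d x z - x))\<^sup>2 * (1 - ?a x z))"
      using mala_accept_bounds[of d x] by (simp add: ennreal_mult mult.commute)
  qed
  also have "\<dots> = (\<integral>\<^sup>+(x, z). ennreal ((norm (mala_proposal d x z - x))\<^sup>2 * (1 - ?a x z)) \<partial>(gibbs f \<Otimes>\<^sub>M std_gaussian))"
    by (subst G.nn_integral_fst[symmetric]) auto
  finally have J: "(\<integral>\<^sup>+y. ennreal ((norm (case y of (x, n) \<Rightarrow> mala_step d x n - mala_proposal d x (fst n)))\<^sup>2) \<partial>(gibbs f \<Otimes>\<^sub>M mala_noise))
    = (\<integral>\<^sup>+(x, z). ennreal ((norm (mala_proposal d x z - x))\<^sup>2 * (1 - ?a x z)) \<partial>(gibbs f \<Otimes>\<^sub>M std_gaussian))"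
    (is "?J = ?J'") .
  have "ennreal ((real k)\<^sup>2) * ?J' = ?I k"
    using mala_accept_bounds[of d]
    by (subst nn_integral_cmult[symmetric]) (auto intro!: nn_integral_cong simp: d_def ennreal_mult case_prod_beta')
  then have "ennreal ((real k)\<^sup>2) * ?J \<le> ennreal (e\<^sup>2)" using k' unfolding J by (simp add: k_def)
  also have "\<dots> = ennreal ((real k)\<^sup>2) * ennreal ((e / k)\<^sup>2)"
    using k by (simp add: ennreal_mult[symmetric] power_divide)
  finally have "?J \<le> ennreal ((e / k)\<^sup>2)" using k by (simp add: ennreal_mult_le_mult_iff)
  then have "L2_le (gibbs f \<Otimes>\<^sub>M mala_noise) (\<lambda>(x, n). mala_step d x n - mala_proposal d x (fst n)) (e / k)"
    using e by (simp add: L2_le_def)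
  then show ?thesis using that[OF k] by (simp add: d_def)
qed

end

section \<open>Stationary paths driven by Gaussian noise\<close>

lemma (in prob_space) preserves_stream_uncons:
  "preserves (stream_space M) (M \<Otimes>\<^sub>M stream_space M) (\<lambda>w. (shd w, stl w))"
proof (rule preservesI)
  interpret S: prob_space "stream_space M" by (rule prob_space_stream_space)
  fix F :: "'a \<times> 'a stream \<Rightarrow> ennreal" assume [measurable]: "F \<in> borel_measurable (M \<Otimes>\<^sub>M stream_space M)"
  have "(\<integral>\<^sup>+w. F (shd w, stl w) \<partial>stream_space M) = (\<integral>\<^sup>+x. \<integral>\<^sup>+w. F (x, w) \<partial>stream_space M \<partial>M)"
    by (subst nn_integral_stream_space) simp_all
  also have "\<dots> = (\<integral>\<^sup>+y. F y \<partial>(M \<Otimes>\<^sub>M stream_space M))"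
    by (rule S.nn_integral_fst) simp
  finally show "(\<integral>\<^sup>+w. F (shd w, stl w) \<partial>stream_space M) = (\<integral>\<^sup>+y. F y \<partial>(M \<Otimes>\<^sub>M stream_space M))" .
qed measurable

context vec_smooth_convex
begin

text \<open>The head of the stream is the last innovation: the chain first runs on the tail. One
  split of the stream then separates the current state from the next innovation, and induction on
  \<open>j\<close> needs no shifted indices.\<close>

primrec mala_chain :: "real \<Rightarrow> nat \<Rightarrow> real^'n \<Rightarrow> ((real^'n) \<times> real) stream \<Rightarrow> real^'n" where
  "mala_chain d 0 x w = x"
| "mala_chain d (Suc j) x w = mala_step d (mala_chain d j x (stl w)) (shd w)"

text \<open>Plays the Brownian increment over time \<open>j * d\<close> and reads the stream in the
  same order as \<open>mala_chain\<close>.\<close>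

primrec noise_sum :: "real \<Rightarrow> nat \<Rightarrow> ((real^'n) \<times> real) stream \<Rightarrow> real^'n" where
  "noise_sum d 0 w = 0"
| "noise_sum d (Suc j) w = noise_sum d j (stl w) + sqrt (2 * d) *\<^sub>R fst (shd w)"

abbreviation mala_stream :: "((real^'n) \<times> real) stream measure" where
  "mala_stream \<equiv> stream_space mala_noise"

lemma prob_space_mala_stream: "prob_space mala_stream"
  by (rule prob_space.prob_space_stream_space[OF prob_space_mala_noise])

lemma prob_space_gibbs_stream: "prob_space (gibbs f \<Otimes>\<^sub>M mala_stream)"
  by (intro prob_space_pair prob_space_gibbs prob_space_mala_stream)

lemma preserves_gibbs_stream_uncons:
  "preserves (gibbs f \<Otimes>\<^sub>M mala_stream) ((gibbs f \<Otimes>\<^sub>M mala_stream) \<Otimes>\<^sub>M mala_noise) (\<lambda>(x, w). ((x, stl w), shd w))"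
proof -
  have "preserves (gibbs f \<Otimes>\<^sub>M mala_stream) (gibbs f \<Otimes>\<^sub>M (mala_noise \<Otimes>\<^sub>M mala_stream)) (\<lambda>(x, w). (x, shd w, stl w))"
    using preserves_prod[OF preserves_id prob_space.preserves_stream_uncons[OF prob_space_mala_noise]
        prob_space_gibbs prob_space_mala_stream] .
  from preserves_comp[OF this preserves_swap_assoc[OF prob_space_gibbs prob_space_mala_noise prob_space_mala_stream]]
  show ?thesis by (simp add: case_prod_beta')
qed

lemma preserves_gibbs_stream_tail:
  "preserves (gibbs f \<Otimes>\<^sub>M mala_stream) (gibbs f \<Otimes>\<^sub>M mala_stream) (\<lambda>(x, w). (x, stl w))"
  using preserves_comp[OF preserves_gibbs_stream_uncons preserves_fst[OF prob_space_mala_noise]]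
  by (simp add: case_prod_beta')

lemma mala_chain_preserves_gibbs:
  assumes d: "0 < d"
  shows "preserves (gibbs f \<Otimes>\<^sub>M mala_stream) (gibbs f) (\<lambda>(x, w). mala_chain d j x w)"
proof (induction j)
  case 0
  show ?case using preserves_fst[OF prob_space_mala_stream, of "gibbs f"] by (simp add: case_prod_beta')
next
  case (Suc j)
  have "preserves ((gibbs f \<Otimes>\<^sub>M mala_stream) \<Otimes>\<^sub>M mala_noise) (gibbs f \<Otimes>\<^sub>M mala_noise)
      (\<lambda>(y, n). ((case y of (x, w) \<Rightarrow> mala_chain d j x w), n))"
    by (rule preserves_prod[OF Suc.IH preserves_id prob_space_gibbs_stream prob_space_mala_noise])
  from preserves_comp[OF preserves_comp[OF preserves_gibbs_stream_uncons this] mala_step_preserves_gibbs[OF d]]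
  show ?case by (simp add: case_prod_beta')
qed

text \<open>The state before the last move is stationary and independent of the last innovation, so
  the one-step rejection bound holds unchanged at every time.\<close>

lemma mala_chain_last_step_preserves:
  assumes d: "0 < d"
  shows "preserves (gibbs f \<Otimes>\<^sub>M mala_stream) (gibbs f \<Otimes>\<^sub>M mala_noise) (\<lambda>(x, w). (mala_chain d j x (stl w), shd w))"
proof -
  have "preserves ((gibbs f \<Otimes>\<^sub>M mala_stream) \<Otimes>\<^sub>M mala_noise) (gibbs f \<Otimes>\<^sub>M mala_noise)
      (\<lambda>(y, n). ((case y of (x, w) \<Rightarrow> mala_chain d j x w), n))"
    by (rule preserves_prod[OF mala_chain_preserves_gibbs[OF d] preserves_id prob_space_gibbs_stream prob_space_mala_noise])
  from preserves_comp[OF preserves_gibbs_stream_uncons this] show ?thesis by (simp add: case_prod_beta')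
qed

text \<open>Independent standard Gaussians with weights \<open>sqrt (1 / Suc j)\<close> and
  \<open>sqrt (j / Suc j)\<close> combine to a standard one. Normalising at each stage lets
  \<open>std_gaussian_combination\<close> do the induction step.\<close>

lemma noise_sum_gaussian:
  assumes d: "0 < d" and "0 < j"
  shows "preserves mala_stream std_gaussian (\<lambda>w. (1 / sqrt (2 * d * j)) *\<^sub>R noise_sum d j w)"
  using assms(2)
proof (induction j rule: nat_induct_non_zero)
  case 1
  have "preserves mala_stream mala_noise shd"
    using preserves_comp[OF prob_space.preserves_stream_uncons[OF prob_space_mala_noise]
        preserves_fst[OF prob_space_mala_stream]] by simp
  moreover have "preserves mala_noise std_gaussian fst"
    unfolding mala_noise_def by (rule preserves_fst[OF prob_space_unit_uniform])
  ultimately show ?case using preserves_comp d by fastforce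
next
  case (Suc j)
  define c s where "c = sqrt (1 / Suc j)" and "s = sqrt (j / Suc j)"
  have cs: "c\<^sup>2 + s\<^sup>2 = 1" "0 \<le> s" by (auto simp: c_def s_def add_divide_distrib[symmetric])
  have fst: "preserves mala_noise std_gaussian fst"
    unfolding mala_noise_def by (rule preserves_fst[OF prob_space_unit_uniform])
  have "preserves (mala_noise \<Otimes>\<^sub>M mala_stream) (std_gaussian \<Otimes>\<^sub>M std_gaussian)
      (\<lambda>(n, w). (fst n, (1 / sqrt (2 * d * j)) *\<^sub>R noise_sum d j w))"
    by (rule preserves_prod[OF fst Suc.IH prob_space_mala_noise prob_space_mala_stream])
  from preserves_comp[OF preserves_comp[OF prob_space.preserves_stream_uncons[OF prob_space_mala_noise] this]
      std_gaussian_combination[OF cs(2,1)]]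
  have *: "preserves mala_stream std_gaussian
      (\<lambda>w. c *\<^sub>R fst (shd w) + s *\<^sub>R (1 / sqrt (2 * d * j)) *\<^sub>R noise_sum d j (stl w))"
    by (simp add: case_prod_beta')
  have "c = 1 / sqrt (2 * d * Suc j) * sqrt (2 * d)" "s * (1 / sqrt (2 * d * j)) = 1 / sqrt (2 * d * Suc j)"
    using d Suc.hyps
    by (simp_all only: c_def s_def real_sqrt_divide real_sqrt_mult[of "2 * d"]) (simp_all del: of_nat_Suc)
  then have "c *\<^sub>R fst (shd w) + s *\<^sub>R (1 / sqrt (2 * d * j)) *\<^sub>R noise_sum d j (stl w)
      = (1 / sqrt (2 * d * Suc j)) *\<^sub>R noise_sum d (Suc j) w" for w
    by (simp only: noise_sum.simps scaleR_add_right scaleR_scaleR add.commute)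
  with * show ?case by (simp only:)
qed

lemma noise_sum_L2:
  assumes d: "0 < d"
  shows "L2_le mala_stream (noise_sum d j) (sqrt (2 * d * j * CARD('n)))"
proof (cases "j = 0")
  case True
  moreover have "noise_sum d 0 = (\<lambda>w. 0)" by (simp add: fun_eq_iff)
  ultimately show ?thesis by (simp add: L2_le_def)
next
  case False
  then have j: "0 < j" by simp
  have "L2_le mala_stream (\<lambda>w. (1 / sqrt (2 * d * j)) *\<^sub>R noise_sum d j w) (sqrt CARD('n))"
    using L2_le_preserves[OF std_gaussian_L2 noise_sum_gaussian[OF d j]] by simp
  from L2_le_scaleR[OF this, of "sqrt (2 * d * j)"] show ?thesis
    using d j by (simp add: real_sqrt_mult)
qed

text \<open>The strong error of the chain is additive over the steps because every iterate is again
  distributed according to the target: no Gronwall argument is needed.\<close>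

lemma
  fixes d r :: real and k :: nat
  assumes d: "0 < d" and r: "0 \<le> r"
    and rej: "L2_le (gibbs f \<Otimes>\<^sub>M mala_noise) (\<lambda>(x, n). mala_step d x n - mala_proposal d x (fst n)) r"
  shows mala_chain_displacement: "L2_le (gibbs f \<Otimes>\<^sub>M mala_stream) (\<lambda>(x, w). mala_chain d j x w - x - noise_sum d j w)
      (j * (d * sqrt (M * CARD('n)) + r))"
    and mala_chain_error: "j \<le> k \<Longrightarrow> L2_le (gibbs f \<Otimes>\<^sub>M mala_stream)
      (\<lambda>(x, w). mala_chain d j x w - x - noise_sum d j w + (j * d) *\<^sub>R g x)
      (j * (r + d * (M * (sqrt (2 * d * k * CARD('n)) + k * (d * sqrt (M * CARD('n)) + r)))))"
proof -
  let ?P = "gibbs f \<Otimes>\<^sub>M mala_stream"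
  note chain = mala_chain_preserves_gibbs[OF d]
  have chain_meas [measurable]: "(\<lambda>(x, w). mala_chain d j x w) \<in> borel_measurable ?P" for j
    using preservesD[OF chain[of j]] measurable_cong_sets[OF refl sets_gibbs] by blast
  have noise_L2: "L2_le ?P (\<lambda>y. noise_sum d j (snd y)) (sqrt (2 * d * j * CARD('n)))" for j
    by (rule L2_le_preserves[OF noise_sum_L2[OF d] preserves_snd[OF prob_space_gibbs prob_space_mala_stream]])
  have noise_meas [measurable]: "(\<lambda>y. noise_sum d j (snd y)) \<in> borel_measurable ?P" for j
    by (rule L2_leD[OF noise_L2])
  have R: "L2_le ?P (\<lambda>(x, w). mala_step d (mala_chain d j x (stl w)) (shd w)
      - mala_proposal d (mala_chain d j x (stl w)) (fst (shd w))) r" for j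
    using L2_le_preserves[OF rej mala_chain_last_step_preserves[OF d, of j]] by (simp add: case_prod_beta')
  \<comment> \<open>A move contributes the drift at the current state and the rejection defect; its
    Gaussian part cancels against \<open>noise_sum\<close>.\<close>
  have Suc_eq: "mala_chain d (Suc j) x w - x - noise_sum d (Suc j) w
      = (mala_chain d j x (stl w) - x - noise_sum d j (stl w)) + (- d) *\<^sub>R g (mala_chain d j x (stl w))
        + (mala_step d (mala_chain d j x (stl w)) (shd w)
      - mala_proposal d (mala_chain d j x (stl w)) (fst (shd w)))" for j x w
    by (simp add: mala_proposal_def)
  show disp: "L2_le ?P (\<lambda>(x, w). mala_chain d j x w - x - noise_sum d j w) (j * (d * sqrt (M * CARD('n)) + r))" for j
  proof (induction j)
    case 0
    show ?case by (simp add: L2_le_def zero_ennreal_def[symmetric] case_prod_beta')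
  next
    case (Suc j)
    have G: "L2_le ?P (\<lambda>y. (- d) *\<^sub>R g (case (case y of (x, w) \<Rightarrow> (x, stl w)) of (x, w) \<Rightarrow> mala_chain d j x w))
        (\<bar>- d\<bar> * sqrt (M * CARD('n)))"
      by (intro L2_le_scaleR L2_le_preserves[OF gradient_L2] preserves_comp[OF preserves_gibbs_stream_tail chain])
    have "L2_le ?P (\<lambda>y. (case (case y of (x, w) \<Rightarrow> (x, stl w)) of (x, w) \<Rightarrow> mala_chain d j x w - x - noise_sum d j w)
        + (- d) *\<^sub>R g (case (case y of (x, w) \<Rightarrow> (x, stl w)) of (x, w) \<Rightarrow> mala_chain d j x w)
        + (case y of (x, w) \<Rightarrow> mala_step d (mala_chain d j x (stl w)) (shd w)
            - mala_proposal d (mala_chain d j x (stl w)) (fst (shd w))))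
        (j * (d * sqrt (M * CARD('n)) + r) + \<bar>- d\<bar> * sqrt (M * CARD('n)) + r)"
      by (rule L2_le_add[OF L2_le_add[OF L2_le_preserves[OF Suc.IH preserves_gibbs_stream_tail] G] R])
    then have "L2_le ?P (\<lambda>(x, w). mala_chain d (Suc j) x w - x - noise_sum d (Suc j) w)
        (j * (d * sqrt (M * CARD('n)) + r) + \<bar>- d\<bar> * sqrt (M * CARD('n)) + r)"
      unfolding Suc_eq by (simp only: case_prod_beta' fst_conv snd_conv)
    moreover have "j * (d * sqrt (M * CARD('n)) + r) + \<bar>- d\<bar> * sqrt (M * CARD('n)) + r
        = Suc j * (d * sqrt (M * CARD('n)) + r)" using d by (simp add: algebra_simps)
    ultimately show ?case by simp
  qed
  \<comment> \<open>L2 distance travelled from the start, uniform over the first \<open>k\<close>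
    times; times \<open>M\<close> it bounds the change of the gradient along the path.\<close>
  define B where "B = sqrt (2 * d * k * CARD('n)) + k * (d * sqrt (M * CARD('n)) + r)"
  have travel: "L2_le ?P (\<lambda>(x, w). mala_chain d j x w - x) B" if "j \<le> k" for j
  proof -
    have "L2_le ?P (\<lambda>y. (case y of (x, w) \<Rightarrow> mala_chain d j x w - x - noise_sum d j w) + noise_sum d j (snd y))
        (j * (d * sqrt (M * CARD('n)) + r) + sqrt (2 * d * j * CARD('n)))"
      by (rule L2_le_add[OF disp noise_L2])
    then show ?thesis
    proof (rule L2_le_mono)
      have "j * (d * sqrt (M * CARD('n)) + r) \<le> k * (d * sqrt (M * CARD('n)) + r)"
        using that d r M_pos by (intro mult_right_mono) auto
      moreover have "sqrt (2 * d * j * CARD('n)) \<le> sqrt (2 * d * k * CARD('n))"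
        using that d by simp
      ultimately show "j * (d * sqrt (M * CARD('n)) + r) + sqrt (2 * d * j * CARD('n)) \<le> B"
        unfolding B_def by linarith
    qed (auto simp: case_prod_beta')
  qed
  show "L2_le ?P (\<lambda>(x, w). mala_chain d j x w - x - noise_sum d j w + (j * d) *\<^sub>R g x)
      (j * (r + d * (M * (sqrt (2 * d * k * CARD('n)) + k * (d * sqrt (M * CARD('n)) + r)))))" if "j \<le> k" for j
    using that
  proof (induction j)
    case 0
    show ?case by (simp add: L2_le_def zero_ennreal_def[symmetric] case_prod_beta')
  next
    case (Suc j)
    then have jk: "j \<le> k" by simp
    have D: "L2_le ?P (\<lambda>y. d *\<^sub>R (case y of (x, w) \<Rightarrow> g x - g (mala_chain d j x w))) (\<bar>d\<bar> * (M * B))"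
    proof (rule L2_le_scaleR, rule L2_le_mono)
      show "L2_le ?P (\<lambda>y. M *\<^sub>R (case y of (x, w) \<Rightarrow> mala_chain d j x w - x)) (\<bar>M\<bar> * B)"
        by (rule L2_le_scaleR[OF travel[OF jk]])
    qed (use M_pos g_lipschitz in \<open>auto simp: case_prod_beta' norm_minus_commute[of "g (fst _)"]\<close>)
    have "L2_le ?P (\<lambda>y. (case (case y of (x, w) \<Rightarrow> (x, stl w)) of (x, w) \<Rightarrow> mala_chain d j x w - x - noise_sum d j w + (j * d) *\<^sub>R g x)
        + d *\<^sub>R (case (case y of (x, w) \<Rightarrow> (x, stl w)) of (x, w) \<Rightarrow> g x - g (mala_chain d j x w))
        + (case y of (x, w) \<Rightarrow> mala_step d (mala_chain d j x (stl w)) (shd w)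
            - mala_proposal d (mala_chain d j x (stl w)) (fst (shd w))))
        (j * (r + d * (M * B)) + \<bar>d\<bar> * (M * B) + r)"
      by (rule L2_le_add[OF L2_le_add[OF L2_le_preserves[OF Suc.IH[OF jk, folded B_def] preserves_gibbs_stream_tail]
              L2_le_preserves[OF D preserves_gibbs_stream_tail]] R])
    moreover have "(case (case y of (x, w) \<Rightarrow> (x, stl w)) of (x, w) \<Rightarrow> mala_chain d j x w - x - noise_sum d j w + (j * d) *\<^sub>R g x)
        + d *\<^sub>R (case (case y of (x, w) \<Rightarrow> (x, stl w)) of (x, w) \<Rightarrow> g x - g (mala_chain d j x w))
        + (case y of (x, w) \<Rightarrow> mala_step d (mala_chain d j x (stl w)) (shd w)
            - mala_proposal d (mala_chain d j x (stl w)) (fst (shd w)))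
        = (case y of (x, w) \<Rightarrow> mala_chain d (Suc j) x w - x - noise_sum d (Suc j) w + (Suc j * d) *\<^sub>R g x)" for y
      by (cases y) (simp only: Suc_eq case_prod_conv, simp add: algebra_simps)
    moreover have "j * (r + d * (M * B)) + \<bar>d\<bar> * (M * B) + r = Suc j * (r + d * (M * B))"
      using d by (simp add: algebra_simps)
    ultimately show ?case by (simp only: B_def)
  qed
qed

text \<open>The chain replaces the Langevin diffusion at time \<open>h\<close>, and \<open>noise_sum\<close> the increment of its
  driving Brownian motion.\<close>

lemma stationary_path_coupling:
  fixes h e :: real
  assumes h: "0 < h" and e: "0 < e"
  obtains k :: nat where "0 < k"
    "L2_le (gibbs f \<Otimes>\<^sub>M mala_stream)
      (\<lambda>(x, w). mala_chain (h / k) k x w - x - noise_sum (h / k) k w + h *\<^sub>R g x)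
      (h * M * (sqrt (2 * h * CARD('n)) + h * sqrt (M * CARD('n))) + e)"
proof -
  \<comment> \<open>Rejections enter once directly and once more, multiplied by
    \<open>h * M\<close>, through the distance travelled.\<close>
  define e' where "e' = e / (1 + h * M)"
  have hM: "0 < 1 + h * M" using h M_pos by (simp add: add_pos_nonneg)
  have e': "0 < e'" using e hM by (simp add: e'_def)
  obtain k :: nat where k: "0 < k"
    and rej: "L2_le (gibbs f \<Otimes>\<^sub>M mala_noise) (\<lambda>(x, n). mala_step (h / k) x n - mala_proposal (h / k) x (fst n)) (e' / k)"
    using mala_rejection_small[OF h e'] by blast
  have d: "0 < h / k" using h k by simp
  have "L2_le (gibbs f \<Otimes>\<^sub>M mala_stream)
      (\<lambda>(x, w). mala_chain (h / k) k x w - x - noise_sum (h / k) k w + (k * (h / k)) *\<^sub>R g x)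
      (k * (e' / k + h / k * (M * (sqrt (2 * (h / k) * k * CARD('n)) + k * (h / k * sqrt (M * CARD('n)) + e' / k)))))"
    using e' by (intro mala_chain_error[OF d _ rej order_refl]) simp
  moreover have "k * (e' / k + h / k * (M * (sqrt (2 * (h / k) * k * CARD('n)) + k * (h / k * sqrt (M * CARD('n)) + e' / k))))
      = h * M * (sqrt (2 * h * CARD('n)) + h * sqrt (M * CARD('n))) + (1 + h * M) * e'"
    using k by (simp add: field_simps)
  moreover have "(1 + h * M) * e' = e" using hM by (simp add: e'_def)
  moreover have "k * (h / k) = h" using k by simp
  ultimately show ?thesis using that[OF k] by simp
qed

end

section \<open>The randomized midpoint step\<close>

lemma sets_rlmc_noise [simp]: "sets (rlmc_noise :: (real \<times> (real^'n) \<times> (real^'n)) measure) = sets borel"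
  and space_rlmc_noise [simp]: "space (rlmc_noise :: (real \<times> (real^'n) \<times> (real^'n)) measure) = UNIV"
  by (simp_all add: rlmc_noise_def)

lemma sets_rlmc_noise_prod [measurable_cong]:
  "sets (rlmc_noise :: (real \<times> (real^'n) \<times> (real^'n)) measure) = sets (borel \<Otimes>\<^sub>M borel \<Otimes>\<^sub>M borel)"
  unfolding sets_rlmc_noise borel_prod ..

lemma rlmc_noise_construction:
  "preserves (unit_uniform \<Otimes>\<^sub>M std_gaussian \<Otimes>\<^sub>M std_gaussian)
    (rlmc_noise :: (real \<times> (real^'n) \<times> (real^'n)) measure)
    (\<lambda>(a, z, v). (a, sqrt a *\<^sub>R z + sqrt (1 - a) *\<^sub>R v, z))"
proof -
  have "(\<lambda>(a, z, v). (a, sqrt a *\<^sub>R z + sqrt (1 - a) *\<^sub>R v, z))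
      \<in> unit_uniform \<Otimes>\<^sub>M std_gaussian \<Otimes>\<^sub>M std_gaussian \<rightarrow>\<^sub>M (rlmc_noise :: (real \<times> (real^'n) \<times> (real^'n)) measure)"
    by measurable
  then show ?thesis
    by (simp add: preserves_def rlmc_noise_def cong: distr_cong)
qed

lemma prob_space_unit_uniform_gaussians:
  "prob_space (unit_uniform \<Otimes>\<^sub>M std_gaussian \<Otimes>\<^sub>M (std_gaussian :: ('a::euclidean_space) measure))"
  "prob_space (unit_uniform \<Otimes>\<^sub>M (std_gaussian :: 'a measure))"
  by (intro prob_space_pair prob_space_unit_uniform prob_space_std_gaussian)+

lemma prob_space_rlmc_noise: "prob_space (rlmc_noise :: (real \<times> (real^'n) \<times> (real^'n)) measure)"
  by (rule preserves_prob_space[OF rlmc_noise_construction])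
    (intro prob_space_pair prob_space_unit_uniform prob_space_std_gaussian)

lemma AE_unit_uniform: "AE a in unit_uniform. 0 \<le> a \<and> a \<le> 1"
  by (rule AE_uniform_measureI) auto

text \<open>Reflecting the pair of Gaussians exchanges the roles of the two noises: the second one can
  be drawn given the first.\<close>

lemma rlmc_noise_reversed_construction:
  "preserves (std_gaussian \<Otimes>\<^sub>M unit_uniform \<Otimes>\<^sub>M std_gaussian)
    (rlmc_noise :: (real \<times> (real^'n) \<times> (real^'n)) measure)
    (\<lambda>(p, a, q). (a, p, sqrt a *\<^sub>R p + sqrt (1 - a) *\<^sub>R q))"
proof (rule preservesI)
  let ?G = "std_gaussian :: (real^'n) measure"
  interpret G: prob_space ?G by (rule prob_space_std_gaussian)
  interpret U: prob_space unit_uniform by (rule prob_space_unit_uniform)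
  interpret UG: prob_space "unit_uniform \<Otimes>\<^sub>M ?G" by (rule prob_space_unit_uniform_gaussians)
  interpret GG: prob_space "?G \<Otimes>\<^sub>M ?G" by (intro prob_space_pair prob_space_std_gaussian)
  interpret GU: pair_sigma_finite ?G unit_uniform ..
  show "(\<lambda>(p, a, q). (a, p, sqrt a *\<^sub>R p + sqrt (1 - a) *\<^sub>R q)) \<in> ?G \<Otimes>\<^sub>M unit_uniform \<Otimes>\<^sub>M ?G \<rightarrow>\<^sub>M rlmc_noise"
    by measurable
  fix F :: "real \<times> (real^'n) \<times> (real^'n) \<Rightarrow> ennreal" assume "F \<in> borel_measurable rlmc_noise"
  then have [measurable]: "F \<in> borel_measurable (borel \<Otimes>\<^sub>M borel \<Otimes>\<^sub>M borel)"
    using measurable_cong_sets[OF sets_rlmc_noise_prod refl] by blast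
  have "(\<integral>\<^sup>+y. F (case y of (p, a, q) \<Rightarrow> (a, p, sqrt a *\<^sub>R p + sqrt (1 - a) *\<^sub>R q)) \<partial>(?G \<Otimes>\<^sub>M unit_uniform \<Otimes>\<^sub>M ?G))
      = (\<integral>\<^sup>+p. \<integral>\<^sup>+a. \<integral>\<^sup>+q. F (a, p, sqrt a *\<^sub>R p + sqrt (1 - a) *\<^sub>R q) \<partial>?G \<partial>unit_uniform \<partial>?G)"
    by (subst UG.nn_integral_fst[symmetric], measurable, intro nn_integral_cong, subst G.nn_integral_fst[symmetric], auto)
  also have "\<dots> = (\<integral>\<^sup>+a. \<integral>\<^sup>+p. \<integral>\<^sup>+q. F (a, p, sqrt a *\<^sub>R p + sqrt (1 - a) *\<^sub>R q) \<partial>?G \<partial>?G \<partial>unit_uniform)"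
    by (rule GU.Fubini'[symmetric]) measurable
  also have "\<dots> = (\<integral>\<^sup>+a. \<integral>\<^sup>+z. \<integral>\<^sup>+v. F (a, sqrt a *\<^sub>R z + sqrt (1 - a) *\<^sub>R v, z) \<partial>?G \<partial>?G \<partial>unit_uniform)"
  proof (rule nn_integral_cong_AE, rule AE_mp[OF AE_unit_uniform], intro AE_I2 impI)
    fix a :: real assume a: "0 \<le> a \<and> a \<le> 1"
    let ?c = "sqrt a" and ?s = "sqrt (1 - a)"
    have cs: "?c\<^sup>2 + ?s\<^sup>2 = 1" "0 \<le> ?s" using a by auto
    \<comment> \<open>The reflection is an involution: from \<open>p = c z + s v\<close> and
      \<open>q = s z - c v\<close> the vector \<open>z\<close> is recovered as
      \<open>c p + s q\<close>.\<close>
    have inv: "?c *\<^sub>R (?c *\<^sub>R z + ?s *\<^sub>R v) + ?s *\<^sub>R (?s *\<^sub>R z - ?c *\<^sub>R v) = z" for z v :: "real^'n"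
    proof -
      have "?c *\<^sub>R (?c *\<^sub>R z + ?s *\<^sub>R v) + ?s *\<^sub>R (?s *\<^sub>R z - ?c *\<^sub>R v) = (?c\<^sup>2 + ?s\<^sup>2) *\<^sub>R z"
        unfolding power2_eq_square by (simp add: scaleR_add_right scaleR_diff_right scaleR_add_left mult.commute)
      then show ?thesis by (simp only: cs scaleR_one)
    qed
    have "(\<integral>\<^sup>+p. \<integral>\<^sup>+q. F (a, p, ?c *\<^sub>R p + ?s *\<^sub>R q) \<partial>?G \<partial>?G)
        = (\<integral>\<^sup>+y. F (a, fst y, ?c *\<^sub>R fst y + ?s *\<^sub>R snd y) \<partial>(?G \<Otimes>\<^sub>M ?G))"
      by (subst G.nn_integral_fst[symmetric]) auto
    also have "\<dots> = (\<integral>\<^sup>+y. F (a, fst (case y of (z, v) \<Rightarrow> (?c *\<^sub>R z + ?s *\<^sub>R v, ?s *\<^sub>R z - ?c *\<^sub>R v)),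
        ?c *\<^sub>R fst (case y of (z, v) \<Rightarrow> (?c *\<^sub>R z + ?s *\<^sub>R v, ?s *\<^sub>R z - ?c *\<^sub>R v))
        + ?s *\<^sub>R snd (case y of (z, v) \<Rightarrow> (?c *\<^sub>R z + ?s *\<^sub>R v, ?s *\<^sub>R z - ?c *\<^sub>R v))) \<partial>(?G \<Otimes>\<^sub>M ?G))"
      by (rule preserves_nn_integral[OF std_gaussian_rotation[OF cs(2,1)], symmetric]) measurable
    also have "\<dots> = (\<integral>\<^sup>+y. F (a, ?c *\<^sub>R fst y + ?s *\<^sub>R snd y, fst y) \<partial>(?G \<Otimes>\<^sub>M ?G))"
      by (simp only: case_prod_beta' fst_conv snd_conv inv)
    also have "\<dots> = (\<integral>\<^sup>+z. \<integral>\<^sup>+v. F (a, ?c *\<^sub>R z + ?s *\<^sub>R v, z) \<partial>?G \<partial>?G)"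
      by (subst G.nn_integral_fst[symmetric]) auto
    finally show "(\<integral>\<^sup>+p. \<integral>\<^sup>+q. F (a, p, ?c *\<^sub>R p + ?s *\<^sub>R q) \<partial>?G \<partial>?G)
        = (\<integral>\<^sup>+z. \<integral>\<^sup>+v. F (a, ?c *\<^sub>R z + ?s *\<^sub>R v, z) \<partial>?G \<partial>?G)" .
  qed
  also have "\<dots> = (\<integral>\<^sup>+y. F (case y of (a, z, v) \<Rightarrow> (a, sqrt a *\<^sub>R z + sqrt (1 - a) *\<^sub>R v, z)) \<partial>(unit_uniform \<Otimes>\<^sub>M ?G \<Otimes>\<^sub>M ?G))"
    by (subst GG.nn_integral_fst[symmetric], measurable, intro nn_integral_cong, subst G.nn_integral_fst[symmetric], auto)
  also have "\<dots> = (\<integral>\<^sup>+y. F y \<partial>rlmc_noise)"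
    by (rule preserves_nn_integral[OF rlmc_noise_construction]) measurable
  finally show "(\<integral>\<^sup>+y. F (case y of (p, a, q) \<Rightarrow> (a, p, sqrt a *\<^sub>R p + sqrt (1 - a) *\<^sub>R q)) \<partial>(?G \<Otimes>\<^sub>M unit_uniform \<Otimes>\<^sub>M ?G))
      = (\<integral>\<^sup>+y. F y \<partial>rlmc_noise)" .
qed

lemma rlmc_noise_fst: "preserves (rlmc_noise :: (real \<times> (real^'n) \<times> (real^'n)) measure) unit_uniform fst"
proof (rule preservesI)
  let ?T = "\<lambda>(a, z :: real^'n, v). (a, sqrt a *\<^sub>R z + sqrt (1 - a) *\<^sub>R v, z)"
  let ?UGG = "unit_uniform \<Otimes>\<^sub>M (std_gaussian :: (real^'n) measure) \<Otimes>\<^sub>M (std_gaussian :: (real^'n) measure)"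
  have GG: "prob_space ((std_gaussian :: (real^'n) measure) \<Otimes>\<^sub>M (std_gaussian :: (real^'n) measure))"
    by (intro prob_space_pair prob_space_std_gaussian)
  fix F :: "real \<Rightarrow> ennreal" assume F [measurable]: "F \<in> borel_measurable unit_uniform"
  have "(\<integral>\<^sup>+n. F (fst n) \<partial>(rlmc_noise :: (real \<times> (real^'n) \<times> (real^'n)) measure)) = (\<integral>\<^sup>+y. F (fst (?T y)) \<partial>?UGG)"
    by (rule preserves_nn_integral[OF rlmc_noise_construction, symmetric]) measurable
  also have "\<dots> = (\<integral>\<^sup>+y. F (fst y) \<partial>?UGG)" by (simp only: case_prod_beta' fst_conv)
  also have "\<dots> = (\<integral>\<^sup>+a. F a \<partial>unit_uniform)"
    by (rule preserves_nn_integral[OF preserves_fst[OF GG] F])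
  finally show "(\<integral>\<^sup>+n. F (fst n) \<partial>(rlmc_noise :: (real \<times> (real^'n) \<times> (real^'n)) measure)) = (\<integral>\<^sup>+a. F a \<partial>unit_uniform)" .
qed measurable

lemma AE_rlmc_noise_fst: "AE n in (rlmc_noise :: (real \<times> (real^'n) \<times> (real^'n)) measure). 0 \<le> fst n \<and> fst n \<le> 1"
proof -
  have "AE a in distr (rlmc_noise :: (real \<times> (real^'n) \<times> (real^'n)) measure) unit_uniform fst. 0 \<le> a \<and> a \<le> 1"
    using rlmc_noise_fst[where 'n='n] AE_unit_uniform by (simp only: preserves_def)
  then show ?thesis by (subst (asm) AE_distr_iff) auto
qed

text \<open>In each construction one of the Gaussians is an untransformed factor: \<open>U'\<close>
  in the defining one, \<open>U\<close> in the reversed one.\<close>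

lemma rlmc_noise_L2:
  "L2_le (rlmc_noise :: (real \<times> (real^'n) \<times> (real^'n)) measure) (\<lambda>n. snd (snd n)) (sqrt CARD('n))"
  "L2_le (rlmc_noise :: (real \<times> (real^'n) \<times> (real^'n)) measure) (\<lambda>n. fst (snd n)) (sqrt CARD('n))"
proof -
  let ?N = "rlmc_noise :: (real \<times> (real^'n) \<times> (real^'n)) measure"
  let ?G = "std_gaussian :: (real^'n) measure"
  let ?U = "unit_uniform"
  have T: "L2_le M (\<lambda>n. X (S n)) c \<Longrightarrow> preserves M ?N S \<Longrightarrow> X \<in> borel_measurable ?N \<Longrightarrow> L2_le ?N X c"
    for M :: "'z measure" and X :: "_ \<Rightarrow> real^'n" and S c
    by (simp add: L2_le_def preserves_nn_integral[of M ?N S "\<lambda>n. ennreal ((norm (X n))\<^sup>2)", symmetric])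
  have G: "L2_le ?G (\<lambda>x. x) (sqrt CARD('n))" using std_gaussian_L2[where 'a="real^'n"] by simp
  have "L2_le (?U \<Otimes>\<^sub>M ?G \<Otimes>\<^sub>M ?G) (\<lambda>n. fst (snd n)) (sqrt CARD('n))"
    by (intro L2_le_preserves[OF G] preserves_comp[OF preserves_snd preserves_fst]
        prob_space_pair prob_space_unit_uniform prob_space_std_gaussian)
  then show "L2_le ?N (\<lambda>n. snd (snd n)) (sqrt CARD('n))"
    by (intro T[OF _ rlmc_noise_construction]) (simp_all add: case_prod_beta')
  have "L2_le (?G \<Otimes>\<^sub>M ?U \<Otimes>\<^sub>M ?G) (\<lambda>n. fst n) (sqrt CARD('n))"
    by (intro L2_le_preserves[OF G] preserves_fst prob_space_pair prob_space_unit_uniform prob_space_std_gaussian)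
  then show "L2_le ?N (\<lambda>n. fst (snd n)) (sqrt CARD('n))"
    by (intro T[OF _ rlmc_noise_reversed_construction]) (simp_all add: case_prod_beta')
qed

text \<open>Origin of \<open>sqrt 3\<close>: a uniform variable has L2 norm
  \<open>1 / sqrt 3\<close>, and this is Minkowski's inequality for \<open>p + a q\<close>. The
  integral is \<open>p^2 + p q + q^2 / 3\<close>, and \<open>1 <= 2 / sqrt 3\<close> takes care of
  the mixed term.\<close>

lemma nn_integral_unit_uniform_affine_square:
  assumes "0 \<le> p" "0 \<le> q"
  shows "(\<integral>\<^sup>+a. ennreal ((p + a * q)\<^sup>2) \<partial>unit_uniform) \<le> ennreal ((p + q / sqrt 3)\<^sup>2)"
proof -
  have "(\<integral>\<^sup>+a. ennreal ((p + a * q)\<^sup>2) \<partial>unit_uniform) = (\<integral>\<^sup>+a. ennreal ((p + a * q)\<^sup>2) * indicator {0..1} a \<partial>lborel)"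
    by (subst nn_integral_uniform_measure) (auto simp: divide_ennreal_def)
  also have "\<dots> = ennreal ((p\<^sup>2 * 1 + p * q * 1\<^sup>2 + q\<^sup>2 * 1 ^ 3 / 3) - (p\<^sup>2 * 0 + p * q * 0\<^sup>2 + q\<^sup>2 * 0 ^ 3 / 3))"
  proof (rule nn_integral_FTC_Icc)
    show "((\<lambda>a. p\<^sup>2 * a + p * q * a\<^sup>2 + q\<^sup>2 * a ^ 3 / 3) has_real_derivative (p + a * q)\<^sup>2) (at a)" for a
      by (auto intro!: derivative_eq_intros simp: power2_eq_square algebra_simps)
  qed simp_all
  also have "\<dots> \<le> ennreal ((p + q / sqrt 3)\<^sup>2)"
  proof (rule ennreal_leI)
    have "sqrt 3 \<le> 2" by (rule real_le_lsqrt) auto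
    then have "p * q \<le> 2 * (p * q) / sqrt 3"
      using mult_left_mono[of "sqrt 3" 2 "p * q"] assms by (simp add: field_simps)
    moreover have "(p + q / sqrt 3)\<^sup>2 = p\<^sup>2 + 2 * (p * q) / sqrt 3 + q\<^sup>2 / 3"
      by (simp add: power2_sum power_divide)
    ultimately show "(p\<^sup>2 * 1 + p * q * 1\<^sup>2 + q\<^sup>2 * 1 ^ 3 / 3) - (p\<^sup>2 * 0 + p * q * 0\<^sup>2 + q\<^sup>2 * 0 ^ 3 / 3)
        \<le> (p + q / sqrt 3)\<^sup>2" by simp
  qed
  finally show ?thesis .
qed

lemma gradient_eqI:
  assumes D: "GDERIV f x :> D"
  shows "gradient f x = D"
  unfolding gradient_def
proof (rule the_equality, rule D)
  fix D' assume "GDERIV f x :> D'"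
  then have "(\<lambda>v. v \<bullet> D') = (\<lambda>v. v \<bullet> D)"
    using D has_derivative_unique unfolding gderiv_def by blast
  then have "v \<bullet> (D' - D) = 0" for v by (metis inner_diff_right right_minus_eq)
  then show "D' = D" by (metis inner_eq_zero_iff right_minus_eq)
qed

context vec_smooth_convex
begin

section \<open>Contraction of the midpoint kernel\<close>

lemma gradient_eq: "gradient f = g"
proof
  fix x
  have "GDERIV f x :> g x" using f_deriv[of x] by (simp add: gderiv_def inner_commute)
  then show "gradient f x = g x" by (rule gradient_eqI)
qed

lemma measurable_rlmc_step [measurable]:
  "(\<lambda>(x, n). rlmc_step f h x n) \<in> borel \<Otimes>\<^sub>M (borel \<Otimes>\<^sub>M borel \<Otimes>\<^sub>M borel) \<rightarrow>\<^sub>M borel"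
  unfolding rlmc_step_def rlmc_midpoint_def gradient_eq by measurable

text \<open>Bounds the L2 norm, over \<alpha>, of the factor
  \<open>1 - m h + \<alpha> M^2 h^2\<close> by which a step with common noise contracts.\<close>

definition rlmc_rate :: "real \<Rightarrow> real" where
  "rlmc_rate h = 1 - m * h + M\<^sup>2 * h\<^sup>2 / sqrt 3"

text \<open>The mean value theorem is applied to \<open>g\<close> tested against the difference of the two updates
  itself, so that a single Hessian (rather than an averaged one) appears.\<close>

lemma rlmc_step_contraction:
  assumes h: "0 \<le> h" "h * (m + M) \<le> 2" and a: "0 \<le> fst n"
  shows "norm (rlmc_step f h x n - rlmc_step f h y n) \<le> (1 - m * h + fst n * (M\<^sup>2 * h\<^sup>2)) * norm (x - y)"
proof -
  obtain a u u' where n: "n = (a, u, u')" by (cases n)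
  have a0: "0 \<le> a" using a n by simp
  define p where "p = rlmc_midpoint f h y a u'"
  \<comment> \<open>Under common noise the Gaussian terms cancel, so this is the difference of the
    two midpoints.\<close>
  define v where "v = x - y - (a * h) *\<^sub>R (g x - g y)"
  have mid: "rlmc_midpoint f h x a u' = p + v"
    by (simp add: p_def v_def rlmc_midpoint_def gradient_eq algebra_simps)
  define D where "D = rlmc_step f h x n - rlmc_step f h y n"
  have D: "D = (x - y) - h *\<^sub>R (g (p + v) - g p)"
    by (simp add: D_def n rlmc_step_def mid p_def[symmetric] gradient_eq algebra_simps)
  obtain t where t: "D \<bullet> (g (p + v) - g p) = D \<bullet> H (p + t *\<^sub>R v) v"
    using g_mean_value[of D p v] by blast
  define A where "A = H (p + t *\<^sub>R v)"
  have Av: "A v = A (x - y) - (a * h) *\<^sub>R A (g x - g y)"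
    by (simp add: A_def v_def linear_diff[OF H_linear] linear_scale[OF H_linear])
  have "D \<bullet> D = D \<bullet> (x - y) - h * (D \<bullet> A v)"
    using t by (subst (2) D) (simp add: A_def inner_diff_right)
  \<comment> \<open>Regrouped into a gradient step with one Hessian, which contracts by
    \<open>1 - m h\<close>, and a term of order \<open>h^2\<close> in which \<open>A\<close> and
    \<open>g\<close> contribute a factor \<open>M\<close> each.\<close>
  also have "\<dots> = D \<bullet> (((x - y) - h *\<^sub>R A (x - y)) + (a * h\<^sup>2) *\<^sub>R A (g x - g y))"
    unfolding Av by (simp add: inner_diff_right inner_add_right power2_eq_square algebra_simps)
  also have "\<dots> \<le> norm D * norm (((x - y) - h *\<^sub>R A (x - y)) + (a * h\<^sup>2) *\<^sub>R A (g x - g y))"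
    by (rule norm_cauchy_schwarz)
  also have "\<dots> \<le> norm D * ((1 - m * h + a * (M\<^sup>2 * h\<^sup>2)) * norm (x - y))"
  proof (rule mult_left_mono)
    have "norm (A (g x - g y)) \<le> M * (M * norm (x - y))"
      unfolding A_def using norm_H_le[of _ "g x - g y"] g_lipschitz[of x y] M_pos
      by (meson less_imp_le mult_left_mono order_trans)
    then have "norm ((a * h\<^sup>2) *\<^sub>R A (g x - g y)) \<le> a * h\<^sup>2 * (M * (M * norm (x - y)))"
      using a0 by (simp add: mult_left_mono)
    moreover have "norm ((x - y) - h *\<^sub>R A (x - y)) \<le> (1 - m * h) * norm (x - y)"
      unfolding A_def by (rule gradient_step_contraction[OF h])
    ultimately show "norm (((x - y) - h *\<^sub>R A (x - y)) + (a * h\<^sup>2) *\<^sub>R A (g x - g y))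
        \<le> (1 - m * h + a * (M\<^sup>2 * h\<^sup>2)) * norm (x - y)"
      by (intro norm_triangle_le) (simp add: power2_eq_square algebra_simps)
  qed simp
  finally have le: "norm D * norm D \<le> norm D * ((1 - m * h + a * (M\<^sup>2 * h\<^sup>2)) * norm (x - y))"
    by (simp add: dot_square_norm power2_eq_square)
  have mh: "m * h \<le> 1"
    using mult_right_mono[OF m_le_M h(1)] h(2) by (simp add: algebra_simps)
  have "0 \<le> (1 - m * h + a * (M\<^sup>2 * h\<^sup>2)) * norm (x - y)"
    using mh a0 by simp
  with le have "norm D \<le> (1 - m * h + a * (M\<^sup>2 * h\<^sup>2)) * norm (x - y)"
    by (cases "norm D = 0") (auto simp: mult_le_cancel_left_pos)
  then show ?thesis by (simp add: D_def n)
qed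

lemma step_size_le: "0 \<le> h \<Longrightarrow> h * (m + M) \<le> 2 \<Longrightarrow> m * h \<le> 1"
  using mult_right_mono[OF m_le_M, of h] by (simp add: algebra_simps)

lemma rlmc_rate_nonneg: "0 \<le> h \<Longrightarrow> h * (m + M) \<le> 2 \<Longrightarrow> 0 \<le> rlmc_rate h"
  using step_size_le[of h] by (simp add: rlmc_rate_def)

text \<open>The pointwise factor involves the noise through \<alpha> alone, so its square can be
  averaged; the worst case \<alpha> = 1 would lose the \<open>sqrt 3\<close>.\<close>

lemma rlmc_step_mean_contraction:
  assumes h: "0 \<le> h" "h * (m + M) \<le> 2"
  shows "(\<integral>\<^sup>+n. ennreal ((norm (rlmc_step f h x n - rlmc_step f h y n))\<^sup>2) \<partial>rlmc_noise)
    \<le> ennreal ((rlmc_rate h)\<^sup>2) * ennreal ((norm (x - y))\<^sup>2)"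
proof -
  let ?N = "rlmc_noise :: (real \<times> (real^'n) \<times> (real^'n)) measure"
  let ?p = "1 - m * h" and ?q = "M\<^sup>2 * h\<^sup>2"
  have pq: "0 \<le> ?p" "0 \<le> ?q" using step_size_le[OF h] by simp_all
  have U: "(\<integral>\<^sup>+n. ennreal ((?p + fst n * ?q)\<^sup>2) \<partial>?N) \<le> ennreal ((rlmc_rate h)\<^sup>2)"
    using preserves_nn_integral[OF rlmc_noise_fst[where 'n='n], of "\<lambda>a. ennreal ((?p + a * ?q)\<^sup>2)"]
      nn_integral_unit_uniform_affine_square[OF pq] by (simp add: rlmc_rate_def)
  have "(\<integral>\<^sup>+n. ennreal ((norm (rlmc_step f h x n - rlmc_step f h y n))\<^sup>2) \<partial>?N)
      \<le> (\<integral>\<^sup>+n. ennreal ((?p + fst n * ?q)\<^sup>2) * ennreal ((norm (x - y))\<^sup>2) \<partial>?N)"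
  proof (rule nn_integral_mono_AE, rule AE_mp[OF AE_rlmc_noise_fst], intro AE_I2 impI)
    fix n :: "real \<times> (real^'n) \<times> (real^'n)" assume "0 \<le> fst n \<and> fst n \<le> 1"
    then have "(norm (rlmc_step f h x n - rlmc_step f h y n))\<^sup>2 \<le> ((?p + fst n * ?q) * norm (x - y))\<^sup>2"
      by (intro power_mono rlmc_step_contraction[OF h]) auto
    then show "ennreal ((norm (rlmc_step f h x n - rlmc_step f h y n))\<^sup>2)
        \<le> ennreal ((?p + fst n * ?q)\<^sup>2) * ennreal ((norm (x - y))\<^sup>2)"
      by (simp add: ennreal_mult[symmetric] power_mult_distrib ennreal_leI)
  qed
  also have "\<dots> = (\<integral>\<^sup>+n. ennreal ((?p + fst n * ?q)\<^sup>2) \<partial>?N) * ennreal ((norm (x - y))\<^sup>2)"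
    by (rule nn_integral_multc) measurable
  also have "\<dots> \<le> ennreal ((rlmc_rate h)\<^sup>2) * ennreal ((norm (x - y))\<^sup>2)"
    by (intro mult_right_mono U) simp
  finally show ?thesis .
qed

lemma rlmc_step_L2_contraction:
  assumes h: "0 \<le> h" "h * (m + M) \<le> 2"
    and \<rho>: "sets \<rho> = sets (borel \<Otimes>\<^sub>M borel)"
    and L: "L2_le \<rho> (\<lambda>z. fst z - snd z) t"
  shows "L2_le (\<rho> \<Otimes>\<^sub>M rlmc_noise) (\<lambda>(z, n). rlmc_step f h (fst z) n - rlmc_step f h (snd z) n) (rlmc_rate h * t)"
proof -
  let ?N = "rlmc_noise :: (real \<times> (real^'n) \<times> (real^'n)) measure"
  interpret N: prob_space ?N by (rule prob_space_rlmc_noise)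
  note [measurable_cong] = \<rho>
  have "(\<integral>\<^sup>+y. ennreal ((norm (case y of (z, n) \<Rightarrow> rlmc_step f h (fst z) n - rlmc_step f h (snd z) n))\<^sup>2) \<partial>(\<rho> \<Otimes>\<^sub>M ?N))
      = (\<integral>\<^sup>+z. \<integral>\<^sup>+n. ennreal ((norm (rlmc_step f h (fst z) n - rlmc_step f h (snd z) n))\<^sup>2) \<partial>?N \<partial>\<rho>)"
    by (subst N.nn_integral_fst[symmetric]) auto
  also have "\<dots> \<le> (\<integral>\<^sup>+z. ennreal ((rlmc_rate h)\<^sup>2) * ennreal ((norm (fst z - snd z))\<^sup>2) \<partial>\<rho>)"
    by (intro nn_integral_mono rlmc_step_mean_contraction[OF h])
  also have "\<dots> = ennreal ((rlmc_rate h)\<^sup>2) * (\<integral>\<^sup>+z. ennreal ((norm (fst z - snd z))\<^sup>2) \<partial>\<rho>)"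
    by (rule nn_integral_cmult) measurable
  also have "\<dots> \<le> ennreal ((rlmc_rate h)\<^sup>2) * ennreal (t\<^sup>2)"
    by (intro mult_left_mono L2_leD(3)[OF L]) simp
  also have "\<dots> = ennreal ((rlmc_rate h * t)\<^sup>2)" by (simp add: ennreal_mult[symmetric] power_mult_distrib)
  finally show ?thesis using rlmc_rate_nonneg[OF h] L2_leD(2)[OF L] by (simp add: L2_le_def)
qed

text \<open>Replacing \<alpha> by 1 in both terms gives the displacement bound of a full step, the
  same as for the chain on \<open>[0, h]\<close>.\<close>

lemma rlmc_midpoint_displacement:
  assumes h: "0 \<le> h" and "sets \<mu> = sets borel" "prob_space \<mu>" and G: "L2_le \<mu> g c"
  shows "L2_le (\<mu> \<Otimes>\<^sub>M rlmc_noise) (\<lambda>(x, n). rlmc_midpoint f h x (fst n) (snd (snd n)) - x)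
    (h * c + sqrt (2 * h * CARD('n)))"
proof -
  let ?N = "rlmc_noise :: (real \<times> (real^'n) \<times> (real^'n)) measure"
  note [measurable_cong] = assms(2)
  have c: "0 \<le> c" by (rule L2_leD[OF G])
  have 1: "L2_le (\<mu> \<Otimes>\<^sub>M ?N) (\<lambda>y. h *\<^sub>R g (fst y)) (\<bar>h\<bar> * c)"
    by (intro L2_le_scaleR L2_le_preserves[OF G] preserves_fst prob_space_rlmc_noise)
  have 2: "L2_le (\<mu> \<Otimes>\<^sub>M ?N) (\<lambda>y. sqrt (2 * h) *\<^sub>R snd (snd (snd y))) (\<bar>sqrt (2 * h)\<bar> * sqrt CARD('n))"
    by (intro L2_le_scaleR L2_le_preserves[OF rlmc_noise_L2(1)] preserves_snd prob_space_rlmc_noise assms)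
  have AE: "AE y in \<mu> \<Otimes>\<^sub>M ?N. 0 \<le> fst (snd y) \<and> fst (snd y) \<le> 1"
  proof -
    have "AE n in distr (\<mu> \<Otimes>\<^sub>M ?N) ?N snd. 0 \<le> fst n \<and> fst n \<le> 1"
      using preserves_snd[OF assms(3) prob_space_rlmc_noise[where 'n='n]] AE_rlmc_noise_fst[where 'n='n]
      by (simp only: preserves_def)
    then show ?thesis by (rule AE_distrD[rotated]) simp
  qed
  have 1: "L2_le (\<mu> \<Otimes>\<^sub>M ?N) (\<lambda>y. (- fst (snd y) * h) *\<^sub>R g (fst y)) (\<bar>h\<bar> * c)"
  proof (rule L2_le_mono[OF 1 _ _ order_refl])
    show "AE y in \<mu> \<Otimes>\<^sub>M ?N. norm ((- fst (snd y) * h) *\<^sub>R g (fst y)) \<le> norm (h *\<^sub>R g (fst y))"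
      using AE by eventually_elim (use h in \<open>auto simp: abs_mult mult.assoc intro!: mult_left_le_one_le\<close>)
  qed measurable
  have 2: "L2_le (\<mu> \<Otimes>\<^sub>M ?N) (\<lambda>y. sqrt (2 * fst (snd y) * h) *\<^sub>R snd (snd (snd y))) (\<bar>sqrt (2 * h)\<bar> * sqrt CARD('n))"
  proof (rule L2_le_mono[OF 2 _ _ order_refl])
    show "AE y in \<mu> \<Otimes>\<^sub>M ?N. norm (sqrt (2 * fst (snd y) * h) *\<^sub>R snd (snd (snd y))) \<le> norm (sqrt (2 * h) *\<^sub>R snd (snd (snd y)))"
      using AE by eventually_elim (use h in \<open>auto intro!: mult_right_mono simp: mult_left_le_one_le\<close>)
  qed measurable
  have eq: "(\<lambda>(x, n). rlmc_midpoint f h x (fst n) (snd (snd n)) - x)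
      = (\<lambda>y. (- fst (snd y) * h) *\<^sub>R g (fst y) + sqrt (2 * fst (snd y) * h) *\<^sub>R snd (snd (snd y)))"
    by (simp add: fun_eq_iff rlmc_midpoint_def gradient_eq)
  have "\<bar>h\<bar> * c + \<bar>sqrt (2 * h)\<bar> * sqrt CARD('n) = h * c + sqrt (2 * h * CARD('n))"
    using h by (simp add: real_sqrt_mult)
  with L2_le_add[OF 1 2] show ?thesis unfolding eq by (simp only:)
qed

end

section \<open>Coupling the stationary measures\<close>

text \<open>The integral of \<open>V\<close> might be infinite a priori; comparing truncations at level \<open>R\<close> before
  letting \<open>R\<close> tend to infinity avoids subtracting infinite integrals.\<close>

lemma stationary_moment_of_drift:
  fixes V :: "'a \<Rightarrow> real"
  assumes "prob_space \<mu>" "prob_space N" and T: "preserves (\<mu> \<Otimes>\<^sub>M N) \<mu> T"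
    and V [measurable]: "V \<in> borel_measurable \<mu>" and V0: "\<And>y. 0 \<le> V y"
    and drift: "\<And>y. (\<integral>\<^sup>+n. ennreal (V (T (y, n))) \<partial>N) \<le> ennreal (l * V y + C)"
    and l: "0 \<le> l" "l < 1" and C: "0 \<le> C"
  shows "(\<integral>\<^sup>+y. ennreal (V y) \<partial>\<mu>) \<le> ennreal (C / (1 - l))"
proof -
  interpret mu: prob_space \<mu> by fact
  interpret N: prob_space N by fact
  note [measurable] = preservesD[OF T]
  \<comment> \<open>Nonnegative, of integral at most \<open>C\<close> by stationarity and the drift
    bound, and eventually equal to \<open>(1 - l) * V y\<close> as \<open>R\<close> grows; Fatou's
    lemma then concludes.\<close>
  define J where "J = (\<lambda>R y. C + min (V y) (real R) - min (l * V y + C) (real R))"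
  have lV0: "0 \<le> l * V y" for y using l V0 by simp
  have J0: "0 \<le> J R y" for R y
  proof -
    have "l * V y \<le> V y" using l V0[of y] by (simp add: mult_left_le_one_le)
    then show ?thesis unfolding J_def min_def using C by auto
  qed
  have trunc: "(\<integral>\<^sup>+y. ennreal (min (V y) R) \<partial>\<mu>) \<le> (\<integral>\<^sup>+y. ennreal (min (l * V y + C) R) \<partial>\<mu>)" for R :: nat
  proof -
    have "(\<integral>\<^sup>+y. ennreal (min (V y) R) \<partial>\<mu>) = (\<integral>\<^sup>+y. ennreal (min (V (T y)) R) \<partial>(\<mu> \<Otimes>\<^sub>M N))"
      by (rule preserves_nn_integral[OF T, symmetric]) measurable
    also have "\<dots> = (\<integral>\<^sup>+y. \<integral>\<^sup>+n. ennreal (min (V (T (y, n))) R) \<partial>N \<partial>\<mu>)"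
      by (rule N.nn_integral_fst[symmetric]) measurable
    also have "\<dots> \<le> (\<integral>\<^sup>+y. ennreal (min (l * V y + C) R) \<partial>\<mu>)"
    proof (rule nn_integral_mono)
      fix y
      have "(\<integral>\<^sup>+n. ennreal (min (V (T (y, n))) R) \<partial>N) \<le> (\<integral>\<^sup>+n. ennreal (V (T (y, n))) \<partial>N)"
        by (intro nn_integral_mono ennreal_leI) simp
      moreover have "(\<integral>\<^sup>+n. ennreal (min (V (T (y, n))) R) \<partial>N) \<le> (\<integral>\<^sup>+n. ennreal R \<partial>N)"
        by (intro nn_integral_mono ennreal_leI) simp
      ultimately show "(\<integral>\<^sup>+n. ennreal (min (V (T (y, n))) R) \<partial>N) \<le> ennreal (min (l * V y + C) R)"
        using drift[of y] by (auto simp: min_def N.emeasure_space_1 intro: order_trans)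
    qed
    finally show ?thesis .
  qed
  have J_le: "(\<integral>\<^sup>+y. ennreal (J R y) \<partial>\<mu>) \<le> ennreal C" for R
  proof -
    let ?m = "\<integral>\<^sup>+y. ennreal (min (l * V y + C) (real R)) \<partial>\<mu>"
    have "?m \<le> (\<integral>\<^sup>+y. ennreal R \<partial>\<mu>)" by (intro nn_integral_mono ennreal_leI) simp
    then have fin: "?m < \<infinity>" by (auto simp: mu.emeasure_space_1 intro: le_less_trans)
    have "?m + (\<integral>\<^sup>+y. ennreal (J R y) \<partial>\<mu>) = (\<integral>\<^sup>+y. ennreal (min (l * V y + C) R) + ennreal (J R y) \<partial>\<mu>)"
      by (rule nn_integral_add[symmetric]) (simp_all add: J_def)
    also have "\<dots> = (\<integral>\<^sup>+y. ennreal C + ennreal (min (V y) R) \<partial>\<mu>)"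
    proof (rule nn_integral_cong)
      fix y
      have "ennreal (min (l * V y + C) R) + ennreal (J R y) = ennreal (min (l * V y + C) R + J R y)"
        using J0[of R y] lV0[of y] C by simp
      also have "min (l * V y + C) R + J R y = C + min (V y) R" by (simp add: J_def)
      finally show "ennreal (min (l * V y + C) R) + ennreal (J R y) = ennreal C + ennreal (min (V y) R)"
        using C V0[of y] by simp
    qed
    also have "\<dots> = ennreal C + (\<integral>\<^sup>+y. ennreal (min (V y) R) \<partial>\<mu>)"
      by (simp add: nn_integral_add mu.emeasure_space_1)
    also have "\<dots> \<le> ?m + ennreal C" using trunc[of R] by (simp add: add.commute add_left_mono)
    finally show ?thesis using fin by (auto simp: ennreal_add_left_cancel_le)
  qed
  have lim: "(\<lambda>R. ennreal (J R y)) \<longlonglongrightarrow> ennreal (1 - l) * ennreal (V y)" for y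
  proof -
    obtain R0 :: nat where R0: "max (V y) (l * V y + C) \<le> R0" using real_arch_simple by blast
    have "J R y = (1 - l) * V y" if "R \<ge> R0" for R
    proof -
      have "real R0 \<le> real R" using that by simp
      then have "V y \<le> real R" "l * V y + C \<le> real R" using R0 by auto
      then show ?thesis by (simp add: J_def algebra_simps)
    qed
    then have "\<forall>\<^sub>F R in sequentially. ennreal (J R y) = ennreal (1 - l) * ennreal (V y)"
      using l V0[of y] by (intro eventually_mono[OF eventually_ge_at_top[of R0]]) (simp add: ennreal_mult)
    then show ?thesis by (rule tendsto_eventually)
  qed
  have "ennreal (1 - l) * (\<integral>\<^sup>+y. ennreal (V y) \<partial>\<mu>) = (\<integral>\<^sup>+y. ennreal (1 - l) * ennreal (V y) \<partial>\<mu>)"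
    by (rule nn_integral_cmult[symmetric]) measurable
  also have "\<dots> = (\<integral>\<^sup>+y. liminf (\<lambda>R. ennreal (J R y)) \<partial>\<mu>)"
    by (simp only: lim_imp_Liminf[OF sequentially_bot lim])
  also have "\<dots> \<le> liminf (\<lambda>R. \<integral>\<^sup>+y. ennreal (J R y) \<partial>\<mu>)"
    by (rule nn_integral_liminf) (simp add: J_def)
  also have "\<dots> \<le> ennreal C"
    by (rule order_trans[OF Liminf_le_Limsup Limsup_bounded]) (auto intro!: always_eventually J_le)
  also have "\<dots> = ennreal (1 - l) * ennreal (C / (1 - l))"
    using l C by (simp add: ennreal_mult[symmetric])
  finally show ?thesis using l by (simp add: ennreal_mult_le_mult_iff)
qed

lemma couplingsD:
  assumes "\<rho> \<in> couplings \<mu> \<nu>" "sets \<mu> = sets borel" "sets \<nu> = sets borel"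
  shows "sets \<rho> = sets (borel \<Otimes>\<^sub>M borel)" "preserves \<rho> \<mu> fst" "preserves \<rho> \<nu> snd"
proof -
  show sets: "sets \<rho> = sets (borel \<Otimes>\<^sub>M borel)"
    using assms by (auto simp: couplings_def cong: sets_pair_measure_cong)
  note [measurable_cong] = sets assms(2,3)
  show "preserves \<rho> \<mu> fst" "preserves \<rho> \<nu> snd"
    using assms by (auto simp: couplings_def preserves_def)
qed

lemma distr_pair_in_couplings:
  assumes X: "preserves Q \<mu> X" and Y: "preserves Q \<nu> Y"
  shows "distr Q (\<mu> \<Otimes>\<^sub>M \<nu>) (\<lambda>q. (X q, Y q)) \<in> couplings \<mu> \<nu>"
proof -
  note [measurable] = preservesD[OF X] preservesD[OF Y]
  have "distr (distr Q (\<mu> \<Otimes>\<^sub>M \<nu>) (\<lambda>q. (X q, Y q))) \<mu> fst = \<mu>"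
    using X by (subst distr_distr) (auto simp: preserves_def comp_def)
  moreover have "distr (distr Q (\<mu> \<Otimes>\<^sub>M \<nu>) (\<lambda>q. (X q, Y q))) \<nu> snd = \<nu>"
    using Y by (subst distr_distr) (auto simp: preserves_def comp_def)
  ultimately show ?thesis by (simp add: couplings_def)
qed

lemma (in prob_space) L2_le_const: "L2_le M (\<lambda>_. c) (norm c)"
  by (simp add: L2_le_def emeasure_space_1)

section \<open>Second moments of the stationary laws and the coupling update\<close>

context vec_smooth_convex
begin

text \<open>Restates invariance under the kernel as invariance of a map on state and noise, the form
  in which couplings are composed.\<close>

lemma rlmc_stationary_preserves:
  assumes "stationary_distribution (rlmc_kernel f h) \<mu>"
  shows "preserves (\<mu> \<Otimes>\<^sub>M rlmc_noise) \<mu> (\<lambda>(y, n). rlmc_step f h y n)"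
proof (rule preservesI)
  let ?N = "rlmc_noise :: (real \<times> (real^'n) \<times> (real^'n)) measure"
  interpret N: prob_space ?N by (rule prob_space_rlmc_noise)
  have \<mu> [measurable_cong]: "sets \<mu> = sets borel" and "prob_space \<mu>" and inv: "\<mu> \<bind> rlmc_kernel f h = \<mu>"
    using assms by (auto simp: stationary_distribution_def)
  show "(\<lambda>(y, n). rlmc_step f h y n) \<in> \<mu> \<Otimes>\<^sub>M ?N \<rightarrow>\<^sub>M \<mu>" by measurable
  have "(\<lambda>y. distr ?N borel (rlmc_step f h y)) \<in> \<mu> \<rightarrow>\<^sub>M subprob_algebra borel"
  proof (rule measurable_distr2)
    show "(\<lambda>(y, n). rlmc_step f h y n) \<in> \<mu> \<Otimes>\<^sub>M ?N \<rightarrow>\<^sub>M borel" by measurable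
    show "(\<lambda>y. ?N) \<in> \<mu> \<rightarrow>\<^sub>M subprob_algebra ?N"
      by (rule measurable_const) (simp add: space_subprob_algebra N.subprob_space_axioms)
  qed
  then have K: "rlmc_kernel f h \<in> \<mu> \<rightarrow>\<^sub>M subprob_algebra borel" by (simp add: rlmc_kernel_def[abs_def])
  fix F :: "real^'n \<Rightarrow> ennreal" assume F: "F \<in> borel_measurable \<mu>"
  then have [measurable]: "F \<in> borel_measurable borel" using measurable_cong_sets[OF \<mu> refl] by blast
  have "(\<integral>\<^sup>+y. F y \<partial>\<mu>) = (\<integral>\<^sup>+y. F y \<partial>(\<mu> \<bind> rlmc_kernel f h))" by (simp only: inv)
  also have "\<dots> = (\<integral>\<^sup>+y. \<integral>\<^sup>+x. F x \<partial>rlmc_kernel f h y \<partial>\<mu>)"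
    by (rule nn_integral_bind[OF _ K]) measurable
  also have "\<dots> = (\<integral>\<^sup>+y. \<integral>\<^sup>+n. F (rlmc_step f h y n) \<partial>?N \<partial>\<mu>)"
    unfolding rlmc_kernel_def by (intro nn_integral_cong nn_integral_distr) measurable
  also have "\<dots> = (\<integral>\<^sup>+x. F (case x of (y, n) \<Rightarrow> rlmc_step f h y n) \<partial>(\<mu> \<Otimes>\<^sub>M ?N))"
    by (subst N.nn_integral_fst[symmetric]) simp_all
  finally show "(\<integral>\<^sup>+x. F (case x of (y, n) \<Rightarrow> rlmc_step f h y n) \<partial>(\<mu> \<Otimes>\<^sub>M ?N)) = (\<integral>\<^sup>+y. F y \<partial>\<mu>)" ..
qed

text \<open>Only some finite \<open>B\<close> is wanted: it supplies the additive constant of the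
  drift inequality.\<close>

lemma rlmc_step_zero_L2:
  assumes h: "0 \<le> h"
  obtains B where "L2_le rlmc_noise (rlmc_step f h 0) B"
proof -
  let ?N = "rlmc_noise :: (real \<times> (real^'n) \<times> (real^'n)) measure"
  interpret N: prob_space ?N by (rule prob_space_rlmc_noise)
  define D where "D = (\<lambda>n :: real \<times> (real^'n) \<times> (real^'n). rlmc_midpoint f h 0 (fst n) (snd (snd n)))"
  have [measurable]: "D \<in> borel_measurable ?N" unfolding D_def rlmc_midpoint_def by measurable
  have "L2_le ?N (\<lambda>n. sqrt (2 * h) *\<^sub>R snd (snd n)) (\<bar>sqrt (2 * h)\<bar> * sqrt CARD('n))"
    by (rule L2_le_scaleR[OF rlmc_noise_L2(1)])
  then have U: "L2_le ?N (\<lambda>n. norm (sqrt (2 * h) *\<^sub>R snd (snd n))) (\<bar>sqrt (2 * h)\<bar> * sqrt CARD('n))"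
    by (rule L2_le_mono) auto
  have D: "AE n in ?N. norm (D n) \<le> norm (norm (h *\<^sub>R g 0) + norm (sqrt (2 * h) *\<^sub>R snd (snd n)))"
  proof (rule AE_mp[OF AE_rlmc_noise_fst], intro AE_I2 impI)
    fix n :: "real \<times> (real^'n) \<times> (real^'n)" assume a: "0 \<le> fst n \<and> fst n \<le> 1"
    have "D n = (- (fst n * h)) *\<^sub>R g 0 + sqrt (2 * fst n * h) *\<^sub>R snd (snd n)"
      by (simp add: D_def rlmc_midpoint_def gradient_eq)
    then have "norm (D n) \<le> norm ((- (fst n * h)) *\<^sub>R g 0) + norm (sqrt (2 * fst n * h) *\<^sub>R snd (snd n))"
      using norm_triangle_ineq by metis
    moreover have "norm ((- (fst n * h)) *\<^sub>R g 0) \<le> norm (h *\<^sub>R g 0)"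
      using a h by (auto simp: abs_mult mult.assoc intro!: mult_left_le_one_le)
    moreover have "norm (sqrt (2 * fst n * h) *\<^sub>R snd (snd n)) \<le> norm (sqrt (2 * h) *\<^sub>R snd (snd n))"
      using a h by (auto intro!: mult_right_mono simp: mult_left_le_one_le)
    ultimately show "norm (D n) \<le> norm (norm (h *\<^sub>R g 0) + norm (sqrt (2 * h) *\<^sub>R snd (snd n)))"
      by simp
  qed
  have D_L2: "L2_le ?N D (norm (norm (h *\<^sub>R g 0)) + \<bar>sqrt (2 * h)\<bar> * sqrt CARD('n))" (is "L2_le _ _ ?b")
  proof -
    have "L2_le ?N (\<lambda>n. norm (h *\<^sub>R g 0) + norm (sqrt (2 * h) *\<^sub>R snd (snd n))) ?b"
      by (rule L2_le_add[OF N.L2_le_const U])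
    then show ?thesis
    proof (unfold L2_le_def, elim conjE, intro conjI)
      assume "(\<integral>\<^sup>+n. ennreal ((norm (norm (h *\<^sub>R g 0) + norm (sqrt (2 * h) *\<^sub>R snd (snd n))))\<^sup>2) \<partial>?N) \<le> ennreal (?b\<^sup>2)"
      moreover have "(\<integral>\<^sup>+n. ennreal ((norm (D n))\<^sup>2) \<partial>?N)
          \<le> (\<integral>\<^sup>+n. ennreal ((norm (norm (h *\<^sub>R g 0) + norm (sqrt (2 * h) *\<^sub>R snd (snd n))))\<^sup>2) \<partial>?N)"
        using D by (intro nn_integral_mono_AE) (auto elim!: eventually_mono intro!: ennreal_leI power_mono)
      ultimately show "(\<integral>\<^sup>+n. ennreal ((norm (D n))\<^sup>2) \<partial>?N) \<le> ennreal (?b\<^sup>2)" by (rule order_trans[rotated])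
    qed auto
  qed
  have GD: "L2_le ?N (\<lambda>n. g (D n) - g 0) (\<bar>M\<bar> * ?b)"
    by (rule L2_le_mono[OF L2_le_scaleR[OF D_L2, of M]])
      (use g_lipschitz[of _ 0] M_pos in auto)
  have "L2_le ?N (\<lambda>n. (- h) *\<^sub>R g 0 + (- h) *\<^sub>R (g (D n) - g 0) + sqrt (2 * h) *\<^sub>R fst (snd n))
      (norm ((- h) *\<^sub>R g 0) + \<bar>- h\<bar> * (\<bar>M\<bar> * ?b) + \<bar>sqrt (2 * h)\<bar> * sqrt CARD('n))"
    by (intro L2_le_add L2_le_scaleR N.L2_le_const GD rlmc_noise_L2(2))
  moreover have "(\<lambda>n. (- h) *\<^sub>R g 0 + (- h) *\<^sub>R (g (D n) - g 0) + sqrt (2 * h) *\<^sub>R fst (snd n)) = rlmc_step f h 0"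
    by (auto simp: fun_eq_iff rlmc_step_def D_def gradient_eq algebra_simps)
  ultimately show ?thesis using that by simp
qed

text \<open>Comparison with the step from 0 under the same noise bounds the L2 norm of a step from
  \<open>y\<close> by \<open>r |y| + B\<close>, which becomes a drift inequality for
  \<open>|y|^2\<close>.\<close>

lemma rlmc_stationary_L2:
  assumes h: "0 \<le> h" "h * (m + M) \<le> 2" and rate: "rlmc_rate h < 1"
    and \<mu>: "sets \<mu> = sets borel" "prob_space \<mu>"
    and T: "preserves (\<mu> \<Otimes>\<^sub>M rlmc_noise) \<mu> (\<lambda>(y, n). rlmc_step f h y n)"
  obtains c where "L2_le \<mu> (\<lambda>y. y) c"
proof -
  let ?N = "rlmc_noise :: (real \<times> (real^'n) \<times> (real^'n)) measure"
  note [measurable_cong] = \<mu>(1)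
  define r where "r = rlmc_rate h"
  have r: "0 \<le> r" "r < 1" using rlmc_rate_nonneg[OF h] rate by (simp_all add: r_def)
  obtain B where B: "L2_le ?N (rlmc_step f h 0) B" using rlmc_step_zero_L2[OF h(1)] by blast
  \<comment> \<open>For nonzero \<open>r\<close> this weight leaves the gap
    \<open>1 - (1 + s) * r^2 = (1 - r^2) * (2 - r^2) / 2\<close>, which is positive.\<close>
  define s where "s = (if r = 0 then 1 else (1 - r\<^sup>2) / 2)"
  define l where "l = (1 + s) * r\<^sup>2"
  have r2: "r\<^sup>2 < 1" using r by (simp add: power_less_one_iff)
  have s: "0 < s" using r2 by (simp add: s_def)
  have l: "0 \<le> l" "l < 1"
  proof -
    show "0 \<le> l" using s by (simp add: l_def)
    show "l < 1"
    proof (cases "r = 0")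
      case False
      have "0 < (1 - r\<^sup>2) * (2 - r\<^sup>2)" using r2 by (intro mult_pos_pos) auto
      then show ?thesis using False by (simp add: l_def s_def field_simps power2_eq_square)
    qed (simp add: l_def)
  qed
  have drift: "(\<integral>\<^sup>+n. ennreal ((norm (case (y, n) of (y, n) \<Rightarrow> rlmc_step f h y n))\<^sup>2) \<partial>?N)
      \<le> ennreal (l * (norm y)\<^sup>2 + (1 + 1 / s) * B\<^sup>2)" for y
  proof -
    have "L2_le ?N (\<lambda>n. rlmc_step f h y n - rlmc_step f h 0 n) (r * norm y)"
      using rlmc_step_mean_contraction[OF h, of y 0] r
      by (simp add: L2_le_def r_def ennreal_mult[symmetric] power_mult_distrib)
    from L2_le_add[OF this B] have "L2_le ?N (rlmc_step f h y) (r * norm y + B)" by simp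
    then have "(\<integral>\<^sup>+n. ennreal ((norm (rlmc_step f h y n))\<^sup>2) \<partial>?N) \<le> ennreal ((r * norm y + B)\<^sup>2)"
      by (rule L2_leD)
    also have "\<dots> \<le> ennreal (l * (norm y)\<^sup>2 + (1 + 1 / s) * B\<^sup>2)"
      using square_add_le_weighted[OF s, of "r * norm y" B]
      by (intro ennreal_leI) (simp add: l_def power_mult_distrib mult.assoc)
    finally show ?thesis by simp
  qed
  have "(\<integral>\<^sup>+y. ennreal ((norm y)\<^sup>2) \<partial>\<mu>) \<le> ennreal ((1 + 1 / s) * B\<^sup>2 / (1 - l))"
    by (rule stationary_moment_of_drift[OF \<mu>(2) prob_space_rlmc_noise T _ _ drift l]) (use s in auto)
  then have "L2_le \<mu> (\<lambda>y. y) (sqrt ((1 + 1 / s) * B\<^sup>2 / (1 - l)))"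
    using s l by (simp add: L2_le_def)
  then show ?thesis by (rule that)
qed

text \<open>Strong monotonicity gives \<open>m |x| <= |g x - g 0|\<close>, so the second moment of
  the target reduces to that of its score.\<close>

lemma gibbs_L2: obtains c where "L2_le (gibbs f) (\<lambda>x. x) c"
proof -
  interpret P: prob_space "gibbs f" by (rule prob_space_gibbs)
  have "L2_le (gibbs f) (\<lambda>x. (1 / m) *\<^sub>R (g x + - g 0)) (\<bar>1 / m\<bar> * (sqrt (M * CARD('n)) + norm (- g 0)))"
    by (intro L2_le_scaleR L2_le_add gradient_L2 P.L2_le_const)
  then have "L2_le (gibbs f) (\<lambda>x. x) (\<bar>1 / m\<bar> * (sqrt (M * CARD('n)) + norm (- g 0)))"
  proof (rule L2_le_mono[OF _ _ _ order_refl])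
    show "AE x in gibbs f. norm x \<le> norm ((1 / m) *\<^sub>R (g x + - g 0))"
      using g_expanding[of _ 0] m_pos by (intro AE_I2) (simp only: norm_scaleR, simp add: field_simps)
  qed simp
  then show ?thesis by (rule that)
qed

text \<open>Step size times Lipschitz constant times the L2 distance covered from a stationary start
  within a step: the price of freezing the gradient at the starting point.\<close>

definition local_error :: "real \<Rightarrow> real" where
  "local_error h = h * M * (sqrt (2 * h * CARD('n)) + h * sqrt (M * CARD('n)))"

text \<open>The chain starts from the first coordinate of \<open>\<rho>\<close>, the midpoint step
  from the second, and both use the same Gaussian increment. Either motion leaves its own law
  invariant, so the final pair is again a coupling.\<close>

lemma coupling_update:
  assumes h: "0 < h" "h * (m + M) \<le> 2" and e: "0 < e"
    and \<mu>: "sets \<mu> = sets borel" "prob_space \<mu>"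
    and T: "preserves (\<mu> \<Otimes>\<^sub>M rlmc_noise) \<mu> (\<lambda>(y, n). rlmc_step f h y n)"
    and \<rho>: "\<rho> \<in> couplings (gibbs f) \<mu>" and L: "L2_le \<rho> (\<lambda>z. fst z - snd z) t"
  obtains \<rho>' where "\<rho>' \<in> couplings (gibbs f) \<mu>"
    "L2_le \<rho>' (\<lambda>z. fst z - snd z) (rlmc_rate h * t + 2 * local_error h + e)"
proof -
  let ?N = "rlmc_noise :: (real \<times> (real^'n) \<times> (real^'n)) measure"
  let ?G = "std_gaussian :: (real^'n) measure"
  let ?UG = "unit_uniform \<Otimes>\<^sub>M ?G"
  note \<rho>_facts = couplingsD[OF \<rho> sets_gibbs \<mu>(1)]
  note [measurable_cong] = \<mu>(1) \<rho>_facts(1)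
  have prob_\<rho>: "prob_space \<rho>"
    using \<rho>_facts(2) prob_space_gibbs preservesD[OF \<rho>_facts(2)] unfolding preserves_def
    by (metis prob_space_distrD)
  obtain k :: nat where k: "0 < k" and path: "L2_le (gibbs f \<Otimes>\<^sub>M mala_stream)
      (\<lambda>(x, w). mala_chain (h / k) k x w - x - noise_sum (h / k) k w + h *\<^sub>R g x) (local_error h + e)"
    using stationary_path_coupling[OF h(1) e] unfolding local_error_def by blast
  have d: "0 < h / k" using h k by simp
  have dk: "2 * (h / k) * k = 2 * h" using k by simp
  have prob_\<Omega>: "prob_space (mala_stream \<Otimes>\<^sub>M ?UG)"
    by (intro prob_space_pair prob_space_mala_stream prob_space_unit_uniform prob_space_std_gaussian)
  define Q where "Q = \<rho> \<Otimes>\<^sub>M (mala_stream \<Otimes>\<^sub>M ?UG)"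
  have prob_Q: "prob_space Q" unfolding Q_def by (rule prob_space_pair[OF prob_\<rho> prob_\<Omega>])
  \<comment> \<open>The increment of the chain rescaled to unit variance; it takes the place of
    \<open>U\<close>.\<close>
  define \<xi> where "\<xi> = (\<lambda>w. (1 / sqrt (2 * h)) *\<^sub>R noise_sum (h / k) k w)"
  have \<xi>: "preserves mala_stream ?G \<xi>"
    using noise_sum_gaussian[OF d k] unfolding dk \<xi>_def .
  \<comment> \<open>As \<open>U\<close> is already fixed by the chain, \<open>U'\<close> is
    completed from it with the fresh Gaussian \<open>q\<close>.\<close>
  define \<zeta> where "\<zeta> = (\<lambda>(w, a, q). (a :: real, \<xi> w, sqrt a *\<^sub>R \<xi> w + sqrt (1 - a) *\<^sub>R q))"
  have \<zeta>: "preserves (mala_stream \<Otimes>\<^sub>M ?UG) ?N \<zeta>"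
  proof -
    have "preserves (mala_stream \<Otimes>\<^sub>M ?UG) (?G \<Otimes>\<^sub>M ?UG) (\<lambda>(w, y). (\<xi> w, y))"
      by (intro preserves_prod \<xi> preserves_id prob_space_mala_stream prob_space_pair
          prob_space_unit_uniform prob_space_std_gaussian)
    from preserves_comp[OF this rlmc_noise_reversed_construction] show ?thesis
      by (simp add: \<zeta>_def case_prod_beta')
  qed
  define X where "X = (\<lambda>q :: ((real^'n) \<times> (real^'n)) \<times> ((real^'n) \<times> real) stream \<times> real \<times> (real^'n). mala_chain (h / k) k (fst (fst q)) (fst (snd q)))"
  define Y where "Y = (\<lambda>q :: ((real^'n) \<times> (real^'n)) \<times> ((real^'n) \<times> real) stream \<times> real \<times> (real^'n). rlmc_step f h (snd (fst q)) (\<zeta> (snd q)))"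
  have xw: "preserves Q (gibbs f \<Otimes>\<^sub>M mala_stream) (\<lambda>(z, y). (fst z, fst y))"
    unfolding Q_def
    by (intro preserves_prod \<rho>_facts preserves_fst prob_\<rho> prob_\<Omega> prob_space_pair
        prob_space_unit_uniform prob_space_std_gaussian)
  have yn: "preserves Q (\<mu> \<Otimes>\<^sub>M ?N) (\<lambda>(z, y). (snd z, \<zeta> y))"
    unfolding Q_def by (intro preserves_prod \<rho>_facts \<zeta> prob_\<rho> prob_\<Omega>)
  have xn: "preserves Q (gibbs f \<Otimes>\<^sub>M ?N) (\<lambda>(z, y). (fst z, \<zeta> y))"
    unfolding Q_def by (intro preserves_prod \<rho>_facts \<zeta> prob_\<rho> prob_\<Omega>)
  have zn: "preserves Q (\<rho> \<Otimes>\<^sub>M ?N) (\<lambda>(z, y). (z, \<zeta> y))"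
    unfolding Q_def by (intro preserves_prod preserves_id \<zeta> prob_\<rho> prob_\<Omega>)
  have X: "preserves Q (gibbs f) X"
    using preserves_comp[OF xw mala_chain_preserves_gibbs[OF d, of k]] by (simp add: X_def case_prod_beta')
  have Y: "preserves Q \<mu> Y"
    using preserves_comp[OF yn T] by (simp add: Y_def case_prod_beta')
  \<comment> \<open>The midpoint step from the target coordinate under the same noise, placed
    between \<open>X\<close> and \<open>Y\<close>.\<close>
  define X' where "X' = (\<lambda>q :: ((real^'n) \<times> (real^'n)) \<times> ((real^'n) \<times> real) stream \<times> real \<times> (real^'n). rlmc_step f h (fst (fst q)) (\<zeta> (snd q)))"
  have 1: "L2_le Q (\<lambda>q. X q - fst (fst q) - noise_sum (h / k) k (fst (snd q)) + h *\<^sub>R g (fst (fst q))) (local_error h + e)"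
    using L2_le_preserves[OF path xw] by (simp add: X_def case_prod_beta')
  have 2: "L2_le Q (\<lambda>q. h *\<^sub>R (g (rlmc_midpoint f h (fst (fst q)) (fst (\<zeta> (snd q))) (snd (snd (\<zeta> (snd q))))) - g (fst (fst q)))) (local_error h)"
  proof -
    have "L2_le (gibbs f \<Otimes>\<^sub>M ?N) (\<lambda>y. M *\<^sub>R (case y of (x, n) \<Rightarrow> rlmc_midpoint f h x (fst n) (snd (snd n)) - x))
        (\<bar>M\<bar> * (h * sqrt (M * CARD('n)) + sqrt (2 * h * CARD('n))))"
      using h by (intro L2_le_scaleR rlmc_midpoint_displacement gradient_L2 prob_space_gibbs) auto
    then have "L2_le (gibbs f \<Otimes>\<^sub>M ?N) (\<lambda>(x, n). g (rlmc_midpoint f h x (fst n) (snd (snd n))) - g x)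
        (\<bar>M\<bar> * (h * sqrt (M * CARD('n)) + sqrt (2 * h * CARD('n))))"
    proof (rule L2_le_mono[OF _ _ _ order_refl])
      show "(\<lambda>(x, n). g (rlmc_midpoint f h x (fst n) (snd (snd n))) - g x) \<in> borel_measurable (gibbs f \<Otimes>\<^sub>M ?N)"
        unfolding rlmc_midpoint_def gradient_eq by measurable
    qed (use g_lipschitz M_pos in auto)
    from L2_le_scaleR[OF L2_le_preserves[OF this xn], of h] show ?thesis
      using h M_pos by (simp add: local_error_def case_prod_beta' mult.assoc add.commute)
  qed
  have 3: "L2_le Q (\<lambda>q. X' q - Y q) (rlmc_rate h * t)"
    using L2_le_preserves[OF rlmc_step_L2_contraction[OF less_imp_le[OF h(1)] h(2) \<rho>_facts(1) L] zn]
    by (simp add: X'_def Y_def case_prod_beta')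
  \<comment> \<open>The first two terms meet at the Euler step with gradient frozen at
    \<open>fst (fst q)\<close>; the third is the contraction.\<close>
  have decomp: "X q - Y q = (X q - fst (fst q) - noise_sum (h / k) k (fst (snd q)) + h *\<^sub>R g (fst (fst q)))
      + h *\<^sub>R (g (rlmc_midpoint f h (fst (fst q)) (fst (\<zeta> (snd q))) (snd (snd (\<zeta> (snd q))))) - g (fst (fst q)))
      + (X' q - Y q)" for q
  proof -
    have "sqrt (2 * h) *\<^sub>R fst (snd (\<zeta> (snd q))) = noise_sum (h / k) k (fst (snd q))"
      using h by (simp add: \<zeta>_def \<xi>_def case_prod_beta')
    then have "X' q = fst (fst q) - h *\<^sub>R g (rlmc_midpoint f h (fst (fst q)) (fst (\<zeta> (snd q))) (snd (snd (\<zeta> (snd q)))))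
        + noise_sum (h / k) k (fst (snd q))"
      by (simp add: X'_def rlmc_step_def case_prod_beta' gradient_eq)
    then show ?thesis by (simp add: algebra_simps)
  qed
  have XY: "L2_le Q (\<lambda>q. X q - Y q) (local_error h + e + local_error h + rlmc_rate h * t)"
    unfolding decomp by (rule L2_le_add[OF L2_le_add[OF 1 2] 3])
  note [measurable] = preservesD[OF X] preservesD[OF Y]
  let ?\<rho>' = "distr Q (gibbs f \<Otimes>\<^sub>M \<mu>) (\<lambda>q. (X q, Y q))"
  have "L2_le ?\<rho>' (\<lambda>z. fst z - snd z) (local_error h + e + local_error h + rlmc_rate h * t)"
    using XY unfolding L2_le_def by (subst nn_integral_distr) (auto simp: measurable_distr_eq1)
  then have "L2_le ?\<rho>' (\<lambda>z. fst z - snd z) (rlmc_rate h * t + 2 * local_error h + e)"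
    by (simp add: algebra_simps)
  with distr_pair_in_couplings[OF X Y] show ?thesis by (rule that)
qed

text \<open>Near-optimal couplings suffice: slack \<open>e\<close> in the coupling and in the path
  error gives \<open>D <= c (D + e) + 2 E + e\<close>, and \<open>e\<close> is arbitrary.\<close>

lemma W2_gibbs_stationary:
  assumes h: "0 < h" "h * (m + M) \<le> 2" and rate: "rlmc_rate h < 1"
    and stat: "stationary_distribution (rlmc_kernel f h) \<mu>"
  shows "W2 (gibbs f) \<mu> \<le> ennreal (2 * local_error h / (1 - rlmc_rate h))"
proof -
  have \<mu>: "sets \<mu> = sets borel" "prob_space \<mu>"
    using stat by (auto simp: stationary_distribution_def)
  note [measurable_cong] = \<mu>(1)
  note T = rlmc_stationary_preserves[OF stat]
  define c where "c = rlmc_rate h"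
  have c: "0 \<le> c" "c < 1" using rate rlmc_rate_nonneg[OF less_imp_le[OF h(1)] h(2)] by (simp_all add: c_def)
  define S where "S = (INF \<rho> \<in> couplings (gibbs f) \<mu>. \<integral>\<^sup>+ z. ennreal ((dist (fst z) (snd z))\<^sup>2) \<partial>\<rho>)"
  have S_le: "S \<le> ennreal (t\<^sup>2)" if "\<rho> \<in> couplings (gibbs f) \<mu>" "L2_le \<rho> (\<lambda>z. fst z - snd z) t" for \<rho> t
    unfolding S_def using that by (intro INF_lower2[OF that(1)]) (simp add: L2_le_def dist_norm)
  obtain c1 where c1: "L2_le (gibbs f) (\<lambda>x. x) c1" using gibbs_L2 by blast
  obtain c2 where c2: "L2_le \<mu> (\<lambda>y. y) c2"
    using rlmc_stationary_L2[OF less_imp_le[OF h(1)] h(2) rate \<mu> T] by blast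
  have pf: "preserves (gibbs f \<Otimes>\<^sub>M \<mu>) (gibbs f) fst" by (rule preserves_fst[OF \<mu>(2)])
  have ps: "preserves (gibbs f \<Otimes>\<^sub>M \<mu>) \<mu> snd" by (rule preserves_snd[OF prob_space_gibbs \<mu>(2)])
  have "gibbs f \<Otimes>\<^sub>M \<mu> \<in> couplings (gibbs f) \<mu>" using pf ps by (simp add: couplings_def preserves_def)
  moreover have "L2_le (gibbs f \<Otimes>\<^sub>M \<mu>) (\<lambda>z. fst z + (- 1) *\<^sub>R snd z) (c1 + \<bar>- 1\<bar> * c2)"
    by (intro L2_le_add L2_le_scaleR L2_le_preserves[OF c1 pf] L2_le_preserves[OF c2 ps])
  \<comment> \<open>The product coupling has finite cost because both laws have second moments;
    without finiteness the recursive inequality would be void.\<close>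
  ultimately have "S \<le> ennreal ((c1 + c2)\<^sup>2)" by (intro S_le) simp_all
  then have "S < \<infinity>" by (auto intro: le_less_trans)
  then obtain s where s: "0 \<le> s" "S = ennreal s" by (cases S) auto
  define D where "D = sqrt s"
  have D: "0 \<le> D" "S = ennreal (D\<^sup>2)" using s by (simp_all add: D_def)
  have E: "0 \<le> local_error h" using h M_pos by (simp add: local_error_def)
  have step: "D \<le> c * (D + e) + 2 * local_error h + e" if e: "0 < e" for e
  proof -
    have "S < ennreal ((D + e)\<^sup>2)" using D e by (simp add: ennreal_less_iff power2_eq_square algebra_simps add_pos_nonneg)
    then obtain \<rho> where \<rho>: "\<rho> \<in> couplings (gibbs f) \<mu>"
      and cost: "(\<integral>\<^sup>+ z. ennreal ((dist (fst z) (snd z))\<^sup>2) \<partial>\<rho>) < ennreal ((D + e)\<^sup>2)"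
      unfolding S_def by (auto simp: INF_less_iff)
    note [measurable_cong] = couplingsD(1)[OF \<rho> sets_gibbs \<mu>(1)]
    have "L2_le \<rho> (\<lambda>z. fst z - snd z) (D + e)"
      using cost D e by (simp add: L2_le_def dist_norm)
    then obtain \<rho>' where "\<rho>' \<in> couplings (gibbs f) \<mu>" "L2_le \<rho>' (\<lambda>z. fst z - snd z) (c * (D + e) + 2 * local_error h + e)"
      using coupling_update[OF h e \<mu> T \<rho>] unfolding c_def by blast
    then have "ennreal (D\<^sup>2) \<le> ennreal ((c * (D + e) + 2 * local_error h + e)\<^sup>2)"
      using S_le D by metis
    then have "D\<^sup>2 \<le> (c * (D + e) + 2 * local_error h + e)\<^sup>2" by (simp add: ennreal_le_iff)
    then show ?thesis by (rule power2_le_imp_le) (use c D E e in simp)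
  qed
  have "D * (1 - c) \<le> 2 * local_error h"
  proof (rule field_le_epsilon)
    fix e :: real assume e: "0 < e"
    have "D \<le> c * (D + e / 2) + 2 * local_error h + e / 2" using step[of "e / 2"] e by simp
    moreover have "c * (e / 2) \<le> e / 2" using c e by (simp add: mult_left_le_one_le)
    ultimately show "D * (1 - c) \<le> 2 * local_error h + e" by (simp add: algebra_simps)
  qed
  then have "D \<le> 2 * local_error h / (1 - c)" using c by (simp add: field_simps)
  moreover have "W2 (gibbs f) \<mu> = ennreal D"
    unfolding W2_def S_def[symmetric] by (simp add: esqrt_def s D_def)
  ultimately show ?thesis by (simp add: c_def ennreal_leI)
qed

end

section \<open>Explicit constants and the final bound\<close>

lemma rlmc_constant_bound:
  fixes M h n :: real
  assumes "0 < M" "0 < h" "0 \<le> n"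
  shows "2 * (sqrt (2 * h * n) + h * sqrt (M * n)) \<le> 3 * sqrt (n * h) * (1 + 2 * M * h)\<^sup>2"
proof -
  define u where "u = sqrt (M * h)"
  have u: "0 \<le> u" "u\<^sup>2 = M * h" using assms by (simp_all add: u_def)
  \<comment> \<open>Leaves room for the loss below:
    \<open>2 * 283 / 200 + 1 / 12 < 3\<close>.\<close>
  have s2: "sqrt 2 \<le> 283 / 200" by (rule real_le_lsqrt) (auto simp: power2_eq_square)
  have hM: "h * sqrt (M * n) = sqrt (n * h) * u"
  proof -
    have "h * sqrt (M * n) = sqrt (h * h) * sqrt (M * n)" using assms by simp
    also have "\<dots> = sqrt (n * h) * u" unfolding u_def real_sqrt_mult[symmetric] by (simp add: mult_ac)
    finally show ?thesis .
  qed
  have "sqrt (2 * h * n) = sqrt (n * h) * sqrt 2" by (simp add: real_sqrt_mult)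
  then have "2 * (sqrt (2 * h * n) + h * sqrt (M * n)) = sqrt (n * h) * (2 * (sqrt 2 + u))"
    by (simp only: hM) (simp add: algebra_simps)
  also have "\<dots> \<le> sqrt (n * h) * (3 * (1 + 2 * u\<^sup>2)\<^sup>2)"
  proof (rule mult_left_mono)
    \<comment> \<open>The linear term \<open>2 u\<close> is absorbed by the mixed term
      \<open>12 u^2\<close> of the expanded right-hand side, at the cost of
      \<open>1 / 12\<close>.\<close>
    have "0 \<le> (12 * u - 1)\<^sup>2" by simp
    then have "2 * u \<le> 12 * u\<^sup>2 + 1 / 12" by (simp add: power2_eq_square algebra_simps)
    moreover have eq: "3 * (1 + 2 * u\<^sup>2)\<^sup>2 = 3 + 12 * u\<^sup>2 + 12 * (u\<^sup>2)\<^sup>2" by (simp add: power2_eq_square algebra_simps)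
    moreover have "0 \<le> (u\<^sup>2)\<^sup>2" by simp
    ultimately show "2 * (sqrt 2 + u) \<le> 3 * (1 + 2 * u\<^sup>2)\<^sup>2" unfolding eq using s2 by argo
  qed (use assms in simp)
  finally show ?thesis by (simp add: u(2) mult_ac)
qed

text \<open>Passage from the descriptive definitions to the locale: Riesz representation in the
  standard basis exhibits a gradient, and uniqueness identifies it with
  \<open>gradient f\<close>.\<close>

lemma C2_smooth_convex:
  fixes f :: "real^'n \<Rightarrow> real"
  assumes "C2 f" "0 < m" "m \<le> M"
    and lower: "\<And>x. loewner_le (m *\<^sub>R mat 1) (hessian f x)"
    and upper: "\<And>x. loewner_le (hessian f x) (M *\<^sub>R mat 1)"
  shows "vec_smooth_convex f (gradient f) (\<lambda>x v. hessian f x *v v) m M"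
proof -
  have f_diff: "f differentiable (at x)" and g_diff: "gradient f differentiable (at x)" for x
    using assms(1) by (auto simp: C2_def)
  have f_deriv: "(f has_derivative (\<lambda>v. gradient f x \<bullet> v)) (at x)" for x
  proof -
    obtain f' where f': "(f has_derivative f') (at x)" using f_diff unfolding differentiable_def by blast
    then interpret bounded_linear f' by (rule has_derivative_bounded_linear)
    define D where "D = (\<Sum>b\<in>Basis. f' b *\<^sub>R b)"
    have "f' = (\<lambda>v. v \<bullet> D)"
    proof
      fix v
      have "f' v = f' (\<Sum>b\<in>Basis. (v \<bullet> b) *\<^sub>R b)" by (simp add: euclidean_representation)
      also have "\<dots> = (\<Sum>b\<in>Basis. (v \<bullet> b) * f' b)" by (simp add: sum scaleR)
      finally show "f' v = v \<bullet> D" by (simp add: D_def inner_sum_right mult.commute)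
    qed
    then have D: "GDERIV f x :> D" using f' by (simp add: gderiv_def)
    from gradient_eqI[OF this] have "gradient f x = D" .
    then show ?thesis using D by (simp add: gderiv_def inner_commute)
  qed
  have g_deriv: "(gradient f has_derivative (\<lambda>v. hessian f x *v v)) (at x)" for x
  proof -
    have 1: "(gradient f has_derivative frechet_derivative (gradient f) (at x)) (at x)"
      using g_diff frechet_derivative_works by blast
    then have "linear (frechet_derivative (gradient f) (at x))" by (rule has_derivative_linear)
    then have "frechet_derivative (gradient f) (at x) = (\<lambda>v. hessian f x *v v)"
      by (simp add: hessian_def fun_eq_iff matrix_works)
    with 1 show ?thesis by simp
  qed
  show ?thesis
  proof (unfold_locales)
    show "m * (v \<bullet> v) \<le> v \<bullet> (hessian f x *v v)" for x v
      using lower[of x] unfolding loewner_le_def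
      by (auto simp: matrix_vector_mult_diff_rdistrib inner_diff_right scaleR_matrix_vector_assoc[symmetric] dest: spec[of _ v])
    show "v \<bullet> (hessian f x *v v) \<le> M * (v \<bullet> v)" for x v
      using upper[of x] unfolding loewner_le_def
      by (auto simp: matrix_vector_mult_diff_rdistrib inner_diff_right scaleR_matrix_vector_assoc[symmetric] dest: spec[of _ v])
  qed (use f_deriv g_deriv assms in auto)
qed

theorem proposition2p2:
  fixes f :: "real^'n \<Rightarrow> real"
    and m M \<kappa> h :: real
    and \<pi>\<^sub>h :: "(real^'n) measure"
  assumes "C2 f"
    and "0 < m" and "m \<le> M"
    and "\<And>x. loewner_le (m *\<^sub>R mat 1) (hessian f x)"
    and "\<And>x. loewner_le (hessian f x) (M *\<^sub>R mat 1)"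
    and "\<kappa> = M / m"
    and "0 < h" and "h < 2 / (m + M)"
    and "0 < 1 / \<kappa> - M * h / sqrt 3"
    and "stationary_distribution (rlmc_kernel f h) \<pi>\<^sub>h"
  shows "W2 (gibbs f) \<pi>\<^sub>h \<le>
    ennreal (3 * sqrt (real CARD('n) * h) * ((1 + 2 * M * h)\<^sup>2 / (1 / \<kappa> - M * h / sqrt 3)))"
proof -
  interpret vec_smooth_convex f "gradient f" "\<lambda>x v. hessian f x *v v" m M
    by (rule C2_smooth_convex) (fact assms)+
  define q where "q = 1 / \<kappa> - M * h / sqrt 3"
  have q: "0 < q" using assms(9) by (simp add: q_def)
  have "h * (m + M) \<le> 2" using \<open>h < 2 / (m + M)\<close> m_pos M_pos by (simp add: field_simps)
  \<comment> \<open>The factor \<open>h * M\<close> also sits in \<open>local_error\<close> and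
    cancels, leaving \<open>q\<close> as denominator; positivity of \<open>q\<close> makes the rate
    less than 1.\<close>
  moreover have rate: "1 - rlmc_rate h = h * M * q"
    using m_pos M_pos by (simp add: rlmc_rate_def q_def \<open>\<kappa> = M / m\<close> field_simps power2_eq_square)
  moreover have hM: "0 < h * M" using \<open>0 < h\<close> M_pos by simp
  moreover have "0 < h * M * q" using hM q by simp
  ultimately have "W2 (gibbs f) \<pi>\<^sub>h \<le> ennreal (2 * local_error h / (h * M * q))"
    using W2_gibbs_stationary[OF \<open>0 < h\<close> _ _ assms(10)] by simp
  also have "2 * local_error h / (h * M * q)
      = 2 * (sqrt (2 * h * CARD('n)) + h * sqrt (M * CARD('n))) / q"
    using M_pos \<open>0 < h\<close> by (simp add: local_error_def)
  also have "ennreal \<dots> \<le> ennreal (3 * sqrt (CARD('n) * h) * (1 + 2 * M * h)\<^sup>2 / q)"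
    using q \<open>0 < h\<close> M_pos by (intro ennreal_leI divide_right_mono rlmc_constant_bound) auto
  finally show ?thesis by (simp add: q_def)
qed

end
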